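(* Let $\{\rho^{B_1B_2}_{x_1,x_2}\}_{x_1\in\mathcal{X}_1,x_2\in\mathcal{X}_2}$ be a classical-quantum interference channel with finite input alphabets. Define $\mathcal{R}_{\mathrm{Sato}}$ as the union, over finite sets $\mathcal{Q}$ and input distributions of the form $p_Q(q)p_{X_1|Q}(x_1|q)p_{X_2|Q}(x_2|q)$, of the sets of rate pairs $(R_1,R_2)$ satisfying $$R_1\le I(X_1;B_1|X_2Q)_\theta,\quad R_2\le I(X_2;B_2|X_1Q)_\theta,\quad R_1+R_2\le I(X_1X_2;B_1B_2|Q)_\theta,$$ where $\theta=\sum_{q,x_1,x_2}p_Q(q)p_{X_1|Q}(x_1|q)p_{X_2|Q}(x_2|q)|q\rangle\langle q|^Q\otimes|x_1\rangle\langle x_1|^{X_1}\otimes|x_2\rangle\langle x_2|^{X_2}\otimes\rho^{B_1B_2}_{x_1,x_2}$. Then the capacity region of the interference channel is contained in $\mathcal{R}_{\mathrm{Sato}}$.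
   Context: A cc-qq interference channel maps classical inputs $(x_1,x_2)$ to a state $\rho^{B_1B_2}_{x_1,x_2}$ on finite-dimensional $\mathcal{H}^{B_1}\otimes\mathcal{H}^{B_2}$; used $n$ times memorylessly it outputs the tensor product state. An $(n,R_1,R_2,\epsilon)$ code consists of codebooks $\{x_1^n(m_1)\}$, $\{x_2^n(m_2)\}$ with $|\mathcal{M}_i|=2^{nR_i}$, a POVM $\{\Lambda_{m_1}\}$ on $B_1^n$ and a POVM $\{\Gamma_{m_2}\}$ on $B_2^n$, with average error $\frac{1}{|\mathcal{M}_1||\mathcal{M}_2|}\sum_{m_1,m_2}\mathrm{Tr}\{(I-\Lambda_{m_1}\otimes\Gamma_{m_2})\rho_{x_1^n(m_1),x_2^n(m_2)}\}\le\epsilon$. A rate pair is achievable if for all $\epsilon,\delta>0$ and sufficiently large $n$ an $(n,R_1-\delta,R_2-\delta,\epsilon)$ code exists; the capacity region is the closure of the set of achievable rate pairs. Information quantities are von Neumann-entropy based. *)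

theory Defs
  imports "HOL-Analysis.Analysis" "Jordan_Normal_Form.Char_Poly"
begin

definition mtrace :: "complex mat \<Rightarrow> complex" where
  "mtrace A = (\<Sum>i<dim_row A. A $$ (i, i))"

definition hermitian :: "nat \<Rightarrow> complex mat \<Rightarrow> bool" where
  "hermitian D A \<longleftrightarrow> A \<in> carrier_mat D D \<and> (\<forall>i<D. \<forall>j<D. A $$ (j, i) = cnj (A $$ (i, j)))"

definition psd :: "nat \<Rightarrow> complex mat \<Rightarrow> bool" where
  "psd D A \<longleftrightarrow> hermitian D A \<and>
     (\<forall>v :: nat \<Rightarrow> complex. 0 \<le> Re (\<Sum>i<D. \<Sum>j<D. cnj (v i) * A $$ (i, j) * v j))"

definition density :: "nat \<Rightarrow> complex mat \<Rightarrow> bool" where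
  "density D A \<longleftrightarrow> psd D A \<and> mtrace A = 1"

definition povm :: "nat \<Rightarrow> nat \<Rightarrow> (nat \<Rightarrow> complex mat) \<Rightarrow> bool" where
  "povm D M P \<longleftrightarrow> (\<forall>m<M. psd D (P m)) \<and>
     (\<forall>i<D. \<forall>j<D. (\<Sum>m<M. P m $$ (i, j)) = (1\<^sub>m D) $$ (i, j))"

definition kron :: "complex mat \<Rightarrow> complex mat \<Rightarrow> complex mat" where
  "kron A B = mat (dim_row A * dim_row B) (dim_col A * dim_col B)
     (\<lambda>(i, j). A $$ (i div dim_row B, j div dim_col B) * B $$ (i mod dim_row B, j mod dim_col B))"

definition ketbra :: "nat \<Rightarrow> nat \<Rightarrow> complex mat" where
  "ketbra d x = mat d d (\<lambda>(i, j). if i = x \<and> j = x then 1 else 0)"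

definition eta :: "real \<Rightarrow> real" where
  "eta t = (if t \<le> 0 then 0 else - t * log 2 t)"

definition vn_entropy :: "complex mat \<Rightarrow> real" where
  "vn_entropy A = (\<Sum>z\<in>{z. eigenvalue A z}. real (order z (char_poly A)) * eta (Re z))"

text \<open>A system with local dimensions ds (a list) has total dimension prod_list ds; a global index
  is written in mixed radix with the first subsystem most significant (consistent with kron).\<close>

definition digit :: "nat list \<Rightarrow> nat \<Rightarrow> nat \<Rightarrow> nat" where
  "digit ds a k = (a div prod_list (drop (Suc k) ds)) mod (ds ! k)"

definition enc :: "nat list \<Rightarrow> (nat \<Rightarrow> nat) \<Rightarrow> nat" where
  "enc ds f = (\<Sum>k<length ds. f k * prod_list (drop (Suc k) ds))"

definition kept :: "nat list \<Rightarrow> nat set \<Rightarrow> nat list" where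
  "kept ds K = sorted_list_of_set (K \<inter> {..<length ds})"

definition kept_index :: "nat list \<Rightarrow> nat set \<Rightarrow> nat \<Rightarrow> nat" where
  "kept_index ds K a = enc (map ((!) ds) (kept ds K)) (\<lambda>m. digit ds a (kept ds K ! m))"

definition ptrace :: "nat list \<Rightarrow> nat set \<Rightarrow> complex mat \<Rightarrow> complex mat" where
  "ptrace ds K A = (let N = prod_list ds; DK = prod_list (map ((!) ds) (kept ds K)) in
     mat DK DK (\<lambda>(i, j). \<Sum>a<N. \<Sum>b<N.
        if kept_index ds K a = i \<and> kept_index ds K b = j \<and>
           (\<forall>k<length ds. k \<notin> K \<longrightarrow> digit ds a k = digit ds b k)
        then A $$ (a, b) else 0))"

definition Hsub :: "nat list \<Rightarrow> complex mat \<Rightarrow> nat set \<Rightarrow> real" where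
  "Hsub ds A K = vn_entropy (ptrace ds K A)"

definition cmi :: "nat list \<Rightarrow> complex mat \<Rightarrow> nat set \<Rightarrow> nat set \<Rightarrow> nat set \<Rightarrow> real" where
  "cmi ds A SA SB SC = Hsub ds A (SA \<union> SC) + Hsub ds A (SB \<union> SC) - Hsub ds A (SA \<union> SB \<union> SC) - Hsub ds A SC"

text \<open>Input alphabets X1 = {0..<a1}, X2 = {0..<a2}; output spaces of dimensions d1 (B1) and d2 (B2);
  rho x1 x2 is a density matrix on B1 tensor B2 (dimension d1*d2, kron convention).\<close>
definition is_ccqq_channel :: "nat \<Rightarrow> nat \<Rightarrow> nat \<Rightarrow> nat \<Rightarrow> (nat \<Rightarrow> nat \<Rightarrow> complex mat) \<Rightarrow> bool" where
  "is_ccqq_channel a1 a2 d1 d2 rho \<longleftrightarrow> 0 < a1 \<and> 0 < a2 \<and> 0 < d1 \<and> 0 < d2 \<and>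
     (\<forall>x1<a1. \<forall>x2<a2. density (d1 * d2) (rho x1 x2))"

text \<open>n-fold memoryless output for input sequences u1, u2 (functions of time t<n), written on
  B1^n tensor B2^n (the B1 block is most significant): this is the tensor product of the rho(u1 t, u2 t),
  with the subsystems reordered from (B1 B2)^n to B1^n B2^n.\<close>
definition out_state :: "nat \<Rightarrow> nat \<Rightarrow> (nat \<Rightarrow> nat \<Rightarrow> complex mat) \<Rightarrow> nat \<Rightarrow> (nat \<Rightarrow> nat) \<Rightarrow> (nat \<Rightarrow> nat) \<Rightarrow> complex mat" where
  "out_state d1 d2 rho n u1 u2 = mat (d1 ^ n * d2 ^ n) (d1 ^ n * d2 ^ n) (\<lambda>(a, b).
     \<Prod>t<n. rho (u1 t) (u2 t) $$
       (digit (replicate n d1) (a div d2 ^ n) t * d2 + digit (replicate n d2) (a mod d2 ^ n) t,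
        digit (replicate n d1) (b div d2 ^ n) t * d2 + digit (replicate n d2) (b mod d2 ^ n) t))"

definition msize :: "nat \<Rightarrow> real \<Rightarrow> nat" where
  "msize n R = nat \<lceil>2 powr (real n * R)\<rceil>"

definition has_code :: "nat \<Rightarrow> nat \<Rightarrow> nat \<Rightarrow> nat \<Rightarrow> (nat \<Rightarrow> nat \<Rightarrow> complex mat) \<Rightarrow> nat \<Rightarrow> real \<Rightarrow> real \<Rightarrow> real \<Rightarrow> bool" where
  "has_code a1 a2 d1 d2 rho n R1 R2 eps \<longleftrightarrow>
    (let M1 = msize n R1; M2 = msize n R2 in
     \<exists>c1 c2 :: nat \<Rightarrow> nat \<Rightarrow> nat. \<exists>Lam Gam :: nat \<Rightarrow> complex mat.
       (\<forall>m<M1. \<forall>t<n. c1 m t < a1) \<and> (\<forall>m<M2. \<forall>t<n. c2 m t < a2) \<and>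
       povm (d1 ^ n) M1 Lam \<and> povm (d2 ^ n) M2 Gam \<and>
       (1 / (real M1 * real M2)) * (\<Sum>m1<M1. \<Sum>m2<M2.
          Re (mtrace ((1\<^sub>m (d1 ^ n * d2 ^ n) - kron (Lam m1) (Gam m2)) *
                      out_state d1 d2 rho n (c1 m1) (c2 m2)))) \<le> eps)"

definition achievable :: "nat \<Rightarrow> nat \<Rightarrow> nat \<Rightarrow> nat \<Rightarrow> (nat \<Rightarrow> nat \<Rightarrow> complex mat) \<Rightarrow> real \<times> real \<Rightarrow> bool" where
  "achievable a1 a2 d1 d2 rho R \<longleftrightarrow>
     (\<forall>eps>0. \<forall>delta>0. \<exists>N. \<forall>n\<ge>N. has_code a1 a2 d1 d2 rho n (fst R - delta) (snd R - delta) eps)"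

definition capacity_region :: "nat \<Rightarrow> nat \<Rightarrow> nat \<Rightarrow> nat \<Rightarrow> (nat \<Rightarrow> nat \<Rightarrow> complex mat) \<Rightarrow> (real \<times> real) set" where
  "capacity_region a1 a2 d1 d2 rho = closure {R. achievable a1 a2 d1 d2 rho R}"

text \<open>Subsystems of theta: 0 = Q (dim k), 1 = X1 (dim a1), 2 = X2 (dim a2), 3 = B1 (dim d1), 4 = B2 (dim d2).\<close>
definition theta :: "nat \<Rightarrow> nat \<Rightarrow> nat \<Rightarrow> nat \<Rightarrow> (nat \<Rightarrow> nat \<Rightarrow> complex mat) \<Rightarrow> nat \<Rightarrow>
    (nat \<Rightarrow> real) \<Rightarrow> (nat \<Rightarrow> nat \<Rightarrow> real) \<Rightarrow> (nat \<Rightarrow> nat \<Rightarrow> real) \<Rightarrow> complex mat" where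
  "theta a1 a2 d1 d2 rho k pQ p1 p2 = (let N = k * a1 * a2 * (d1 * d2) in
     mat N N (\<lambda>(i, j). \<Sum>q<k. \<Sum>x1<a1. \<Sum>x2<a2.
       complex_of_real (pQ q * p1 q x1 * p2 q x2) *
       kron (ketbra k q) (kron (ketbra a1 x1) (kron (ketbra a2 x2) (rho x1 x2))) $$ (i, j)))"

definition is_distr :: "nat \<Rightarrow> (nat \<Rightarrow> real) \<Rightarrow> bool" where
  "is_distr n p \<longleftrightarrow> (\<forall>i<n. 0 \<le> p i) \<and> (\<Sum>i<n. p i) = 1"

definition sato_region :: "nat \<Rightarrow> nat \<Rightarrow> nat \<Rightarrow> nat \<Rightarrow> (nat \<Rightarrow> nat \<Rightarrow> complex mat) \<Rightarrow> (real \<times> real) set" where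
  "sato_region a1 a2 d1 d2 rho = {(R1, R2). \<exists>k>0. \<exists>pQ p1 p2.
     is_distr k pQ \<and> (\<forall>q<k. is_distr a1 (p1 q) \<and> is_distr a2 (p2 q)) \<and>
     (let ds = [k, a1, a2, d1, d2]; th = theta a1 a2 d1 d2 rho k pQ p1 p2 in
       R1 \<le> cmi ds th {1} {3} {2, 0} \<and>
       R2 \<le> cmi ds th {2} {4} {1, 0} \<and>
       R1 + R2 \<le> cmi ds th {1, 2} {3, 4} {0})}"

end

theory Submission
  imports Defs
begin

text \<open>For a single test \<open>0 \<le> L \<le> 1\<close> of a state \<open>R\<close> against a state \<open>S\<close>, the operator inequality
  \<open>L \<ge> L\<^sup>2\<close> bounds \<open>(1 - Tr R L) + c Tr S L\<close> from below by half of \<open>\<Sum> min (P, c Q)\<close>, where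
  \<open>P (j, k) = r\<^sub>j w\<^sub>j\<^sub>k\<close> and \<open>Q (j, k) = s\<^sub>k w\<^sub>j\<^sub>k\<close> are classical distributions built from the eigenvalues and
  the overlaps \<open>w\<^sub>j\<^sub>k\<close> of the eigenbases, whose relative entropy is \<open>D(R\<parallel>S)\<close>. With \<open>c\<close> proportional to
  the number \<open>M\<close> of messages, a reliable code forces \<open>P > c Q\<close> with high \<open>P\<close>-probability, so the
  average of \<open>D(R\<^sub>m\<parallel>S)\<close> is at least about \<open>log M\<close>. This replaces the Holevo bound and Fano's
  inequality. Choosing for \<open>S\<close> the tensor product over time of the message averages makes the
  relative entropy single-letter, with time as the time-sharing variable \<open>Q\<close>. For \<open>R\<^sub>1\<close> the message
  of the second sender is fixed and \<open>B\<^sub>2\<close> is traced out.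

  The code lengths, and with them the time-sharing alphabets, are unbounded. The limit stays in the
  region because the entropy is upper semicontinuous (Klein's inequality) and the convex hull of a
  compact set in three dimensions is compact.\<close>

section \<open>Orthonormal bases and the spectral theorem\<close>

text \<open>The comparison constant is \<open>c = g * M\<close>. The effects of a decoder sum to the
  identity, so \<open>Tr S L\<close> averages to \<open>1 / M\<close> over the messages, whatever
  the reference state \<open>S\<close> is, and the second error term averages to \<open>g\<close>. A
  small \<open>g\<close> is cheap: it enters otherwise only through an additive
  \<open>log 2 g\<close>, which vanishes after division by the code length. All three rate bounds
  must hold for one and the same input distribution, otherwise the limit would not be a point of the
  union. Hence the informations are carried as a point of three-dimensional space, and the sum rate
  is a coordinate of its own. Operators are functions on an arbitrary finite index set and not
  matrices: the output space is ordered as B1^n B2^n, while the product structure is that of (B1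
  B2)^n. A bijection from indices to sequences of local indices absorbs the reordering, with no
  permutation matrices.\<close>

definition onb :: "'a set \<Rightarrow> 'b set \<Rightarrow> ('b \<Rightarrow> 'a \<Rightarrow> complex) \<Rightarrow> bool" where
  "onb I J u \<longleftrightarrow> finite I \<and> finite J \<and>
     (\<forall>j\<in>J. \<forall>k\<in>J. (\<Sum>a\<in>I. cnj (u j a) * u k a) = (if j = k then 1 else 0)) \<and>
     (\<forall>a\<in>I. \<forall>b\<in>I. (\<Sum>j\<in>J. u j a * cnj (u j b)) = (if a = b then 1 else 0))"

definition spectral :: "'a set \<Rightarrow> 'b set \<Rightarrow> ('a \<Rightarrow> 'a \<Rightarrow> complex) \<Rightarrow> ('b \<Rightarrow> real) \<Rightarrow> ('b \<Rightarrow> 'a \<Rightarrow> complex) \<Rightarrow> bool" where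
  "spectral I J A lam u \<longleftrightarrow> onb I J u \<and>
     (\<forall>a\<in>I. \<forall>b\<in>I. A a b = (\<Sum>j\<in>J. of_real (lam j) * (u j a * cnj (u j b))))"

lemma onbD:
  assumes "onb I J u"
  shows "finite I" "finite J"
    "\<And>j k. j \<in> J \<Longrightarrow> k \<in> J \<Longrightarrow> (\<Sum>a\<in>I. cnj (u j a) * u k a) = (if j = k then 1 else 0)"
    "\<And>a b. a \<in> I \<Longrightarrow> b \<in> I \<Longrightarrow> (\<Sum>j\<in>J. u j a * cnj (u j b)) = (if a = b then 1 else 0)"
  using assms unfolding onb_def by auto

lemma specD:
  assumes "spectral I J A lam u"
  shows "onb I J u" "finite I" "finite J"
    "\<And>a b. a \<in> I \<Longrightarrow> b \<in> I \<Longrightarrow> A a b = (\<Sum>j\<in>J. of_real (lam j) * (u j a * cnj (u j b)))"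
  using assms unfolding spectral_def onb_def by auto

text \<open>Both cardinalities are the double sum of the squared moduli of
  \<open>u j a\<close>.\<close>

lemma onb_card:
  assumes "onb I J u" shows "card J = card I"
proof -
  have "of_nat (card J) = (\<Sum>j\<in>J. \<Sum>a\<in>I. cnj (u j a) * u j a)"
    using onbD[OF assms] by simp
  also have "\<dots> = (\<Sum>a\<in>I. \<Sum>j\<in>J. u j a * cnj (u j a))"
    by (subst sum.swap) (simp add: mult.commute)
  also have "\<dots> = of_nat (card I)" using onbD[OF assms] by simp
  finally show ?thesis by (metis of_nat_eq_iff)
qed

text \<open>A unitary change of basis. It carries an eigenbasis found in rotated coordinates back to
  the original ones.\<close>

lemma onb_comp:
  assumes u: "onb I J u" and x: "onb J K x"
  shows "onb I K (\<lambda>k a. \<Sum>j\<in>J. x k j * u j a)"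
proof -
  note U = onbD[OF u] and X = onbD[OF x]
  have "(\<Sum>a\<in>I. cnj (\<Sum>j\<in>J. x k j * u j a) * (\<Sum>j\<in>J. x l j * u j a)) = (if k = l then 1 else 0)"
    if "k \<in> K" "l \<in> K" for k l
  proof -
    have "(\<Sum>a\<in>I. cnj (\<Sum>j\<in>J. x k j * u j a) * (\<Sum>j\<in>J. x l j * u j a))
      = (\<Sum>a\<in>I. \<Sum>j\<in>J. \<Sum>j'\<in>J. cnj (x k j) * x l j' * (cnj (u j a) * u j' a))"
      by (rule sum.cong[OF refl], simp add: sum_product mult_ac, rule sum.swap)
    also have "\<dots> = (\<Sum>j\<in>J. \<Sum>j'\<in>J. cnj (x k j) * x l j' * (\<Sum>a\<in>I. cnj (u j a) * u j' a))"
      by (subst sum.swap, rule sum.cong[OF refl], subst sum.swap) (simp add: sum_distrib_left)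
    also have "\<dots> = (\<Sum>j\<in>J. \<Sum>j'\<in>J. if j = j' then cnj (x k j) * x l j' else 0)"
      by (intro sum.cong refl) (simp add: U)
    also have "\<dots> = (\<Sum>j\<in>J. cnj (x k j) * x l j)" using U by (simp add: sum.delta)
    finally show ?thesis using X that by simp
  qed
  moreover have "(\<Sum>k\<in>K. (\<Sum>j\<in>J. x k j * u j a) * cnj (\<Sum>j\<in>J. x k j * u j b)) = (if a = b then 1 else 0)"
    if "a \<in> I" "b \<in> I" for a b
  proof -
    have "(\<Sum>k\<in>K. (\<Sum>j\<in>J. x k j * u j a) * cnj (\<Sum>j\<in>J. x k j * u j b))
      = (\<Sum>k\<in>K. \<Sum>j\<in>J. \<Sum>j'\<in>J. u j a * cnj (u j' b) * (x k j * cnj (x k j')))"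
      by (simp add: sum_product algebra_simps)
    also have "\<dots> = (\<Sum>j\<in>J. \<Sum>j'\<in>J. u j a * cnj (u j' b) * (\<Sum>k\<in>K. x k j * cnj (x k j')))"
      by (subst sum.swap, rule sum.cong[OF refl], subst sum.swap) (simp add: sum_distrib_left)
    also have "\<dots> = (\<Sum>j\<in>J. \<Sum>j'\<in>J. if j = j' then u j a * cnj (u j' b) else 0)"
      by (intro sum.cong refl) (simp add: X)
    also have "\<dots> = (\<Sum>j\<in>J. u j a * cnj (u j b))" using U by (simp add: sum.delta)
    finally show ?thesis using U that by simp
  qed
  ultimately show ?thesis using U X by (simp add: onb_def)
qed

lemma sum_swap4:
  "(\<Sum>j\<in>J. \<Sum>k\<in>K. \<Sum>c\<in>C. \<Sum>d\<in>D. f j k c d) = (\<Sum>c\<in>C. \<Sum>d\<in>D. \<Sum>j\<in>J. \<Sum>k\<in>K. f j k c d)"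
proof -
  have "(\<Sum>j\<in>J. \<Sum>k\<in>K. \<Sum>c\<in>C. \<Sum>d\<in>D. f j k c d) = (\<Sum>j\<in>J. \<Sum>c\<in>C. \<Sum>k\<in>K. \<Sum>d\<in>D. f j k c d)"
    by (rule sum.cong[OF refl], rule sum.swap)
  also have "\<dots> = (\<Sum>c\<in>C. \<Sum>j\<in>J. \<Sum>k\<in>K. \<Sum>d\<in>D. f j k c d)" by (rule sum.swap)
  also have "\<dots> = (\<Sum>c\<in>C. \<Sum>j\<in>J. \<Sum>d\<in>D. \<Sum>k\<in>K. f j k c d)"
    by (rule sum.cong[OF refl], rule sum.cong[OF refl], rule sum.swap)
  also have "\<dots> = (\<Sum>c\<in>C. \<Sum>d\<in>D. \<Sum>j\<in>J. \<Sum>k\<in>K. f j k c d)" by (rule sum.cong[OF refl], rule sum.swap)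
  finally show ?thesis .
qed

text \<open>The inner double sum is the matrix of \<open>A\<close> in the basis \<open>u\<close>.
  This is \<open>A = U (U* A U) U*\<close>, by completeness of the basis on both sides.\<close>

lemma onb_expand:
  assumes u: "onb I J u" and "a \<in> I" "b \<in> I"
  shows "A a b = (\<Sum>j\<in>J. \<Sum>k\<in>J. u j a * (\<Sum>c\<in>I. \<Sum>d\<in>I. cnj (u j c) * A c d * u k d) * cnj (u k b))"
proof -
  note U = onbD[OF u]
  have "(\<Sum>j\<in>J. \<Sum>k\<in>J. u j a * (\<Sum>c\<in>I. \<Sum>d\<in>I. cnj (u j c) * A c d * u k d) * cnj (u k b))
    = (\<Sum>j\<in>J. \<Sum>k\<in>J. \<Sum>c\<in>I. \<Sum>d\<in>I. A c d * ((u j a * cnj (u j c)) * (u k d * cnj (u k b))))"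
    by (simp add: sum_distrib_left sum_distrib_right mult_ac)
  also have "\<dots> = (\<Sum>c\<in>I. \<Sum>d\<in>I. A c d * ((\<Sum>j\<in>J. u j a * cnj (u j c)) * (\<Sum>k\<in>J. u k d * cnj (u k b))))"
    by (rule trans[OF sum_swap4]) (simp only: sum_product, simp only: sum_distrib_left)
  also have "\<dots> = (\<Sum>c\<in>I. \<Sum>d\<in>I. if a = c then if d = b then A c d else 0 else 0)"
    using assms U by (intro sum.cong refl) auto
  also have "\<dots> = (\<Sum>c\<in>I. if a = c then A c b else 0)"
    using assms U by (intro sum.cong refl) (auto simp: sum.delta')
  also have "\<dots> = A a b" using assms U by simp
  finally show ?thesis by simp
qed

text \<open>Completes a nonzero vector to an orthonormal basis in closed form: a reflection maps the
  first unit vector to a normalised multiple of \<open>w\<close>, and its columns are the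
  basis.\<close>

lemma householder:
  fixes w :: "nat \<Rightarrow> complex"
  assumes n: "0 < n" and w: "\<exists>a<n. w a \<noteq> 0"
  shows "\<exists>u c. onb {..<n} {..<n} u \<and> (\<forall>a<n. u 0 a = c * w a)"
proof -
  define N where "N = sqrt (\<Sum>a<n. (cmod (w a))\<^sup>2)"
  have pos: "0 < (\<Sum>a<n. (cmod (w a))\<^sup>2)"
  proof -
    from w obtain a where a: "a < n" "w a \<noteq> 0" by blast
    show ?thesis by (rule sum_pos2[of _ a]) (use a in auto)
  qed
  have N: "N > 0" "N\<^sup>2 = (\<Sum>a<n. (cmod (w a))\<^sup>2)" unfolding N_def using pos by auto
  \<comment> \<open>The phase makes the first coordinate of \<open>x\<close> real and nonnegative.
    Over the complex numbers a reflection can exchange two unit vectors only if their inner product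
    is real.\<close>
  define ph where "ph = (if w 0 = 0 then 1 else cnj (w 0) / of_real (cmod (w 0)))"
  have ph: "cmod ph = 1" unfolding ph_def by (auto simp: norm_divide)
  define c where "c = ph / of_real N"
  define x where "x = (\<lambda>a. c * w a)"
  define r where "r = cmod (w 0) / N"
  have x0: "x 0 = of_real r"
    unfolding x_def c_def ph_def r_def using N(1)
    by (simp add: field_simps complex_norm_square[symmetric] power2_eq_square[symmetric])
  have xx: "(\<Sum>a<n. cnj (x a) * x a) = 1"
  proof -
    have "(\<Sum>a<n. cnj (x a) * x a) = of_real (\<Sum>a<n. (cmod (x a))\<^sup>2)"
      by (simp only: of_real_sum complex_norm_square) (simp add: mult.commute)
    also have "(\<Sum>a<n. (cmod (x a))\<^sup>2) = (cmod c)\<^sup>2 * N\<^sup>2"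
      unfolding N x_def by (simp add: norm_mult power_mult_distrib sum_distrib_left)
    also have "\<dots> = 1" unfolding c_def using ph N(1) by (simp add: norm_divide power_divide)
    finally show ?thesis by simp
  qed
  define v where "v = (\<lambda>a. x a - (if a = 0 then 1 else 0))"
  define s where "s = (\<Sum>a<n. cnj (v a) * v a)"
  have s: "s = 2 - 2 * of_real r"
  proof -
    have "s = (\<Sum>a<n. cnj (x a) * x a) + (\<Sum>a<n. if a = 0 then 1 - x a - cnj (x a) else 0)"
      unfolding s_def v_def sum.distrib[symmetric] by (intro sum.cong) (auto simp: algebra_simps)
    also have "\<dots> = 2 - 2 * of_real r" using n by (simp add: xx x0)
    finally show ?thesis .
  qed
  show ?thesis
  \<comment> \<open>If \<open>s = 0\<close>, then \<open>x\<close> already is the first unit vector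
    and the standard basis serves; otherwise the reflection in \<open>v\<close> is defined.\<close>
  proof (cases "s = 0")
    case True
    have "(\<Sum>a<n. (cmod (v a))\<^sup>2) = 0"
    proof -
      have "of_real (\<Sum>a<n. (cmod (v a))\<^sup>2) = s" unfolding s_def
        by (simp only: of_real_sum complex_norm_square) (simp add: mult.commute)
      then show ?thesis unfolding True of_real_eq_0_iff .
    qed
    then have "\<forall>a<n. v a = 0" by (subst (asm) sum_nonneg_eq_0_iff) auto
    then have "\<forall>a<n. (if 0 = a then 1 else 0) = c * w a" unfolding v_def x_def by auto
    moreover have "onb {..<n} {..<n} (\<lambda>j a. if j = a then 1 else 0)"
    proof -
      have 1: "(\<Sum>a<n. cnj (if j = a then 1 else 0) * (if k = a then 1 else 0)) = (if j = k then 1 else (0::complex))"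
        if "j < n" for j k :: nat
      proof -
        have "(\<Sum>a<n. cnj (if j = a then 1 else 0) * (if k = a then 1 else 0)) = (\<Sum>a<n. if j = a then if j = k then 1 else 0 else (0::complex))"
          by (intro sum.cong) auto
        then show ?thesis using that by simp
      qed
      have 2: "(\<Sum>j<n. (if j = a then 1 else 0) * cnj (if j = b then 1 else 0)) = (if a = b then 1 else (0::complex))"
        if "a < n" for a b :: nat
      proof -
        have "(\<Sum>j<n. (if j = a then 1 else 0) * cnj (if j = b then 1 else 0)) = (\<Sum>j<n. if j = a then if a = b then 1 else 0 else (0::complex))"
          by (intro sum.cong) auto
        then show ?thesis using that by simp
      qed
      show ?thesis unfolding onb_def using 1 2 by (simp only: finite_lessThan lessThan_iff) blast
    qed
    ultimately show ?thesis by (intro exI[of _ "\<lambda>j a. if j = a then 1 else 0"] exI[of _ c]) auto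
  next
    case False
    \<comment> \<open>The usual factor of the reflection \<open>1 - 2 v v* / |v|^2\<close>.\<close>
    define k where "k = 2 / s"
    have ks: "k * s = 2" unfolding k_def using False by simp
    define u where "u = (\<lambda>j a. (if j = a then 1 else 0) - k * (v a * cnj (v j)))"
    have sr: "cnj s = s" unfolding s_def by (simp add: mult.commute)
    have cu: "cnj (u j a) = u a j" for j a
      unfolding u_def k_def by (simp add: sr mult.commute)
    have uu: "(\<Sum>a<n. u a j * u i a) = (if j = i then 1 else 0)" if "j < n" "i < n" for j i
    proof -
      have "(\<Sum>a<n. u a j * u i a) = (\<Sum>a<n. (if j = a then if i = j then 1 else 0 else 0)
         - (if j = a then k * (v j * cnj (v i)) else 0) - (if i = a then k * (v j * cnj (v i)) else 0)
         + k * k * (v j * cnj (v i)) * (cnj (v a) * v a))"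
        unfolding u_def by (intro sum.cong refl) (simp add: algebra_simps)
      also have "\<dots> = (if i = j then 1 else 0) - k * (v j * cnj (v i)) - k * (v j * cnj (v i))
         + k * (k * s) * (v j * cnj (v i))"
      proof -
        have "(\<Sum>a<n. k * k * (v j * cnj (v i)) * (cnj (v a) * v a)) = k * (k * s) * (v j * cnj (v i))"
          unfolding sum_distrib_left[symmetric] s_def[symmetric] by (simp only: mult_ac)
        then show ?thesis using that by (simp add: sum.distrib sum_subtractf)
      qed
      also have "\<dots> = (if j = i then 1 else 0)" unfolding ks by simp
      finally show ?thesis .
    qed
    have "onb {..<n} {..<n} u"
      unfolding onb_def cu using uu by simp
    moreover have "u 0 a = c * w a" if "a < n" for a
    proof -
      have "cnj (v 0) = - s / 2" unfolding s v_def using x0 by (simp add: field_simps)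
      then have "u 0 a = (if 0 = a then 1 else 0) + v a" unfolding u_def k_def using False by simp
      then show ?thesis unfolding v_def x_def by auto
    qed
    ultimately show ?thesis by blast
  qed
qed

text \<open>Deflation: in a basis that starts with an eigenvector the first column vanishes below
  the corner, and by symmetry so does the first row. The induction hypothesis diagonalises the
  remaining block.\<close>

lemma hermitian_spec:
  fixes A :: "nat \<Rightarrow> nat \<Rightarrow> complex"
  assumes "\<And>a b. a < n \<Longrightarrow> b < n \<Longrightarrow> A b a = cnj (A a b)"
  shows "\<exists>lam u. spectral {..<n} {..<n} A lam u"
  using assms
proof (induction n arbitrary: A)
  case 0
  then show ?case by (auto simp: spectral_def onb_def)
next
  case (Suc n)
  let ?I = "{..<Suc n}"
  define M where "M = mat (Suc n) (Suc n) (\<lambda>(a, b). A a b)"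
  have M: "M \<in> carrier_mat (Suc n) (Suc n)" by (simp add: M_def)
  obtain l where l: "eigenvalue M l"
  proof -
    from char_poly_factorized[OF M] obtain as where as: "char_poly M = (\<Prod>a\<leftarrow>as. [:- a, 1:])" "length as = Suc n" by auto
    then obtain a as' where "as = a # as'" by (cases as) auto
    then have "poly (char_poly M) a = 0" using as by simp
    then show ?thesis using eigenvalue_root_char_poly[OF M] that by blast
  qed
  then obtain w where w: "w \<in> carrier_vec (Suc n)" "w \<noteq> 0\<^sub>v (Suc n)" "M *\<^sub>v w = l \<cdot>\<^sub>v w"
    using M unfolding eigenvalue_def eigenvector_def by auto
  have "\<exists>a<Suc n. w $ a \<noteq> 0"
    using w(1,2) by (metis carrier_vecD eq_vecI index_zero_vec(1) zero_carrier_vec)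
  from householder[OF _ this] obtain u c where u: "onb ?I ?I u" and u0: "\<forall>a<Suc n. u 0 a = c * w $ a" by auto
  note U = onbD[OF u]
  have ev: "(\<Sum>b<Suc n. A a b * u 0 b) = l * u 0 a" if "a < Suc n" for a
  proof -
    have "(\<Sum>b<Suc n. A a b * w $ b) = (M *\<^sub>v w) $ a"
      using that w(1) by (simp only: M_def) (simp add: scalar_prod_def atLeast0LessThan del: sum.lessThan_Suc)
    also have "\<dots> = l * w $ a" using w that by simp
    finally have "c * (\<Sum>b<Suc n. A a b * w $ b) = l * u 0 a" using u0 that by simp
    moreover have "(\<Sum>b<Suc n. A a b * u 0 b) = c * (\<Sum>b<Suc n. A a b * w $ b)"
      unfolding sum_distrib_left using u0 by (intro sum.cong) auto
    ultimately show ?thesis by simp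
  qed
  define B where "B = (\<lambda>j k. \<Sum>c\<in>?I. \<Sum>d\<in>?I. cnj (u j c) * A c d * u k d)"
  have Bh: "B k j = cnj (B j k)" for j k
  proof -
    have "cnj (B j k) = (\<Sum>c\<in>?I. \<Sum>d\<in>?I. u j c * cnj (A c d) * cnj (u k d))" by (simp only: B_def cnj_sum complex_cnj_mult complex_cnj_cnj)
    also have "\<dots> = (\<Sum>d\<in>?I. \<Sum>c\<in>?I. u j c * cnj (A c d) * cnj (u k d))" by (rule sum.swap)
    also have "\<dots> = B k j" unfolding B_def
      by (intro sum.cong refl) (simp add: mult_ac Suc.prems[symmetric])
    finally show ?thesis by simp
  qed
  have B0: "B j 0 = (if j = 0 then l else 0)" if "j < Suc n" for j
  proof -
    have "B j 0 = (\<Sum>c\<in>?I. cnj (u j c) * (\<Sum>d\<in>?I. A c d * u 0 d))"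
      unfolding B_def sum_distrib_left by (simp only: mult.assoc)
    also have "\<dots> = (\<Sum>c\<in>?I. l * (cnj (u j c) * u 0 c))" by (intro sum.cong refl) (simp only: ev lessThan_iff mult_ac)
    also have "\<dots> = (if j = 0 then l else 0)" unfolding sum_distrib_left[symmetric] using U(3)[of j 0] that by simp
    finally show ?thesis .
  qed
  have "cnj l = l" using Bh[of 0 0] unfolding B0[OF zero_less_Suc] by simp
  then have lr: "l = of_real (Re l)" by (metis Reals_cnj_iff of_real_Re)
  obtain lam x where x: "spectral {..<n} {..<n} (\<lambda>j k. B (Suc j) (Suc k)) lam x"
    using Suc.IH[of "\<lambda>j k. B (Suc j) (Suc k)", OF Bh] by blast
  note X = specD[OF x] and XO = onbD[OF specD(1)[OF x]]
  \<comment> \<open>Block-diagonal eigenbasis of \<open>B\<close>: the first unit vector, followed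
    by the eigenvectors of the lower block padded with a zero.\<close>
  define y where "y = (\<lambda>j a. case j of 0 \<Rightarrow> (if a = 0 then 1 else 0) | Suc j' \<Rightarrow> (case a of 0 \<Rightarrow> 0 | Suc a' \<Rightarrow> x j' a'))"
  define mu where "mu = case_nat (Re l) lam"
  have "onb ?I ?I y"
    unfolding onb_def
  proof (intro conjI ballI)
    fix j k assume jk: "j \<in> ?I" "k \<in> ?I"
    show "(\<Sum>a\<in>?I. cnj (y j a) * y k a) = (if j = k then 1 else 0)"
      using XO(3) jk unfolding sum.lessThan_Suc_shift by (cases j; cases k) (simp_all add: y_def)
    show "(\<Sum>i\<in>?I. y i j * cnj (y i k)) = (if j = k then 1 else 0)"
      using XO(4) jk unfolding sum.lessThan_Suc_shift by (cases j; cases k) (simp_all add: y_def)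
  qed auto
  moreover have "B j k = (\<Sum>i\<in>?I. of_real (mu i) * (y i j * cnj (y i k)))" if "j \<in> ?I" "k \<in> ?I" for j k
  proof (cases k)
    case 0
    then show ?thesis using that B0[of j] unfolding sum.lessThan_Suc_shift
      by (cases j) (simp_all add: y_def mu_def lr[symmetric])
  next
    case (Suc k')
    show ?thesis
    proof (cases j)
      case 0
      have "B 0 k = 0" using Bh[of 0 k] B0[of k] that(2) Suc by simp
      then show ?thesis using 0 Suc unfolding sum.lessThan_Suc_shift by (simp add: y_def mu_def)
    next
      case (Suc j')
      then show ?thesis using that X(4)[of j' k'] \<open>k = Suc k'\<close> unfolding sum.lessThan_Suc_shift
        by (simp add: y_def mu_def)
    qed
  qed
  ultimately have sy: "spectral ?I ?I B mu y" by (simp add: spectral_def)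
  define z where "z = (\<lambda>k a. \<Sum>j\<in>?I. y k j * u j a)"
  have "onb ?I ?I z" unfolding z_def by (rule onb_comp[OF u specD(1)[OF sy]])
  moreover have "A a b = (\<Sum>i\<in>?I. of_real (mu i) * (z i a * cnj (z i b)))" if "a \<in> ?I" "b \<in> ?I" for a b
  proof -
    have "A a b = (\<Sum>j\<in>?I. \<Sum>k\<in>?I. u j a * B j k * cnj (u k b))"
      unfolding B_def by (rule onb_expand[OF u that])
    also have "\<dots> = (\<Sum>j\<in>?I. \<Sum>k\<in>?I. \<Sum>i\<in>?I. of_real (mu i) * ((y i j * u j a) * cnj (y i k * u k b)))"
      using specD(4)[OF sy] by (intro sum.cong refl) (simp add: sum_distrib_left sum_distrib_right mult_ac del: sum.lessThan_Suc)
    also have "\<dots> = (\<Sum>j\<in>?I. \<Sum>i\<in>?I. \<Sum>k\<in>?I. of_real (mu i) * ((y i j * u j a) * cnj (y i k * u k b)))"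
      by (rule sum.cong[OF refl], rule sum.swap)
    also have "\<dots> = (\<Sum>i\<in>?I. \<Sum>j\<in>?I. \<Sum>k\<in>?I. of_real (mu i) * ((y i j * u j a) * cnj (y i k * u k b)))"
      by (rule sum.swap)
    also have "\<dots> = (\<Sum>i\<in>?I. of_real (mu i) * (z i a * cnj (z i b)))"
      unfolding z_def cnj_sum sum_product by (simp only: sum_distrib_left)
    finally show ?thesis .
  qed
  ultimately have "spectral ?I ?I A mu z" by (simp add: spectral_def)
  then show ?case by blast
qed

section \<open>Von Neumann entropy from a spectral decomposition\<close>

lemma order_prod_linear:
  fixes z :: complex
  assumes "finite X"
  shows "order z (\<Prod>j\<in>X. [:- f j, 1:]) = card {j\<in>X. f j = z}"
  using assms
proof (induction X rule: finite_induct)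
  case empty
  then show ?case by (simp add: order_0I)
next
  case (insert x X)
  have o: "order z [:- f x, 1:] = (if f x = z then 1 else 0)"
    using order_linear_power[of z "- f x" 1] by (cases "f x = z") simp_all
  have nz: "[:- f x, 1:] * (\<Prod>j\<in>X. [:- f j, 1:]) \<noteq> 0"
    using insert.hyps by (simp only: mult_eq_0_iff prod_zero_iff) auto
  have "order z (\<Prod>j\<in>insert x X. [:- f j, 1:]) = order z [:- f x, 1:] + order z (\<Prod>j\<in>X. [:- f j, 1:])"
    unfolding prod.insert[OF insert.hyps] by (rule order_mult[OF nz])
  also have "\<dots> = (if f x = z then 1 else 0) + card {j\<in>X. f j = z}" by (simp only: o insert.IH)
  also have "\<dots> = card {j\<in>insert x X. f j = z}"
  proof (cases "f x = z")
    case True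
    then have "{j\<in>insert x X. f j = z} = insert x {j\<in>X. f j = z}" by auto
    then show ?thesis using True insert.hyps by simp
  next
    case False
    then have "{j\<in>insert x X. f j = z} = {j\<in>X. f j = z}" by auto
    then show ?thesis using False by simp
  qed
  finally show ?case .
qed

text \<open>The decomposition makes \<open>M\<close> similar to a diagonal matrix, so the order of a
  root of its characteristic polynomial is the number of indices \<open>j\<close> that carry this
  eigenvalue. The bijection \<open>e\<close> allows the eigenbasis to live on another index set than
  the matrix.\<close>

lemma vn_entropy_spec:
  assumes s: "spectral I J A lam u" and e: "bij_betw e I {..<N}" and M: "M \<in> carrier_mat N N"
    and eq: "\<And>a b. a \<in> I \<Longrightarrow> b \<in> I \<Longrightarrow> M $$ (e a, e b) = A a b"
  shows "vn_entropy M = (\<Sum>j\<in>J. eta (lam j))"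
proof -
  note S = specD[OF s] and U = onbD[OF specD(1)[OF s]]
  define g where "g = inv_into I e"
  have g: "bij_betw g {..<N} I" unfolding g_def by (rule bij_betw_inv_into[OF e])
  have eg: "e (g i) = i" "g i \<in> I" if "i < N" for i
    using that e g unfolding g_def by (auto simp: bij_betw_inv_into_right bij_betwE)
  have "card J = N" using onb_card[OF S(1)] bij_betw_same_card[OF e] by simp
  then obtain f where f: "bij_betw f {..<N} J"
    using S(3) by (metis card_lessThan finite_lessThan finite_same_card_bij)
  have fJ: "f i \<in> J" if "i < N" for i using f that by (auto simp: bij_betw_def)
  have inj: "f i = f j \<longleftrightarrow> i = j" "g i = g j \<longleftrightarrow> i = j" if "i < N" "j < N" for i j
    using f g that by (auto simp: bij_betw_def inj_on_def)
  define P where "P = mat N N (\<lambda>(i,j). u (f j) (g i))"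
  define D where "D = mat N N (\<lambda>(i,j). if i = j then complex_of_real (lam (f i)) else 0)"
  define Q where "Q = mat N N (\<lambda>(i,j). cnj (u (f i) (g j)))"
  have PD: "P * D = mat N N (\<lambda>(i,j). u (f j) (g i) * lam (f j))"
    by (rule eq_matI) (auto simp: P_def D_def scalar_prod_def if_distrib cong: if_cong)
  have "similar_mat M D"
  proof (rule similar_matI)
    show "{M, D, P, Q} \<subseteq> carrier_mat N N" using M by (auto simp: P_def D_def Q_def)
    show "P * Q = 1\<^sub>m N"
    proof (rule eq_matI, unfold index_one_mat)
      fix i j assume ij: "i < N" "j < N"
      then have "(P * Q) $$ (i, j) = (\<Sum>k<N. u (f k) (g i) * cnj (u (f k) (g j)))"
        by (simp add: P_def Q_def scalar_prod_def atLeast0LessThan)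
      also have "\<dots> = (\<Sum>k\<in>J. u k (g i) * cnj (u k (g j)))" by (rule sum.reindex_bij_betw[OF f])
      finally show "(P * Q) $$ (i, j) = (if i = j then 1 else 0)" using ij U(4) eg inj by simp
    qed (auto simp: P_def Q_def)
    show "Q * P = 1\<^sub>m N"
    proof (rule eq_matI, unfold index_one_mat)
      fix i j assume ij: "i < N" "j < N"
      then have "(Q * P) $$ (i, j) = (\<Sum>k<N. cnj (u (f i) (g k)) * u (f j) (g k))"
        by (simp add: P_def Q_def scalar_prod_def atLeast0LessThan)
      also have "\<dots> = (\<Sum>k\<in>I. cnj (u (f i) k) * u (f j) k)" by (rule sum.reindex_bij_betw[OF g])
      finally show "(Q * P) $$ (i, j) = (if i = j then 1 else 0)" using ij U(3) fJ inj by simp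
    qed (auto simp: P_def Q_def)
    show "M = P * D * Q"
    proof (rule eq_matI)
      fix i j assume "i < dim_row (P * D * Q)" "j < dim_col (P * D * Q)"
      then have ij: "i < N" "j < N" by (auto simp: P_def Q_def)
      then have "(P * D * Q) $$ (i, j) = (\<Sum>k<N. of_real (lam (f k)) * (u (f k) (g i) * cnj (u (f k) (g j))))"
        by (simp only: PD) (simp add: Q_def scalar_prod_def atLeast0LessThan mult_ac)
      also have "\<dots> = (\<Sum>k\<in>J. of_real (lam k) * (u k (g i) * cnj (u k (g j))))" by (rule sum.reindex_bij_betw[OF f])
      also have "\<dots> = A (g i) (g j)" using S(4) eg ij by simp
      also have "\<dots> = M $$ (i, j)" using eq[of "g i" "g j"] eg ij by simp
      finally show "M $$ (i, j) = (P * D * Q) $$ (i, j)" by simp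
    qed (use M in \<open>auto simp: P_def Q_def\<close>)
  qed
  then have "char_poly M = char_poly D" by (rule char_poly_similar)
  also have "\<dots> = (\<Prod>a\<leftarrow>diag_mat D. [:- a, 1:])"
    by (rule char_poly_upper_triangular[of _ N]) (auto simp: D_def)
  also have "diag_mat D = map (\<lambda>i. complex_of_real (lam (f i))) [0..<N]"
    by (auto simp: diag_mat_def D_def)
  also have "(\<Prod>a\<leftarrow>map (\<lambda>i. complex_of_real (lam (f i))) [0..<N]. [:- a, 1:]) = (\<Prod>i<N. [:- complex_of_real (lam (f i)), 1:])"
    unfolding map_map comp_def by (simp add: interv_sum_list_conv_sum_set_nat prod.list_conv_set_nth atLeast0LessThan)
  also have "\<dots> = (\<Prod>j\<in>J. [:- complex_of_real (lam j), 1:])"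
    by (rule prod.reindex_bij_betw[OF f])
  finally have cp: "char_poly M = (\<Prod>j\<in>J. [:- complex_of_real (lam j), 1:])" .
  let ?h = "\<lambda>j. complex_of_real (lam j)"
  have "eigenvalue M z \<longleftrightarrow> z \<in> ?h ` J" for z
    unfolding eigenvalue_root_char_poly[OF M] cp poly_prod using S(3) by (auto simp: prod_zero_iff)
  then have "vn_entropy M = (\<Sum>z\<in>?h ` J. real (card {j\<in>J. ?h j = z}) * eta (Re z))"
    unfolding vn_entropy_def cp order_prod_linear[OF S(3)] by (intro sum.cong) auto
  also have "\<dots> = (\<Sum>z\<in>?h ` J. \<Sum>j\<in>{j\<in>J. ?h j = z}. eta (lam j))"
    by (intro sum.cong refl) auto
  also have "\<dots> = (\<Sum>j\<in>J. eta (lam j))" by (rule sum.image_gen[OF S(3), symmetric])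
  finally show ?thesis .
qed

section \<open>One-shot bound for a binary test\<close>

definition ip :: "'a set \<Rightarrow> ('a \<Rightarrow> complex) \<Rightarrow> ('a \<Rightarrow> complex) \<Rightarrow> complex" where
  "ip I x y = (\<Sum>a\<in>I. cnj (x a) * y a)"

definition app :: "'a set \<Rightarrow> ('a \<Rightarrow> 'a \<Rightarrow> complex) \<Rightarrow> ('a \<Rightarrow> complex) \<Rightarrow> 'a \<Rightarrow> complex" where
  "app I A y = (\<lambda>a. \<Sum>b\<in>I. A a b * y b)"

definition qf :: "'a set \<Rightarrow> ('a \<Rightarrow> 'a \<Rightarrow> complex) \<Rightarrow> ('a \<Rightarrow> complex) \<Rightarrow> complex" where
  "qf I A x = ip I x (app I A x)"

definition pos :: "'a set \<Rightarrow> ('a \<Rightarrow> 'a \<Rightarrow> complex) \<Rightarrow> bool" where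
  "pos I A \<longleftrightarrow> (\<forall>a\<in>I. \<forall>b\<in>I. cnj (A a b) = A b a) \<and> (\<forall>x. 0 \<le> Re (qf I A x))"

definition idm :: "'a \<Rightarrow> 'a \<Rightarrow> complex" where
  "idm a b = (if a = b then 1 else 0)"

text \<open>The trace of the product \<open>A B\<close>; for a state and an effect it is the
  probability of the outcome.\<close>

definition tr2 :: "'a set \<Rightarrow> ('a \<Rightarrow> 'a \<Rightarrow> complex) \<Rightarrow> ('a \<Rightarrow> 'a \<Rightarrow> complex) \<Rightarrow> complex" where
  "tr2 I A B = (\<Sum>a\<in>I. \<Sum>b\<in>I. A a b * B b a)"

lemma qf_expand: "qf I A x = (\<Sum>a\<in>I. \<Sum>b\<in>I. cnj (x a) * A a b * x b)"
  unfolding qf_def ip_def app_def sum_distrib_left by (simp only: mult.assoc)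

lemma ip_cnj: "cnj (ip I x y) = ip I y x"
  unfolding ip_def by (simp add: mult.commute)

lemma ip_diff_right: "ip I x (\<lambda>a. y a - z a) = ip I x y - ip I x z"
  unfolding ip_def by (simp add: algebra_simps sum_subtractf)

lemma ip_diff_left: "ip I (\<lambda>a. y a - z a) x = ip I y x - ip I z x"
  unfolding ip_def by (simp add: algebra_simps sum_subtractf)

lemma ip_self: "ip I x x = of_real (\<Sum>a\<in>I. (cmod (x a))\<^sup>2)"
  unfolding ip_def of_real_sum complex_norm_square by (simp only: mult.commute)

lemma ip_cong: "(\<And>a. a \<in> I \<Longrightarrow> x a = x' a) \<Longrightarrow> (\<And>a. a \<in> I \<Longrightarrow> y a = y' a) \<Longrightarrow> ip I x y = ip I x' y'"
  unfolding ip_def by (auto intro: sum.cong)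

lemma ip_app:
  assumes "\<And>a b. a \<in> I \<Longrightarrow> b \<in> I \<Longrightarrow> cnj (A a b) = A b a"
  shows "ip I x (app I A y) = ip I (app I A x) y"
proof -
  have "ip I x (app I A y) = (\<Sum>a\<in>I. \<Sum>b\<in>I. cnj (x a) * A a b * y b)"
    unfolding ip_def app_def sum_distrib_left by (simp only: mult.assoc)
  also have "\<dots> = (\<Sum>b\<in>I. \<Sum>a\<in>I. cnj (x a) * A a b * y b)" by (rule sum.swap)
  also have "\<dots> = (\<Sum>b\<in>I. \<Sum>a\<in>I. cnj (A b a * x a) * y b)"
    using assms by (intro sum.cong refl) (simp add: mult_ac)
  also have "\<dots> = ip I (app I A x) y"
    unfolding ip_def app_def cnj_sum sum_distrib_right ..
  finally show ?thesis .
qed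

lemma app_diff: "app I (\<lambda>a b. A a b - B a b) x = (\<lambda>a. app I A x a - app I B x a)"
  unfolding app_def by (simp add: algebra_simps sum_subtractf)

lemma app_idm: "finite I \<Longrightarrow> a \<in> I \<Longrightarrow> app I idm x a = x a"
  unfolding app_def idm_def by (simp add: if_distrib[of "\<lambda>c. c * _"] cong: if_cong)

lemma app_diff_vec: "app I A (\<lambda>a. x a - y a) = (\<lambda>a. app I A x a - app I A y a)"
  unfolding app_def by (simp add: algebra_simps sum_subtractf)

text \<open>An effect dominates its square: \<open>L - L\<^sup>2 = L(1 - L)L + (1 - L)L(1 - L)\<close>.\<close>

lemma effect_square_le:
  assumes fin: "finite I" and L: "pos I L" and L': "pos I (\<lambda>a b. idm a b - L a b)"
  shows "(\<Sum>a\<in>I. (cmod (app I L x a))\<^sup>2) \<le> Re (qf I L x)"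
proof -
  define y where "y = app I L x"
  define z where "z = (\<lambda>a. x a - y a)"
  have h: "\<And>a b. a \<in> I \<Longrightarrow> b \<in> I \<Longrightarrow> cnj (L a b) = L b a" using L by (auto simp: pos_def)
  have "qf I (\<lambda>a b. idm a b - L a b) y = ip I y (\<lambda>a. y a - app I L y a)"
    unfolding qf_def app_diff by (rule ip_cong) (auto simp: app_idm[OF fin])
  then have 1: "0 \<le> Re (ip I y y - ip I y (app I L y))"
    using L' unfolding pos_def by (metis ip_diff_right)
  have "app I L z = (\<lambda>a. y a - app I L y a)"
    unfolding z_def app_diff_vec y_def ..
  then have "qf I L z = ip I x y - ip I y y - (ip I x (app I L y) - ip I y (app I L y))"
    unfolding qf_def z_def ip_diff_left by (simp add: ip_diff_right)
  moreover have "ip I x (app I L y) = ip I y y"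
    unfolding y_def by (rule ip_app[OF h])
  ultimately have "Re (ip I x y - ip I y y - (ip I y y - ip I y (app I L y))) \<ge> 0"
    using L unfolding pos_def by metis
  with 1 have "Re (ip I y y) \<le> Re (ip I x y)" by simp
  then show ?thesis unfolding qf_def ip_self y_def[symmetric] by simp
qed

lemma parseval:
  assumes "onb I J u"
  shows "(\<Sum>j\<in>J. (cmod (ip I (u j) y))\<^sup>2) = (\<Sum>a\<in>I. (cmod (y a))\<^sup>2)"
proof -
  note U = onbD[OF assms]
  have "complex_of_real (\<Sum>j\<in>J. (cmod (ip I (u j) y))\<^sup>2) = (\<Sum>j\<in>J. ip I (u j) y * cnj (ip I (u j) y))"
    unfolding of_real_sum complex_norm_square ..
  also have "\<dots> = (\<Sum>j\<in>J. \<Sum>a\<in>I. \<Sum>b\<in>I. (cnj (u j a) * y a) * (u j b * cnj (y b)))"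
    unfolding ip_cnj unfolding ip_def sum_product by (simp only: mult.commute[of "cnj (y _)"])
  also have "\<dots> = (\<Sum>a\<in>I. \<Sum>b\<in>I. \<Sum>j\<in>J. (cnj (u j a) * y a) * (u j b * cnj (y b)))"
    by (subst sum.swap) (rule sum.cong[OF refl], rule sum.swap)
  also have "\<dots> = (\<Sum>a\<in>I. \<Sum>b\<in>I. y a * cnj (y b) * (\<Sum>j\<in>J. u j b * cnj (u j a)))"
    unfolding sum_distrib_left by (simp only: mult_ac)
  also have "\<dots> = (\<Sum>a\<in>I. \<Sum>b\<in>I. if a = b then y a * cnj (y b) else 0)"
    by (intro sum.cong refl) (simp add: U)
  also have "\<dots> = (\<Sum>a\<in>I. y a * cnj (y a))" using U by simp
  also have "\<dots> = of_real (\<Sum>a\<in>I. (cmod (y a))\<^sup>2)" unfolding of_real_sum complex_norm_square ..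
  finally show ?thesis by (simp only: of_real_eq_iff)
qed

lemma tr2_spec:
  assumes "spectral I J A r u"
  shows "tr2 I A L = (\<Sum>j\<in>J. of_real (r j) * qf I L (u j))"
proof -
  note S = specD[OF assms]
  have "tr2 I A L = (\<Sum>a\<in>I. \<Sum>b\<in>I. \<Sum>j\<in>J. of_real (r j) * (cnj (u j b) * L b a * u j a))"
    unfolding tr2_def by (intro sum.cong refl) (simp add: S(4) sum_distrib_left sum_distrib_right mult_ac)
  also have "\<dots> = (\<Sum>b\<in>I. \<Sum>a\<in>I. \<Sum>j\<in>J. of_real (r j) * (cnj (u j b) * L b a * u j a))"
    by (rule sum.swap)
  also have "\<dots> = (\<Sum>b\<in>I. \<Sum>j\<in>J. \<Sum>a\<in>I. of_real (r j) * (cnj (u j b) * L b a * u j a))"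
    by (rule sum.cong[OF refl], rule sum.swap)
  also have "\<dots> = (\<Sum>j\<in>J. \<Sum>b\<in>I. \<Sum>a\<in>I. of_real (r j) * (cnj (u j b) * L b a * u j a))"
    by (rule sum.swap)
  also have "\<dots> = (\<Sum>j\<in>J. of_real (r j) * qf I L (u j))"
    unfolding qf_expand sum_distrib_left ..
  finally show ?thesis .
qed

text \<open>For two orthonormal bases these squared overlaps form a doubly stochastic matrix, by
  Parseval. This is why multiplying them by the eigenvalues of either state gives a distribution on
  pairs.\<close>

definition ovl :: "'a set \<Rightarrow> ('b \<Rightarrow> 'a \<Rightarrow> complex) \<Rightarrow> ('c \<Rightarrow> 'a \<Rightarrow> complex) \<Rightarrow> 'b \<Rightarrow> 'c \<Rightarrow> real" where
  "ovl I u v j k = (cmod (ip I (u j) (v k)))\<^sup>2"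

lemma ovl_nonneg: "0 \<le> ovl I u v j k" unfolding ovl_def by simp

lemma onb_norm:
  assumes "onb I J u" "j \<in> J" shows "(\<Sum>a\<in>I. (cmod (u j a))\<^sup>2) = 1"
proof -
  have "complex_of_real (\<Sum>a\<in>I. (cmod (u j a))\<^sup>2) = 1"
    using onbD(3)[OF assms(1,2,2)] unfolding ip_self[symmetric] ip_def by simp
  then show ?thesis by (simp only: of_real_eq_1_iff)
qed

lemma ovl_sum_right:
  assumes "onb I J u" "onb I K v" "j \<in> J"
  shows "(\<Sum>k\<in>K. ovl I u v j k) = 1"
proof -
  have "ovl I u v j k = (cmod (ip I (v k) (u j)))\<^sup>2" for k
    unfolding ovl_def by (metis ip_cnj complex_mod_cnj)
  then show ?thesis using parseval[OF assms(2), of "u j"] onb_norm[OF assms(1,3)] by simp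
qed

lemma ovl_sum_left:
  assumes "onb I J u" "onb I K v" "k \<in> K"
  shows "(\<Sum>j\<in>J. ovl I u v j k) = 1"
  using parseval[OF assms(1), of "v k"] onb_norm[OF assms(2,3)] unfolding ovl_def by simp

text \<open>The marginal on the second basis is the diagonal of \<open>A\<close> there, that is, the
  outcome distribution of measuring \<open>A\<close> in the basis \<open>v\<close>.\<close>

lemma ovl_sum_spec:
  assumes s: "spectral I J A r u"
  shows "(\<Sum>j\<in>J. r j * ovl I u v j k) = Re (qf I A (v k))"
proof -
  note S = specD[OF s]
  have "qf I A (v k) = (\<Sum>a\<in>I. \<Sum>b\<in>I. \<Sum>j\<in>J. of_real (r j) * (cnj (v k a) * u j a * (cnj (u j b) * v k b)))"
    unfolding qf_expand by (intro sum.cong refl) (simp add: S(4) sum_distrib_left sum_distrib_right mult_ac)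
  also have "\<dots> = (\<Sum>a\<in>I. \<Sum>j\<in>J. \<Sum>b\<in>I. of_real (r j) * (cnj (v k a) * u j a * (cnj (u j b) * v k b)))"
    by (rule sum.cong[OF refl], rule sum.swap)
  also have "\<dots> = (\<Sum>j\<in>J. \<Sum>a\<in>I. \<Sum>b\<in>I. of_real (r j) * (cnj (v k a) * u j a * (cnj (u j b) * v k b)))"
    by (rule sum.swap)
  also have "\<dots> = (\<Sum>j\<in>J. of_real (r j) * (ip I (v k) (u j) * ip I (u j) (v k)))"
    unfolding ip_def sum_product by (simp only: sum_distrib_left)
  also have "\<dots> = (\<Sum>j\<in>J. of_real (r j * ovl I u v j k))"
    unfolding ovl_def of_real_mult complex_norm_square ip_cnj by (simp only: mult.commute)
  finally show ?thesis by (simp only: of_real_sum[symmetric] Re_complex_of_real)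
qed

lemma half_norm_le: "(cmod w)\<^sup>2 / 2 \<le> (cmod z)\<^sup>2 + (cmod (w - z))\<^sup>2"
proof -
  have "cmod w \<le> cmod z + cmod (w - z)" by (metis add.commute diff_add_cancel norm_triangle_ineq)
  then have "(cmod w)\<^sup>2 \<le> (cmod z + cmod (w - z))\<^sup>2" by (simp add: power_mono)
  also have "\<dots> \<le> 2 * ((cmod z)\<^sup>2 + (cmod (w - z))\<^sup>2)"
    using zero_le_power2[of "cmod z - cmod (w - z)"] by (simp add: power2_eq_square algebra_simps)
  finally show ?thesis by simp
qed

text \<open>The Nussbaum--Szkola argument: both error probabilities are expanded over the pair of
  eigenbases, where \<open>\<bar>z\<bar>\<^sup>2 + \<bar>w - z\<bar>\<^sup>2 \<ge> \<bar>w\<bar>\<^sup>2 / 2\<close> with \<open>w\<close> the overlap of two eigenvectors.\<close>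

lemma test_error_ge:
  assumes R: "spectral I J R r u" and S: "spectral I K S s v"
    and r: "\<And>j. j \<in> J \<Longrightarrow> 0 \<le> r j" and s: "\<And>k. k \<in> K \<Longrightarrow> 0 \<le> s k" and c: "0 \<le> c"
    and L: "pos I L" and L': "pos I (\<lambda>a b. idm a b - L a b)"
  shows "(\<Sum>j\<in>J. \<Sum>k\<in>K. min (r j) (c * s k) * ovl I u v j k) / 2
    \<le> ((\<Sum>j\<in>J. r j) - Re (tr2 I R L)) + c * Re (tr2 I S L)"
proof -
  note RD = specD[OF R] and SD = specD[OF S]
  have fin: "finite I" by (rule RD)
  let ?N = "\<lambda>a b. idm a b - L a b"
  have hL: "\<And>a b. a \<in> I \<Longrightarrow> b \<in> I \<Longrightarrow> cnj (L a b) = L b a"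
    and hN: "\<And>a b. a \<in> I \<Longrightarrow> b \<in> I \<Longrightarrow> cnj (?N a b) = ?N b a"
    using L L' by (auto simp: pos_def)
  have N': "pos I (\<lambda>a b. idm a b - ?N a b)" using L by simp
  let ?z = "\<lambda>j k. ip I (u j) (app I L (v k))"
  have qN: "Re (qf I ?N x) = Re (ip I x x) - Re (qf I L x)" for x
  proof -
    have "qf I ?N x = ip I x (\<lambda>a. x a - app I L x a)"
      unfolding qf_def app_diff by (rule ip_cong) (auto simp: app_idm[OF fin])
    then show ?thesis unfolding ip_diff_right qf_def by simp
  qed
  have e1: "(\<Sum>j\<in>J. (cmod (?z j k))\<^sup>2) \<le> Re (qf I L (v k))" for k
    unfolding parseval[OF RD(1)] by (rule effect_square_le[OF fin L L'])
  \<comment> \<open>Self-adjointness moves \<open>1 - L\<close> to the other vector, so its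
    amplitude is, up to conjugation, the overlap minus the amplitude \<open>?z\<close> of
    \<open>L\<close>.\<close>
  have cm: "cmod (ip I (v k) (app I ?N (u j))) = cmod (ip I (u j) (v k) - ?z j k)" for j k
  proof -
    have "ip I (v k) (app I ?N (u j)) = ip I (app I ?N (v k)) (u j)" by (rule ip_app[OF hN])
    also have "\<dots> = cnj (ip I (u j) (app I ?N (v k)))" by (simp only: ip_cnj)
    also have "ip I (u j) (app I ?N (v k)) = ip I (u j) (\<lambda>a. v k a - app I L (v k) a)"
      unfolding app_diff by (rule ip_cong) (auto simp: app_idm[OF fin])
    finally show ?thesis by (simp only: complex_mod_cnj ip_diff_right)
  qed
  have e2: "(\<Sum>k\<in>K. (cmod (ip I (u j) (v k) - ?z j k))\<^sup>2) \<le> 1 - Re (qf I L (u j))" if "j \<in> J" for j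
  proof -
    have "(\<Sum>k\<in>K. (cmod (ip I (v k) (app I ?N (u j))))\<^sup>2) \<le> Re (qf I ?N (u j))"
      unfolding parseval[OF SD(1)] by (rule effect_square_le[OF fin L' N'])
    then show ?thesis unfolding cm qN ip_self onb_norm[OF RD(1) that] by simp
  qed
  have "(\<Sum>j\<in>J. \<Sum>k\<in>K. min (r j) (c * s k) * ovl I u v j k) / 2
      = (\<Sum>j\<in>J. \<Sum>k\<in>K. min (r j) (c * s k) * ((cmod (ip I (u j) (v k)))\<^sup>2 / 2))"
    unfolding ovl_def by (simp add: sum_divide_distrib)
  also have "\<dots> \<le> (\<Sum>j\<in>J. \<Sum>k\<in>K. r j * (cmod (ip I (u j) (v k) - ?z j k))\<^sup>2 + c * s k * (cmod (?z j k))\<^sup>2)"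
  proof (intro sum_mono)
    fix j k assume jk: "j \<in> J" "k \<in> K"
    let ?m = "min (r j) (c * s k)"
    have "0 \<le> ?m" using r s c jk by simp
    then have "?m * ((cmod (ip I (u j) (v k)))\<^sup>2 / 2)
      \<le> ?m * ((cmod (?z j k))\<^sup>2 + (cmod (ip I (u j) (v k) - ?z j k))\<^sup>2)"
      by (intro mult_left_mono half_norm_le)
    also have "\<dots> = ?m * (cmod (ip I (u j) (v k) - ?z j k))\<^sup>2 + ?m * (cmod (?z j k))\<^sup>2"
      by (simp only: distrib_left add.commute)
    also have "\<dots> \<le> r j * (cmod (ip I (u j) (v k) - ?z j k))\<^sup>2 + c * s k * (cmod (?z j k))\<^sup>2"
      by (intro add_mono mult_right_mono) auto
    finally show "?m * ((cmod (ip I (u j) (v k)))\<^sup>2 / 2)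
      \<le> r j * (cmod (ip I (u j) (v k) - ?z j k))\<^sup>2 + c * s k * (cmod (?z j k))\<^sup>2" .
  qed
  also have "\<dots> = (\<Sum>j\<in>J. r j * (\<Sum>k\<in>K. (cmod (ip I (u j) (v k) - ?z j k))\<^sup>2))
      + (\<Sum>j\<in>J. \<Sum>k\<in>K. c * s k * (cmod (?z j k))\<^sup>2)"
    by (simp only: sum.distrib sum_distrib_left)
  also have "(\<Sum>j\<in>J. \<Sum>k\<in>K. c * s k * (cmod (?z j k))\<^sup>2) = (\<Sum>k\<in>K. c * s k * (\<Sum>j\<in>J. (cmod (?z j k))\<^sup>2))"
    by (subst sum.swap) (simp only: sum_distrib_left)
  also have "(\<Sum>j\<in>J. r j * (\<Sum>k\<in>K. (cmod (ip I (u j) (v k) - ?z j k))\<^sup>2))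
      + (\<Sum>k\<in>K. c * s k * (\<Sum>j\<in>J. (cmod (?z j k))\<^sup>2))
      \<le> (\<Sum>j\<in>J. r j * (1 - Re (qf I L (u j)))) + (\<Sum>k\<in>K. c * s k * Re (qf I L (v k)))"
    using e1 e2 r s c by (intro add_mono sum_mono mult_left_mono) auto
  also have "\<dots> = ((\<Sum>j\<in>J. r j) - Re (tr2 I R L)) + c * Re (tr2 I S L)"
    unfolding tr2_spec[OF R] tr2_spec[OF S]
    by (simp add: algebra_simps sum_subtractf sum_distrib_left)
  finally show ?thesis .
qed

text \<open>The bound is pointwise. Where \<open>P\<close> exceeds \<open>g * M * Q\<close>, the
  log-likelihood ratio is at least \<open>log 2 M + log 2 g\<close>. Elsewhere the minimum equals
  \<open>P\<close>, the first term vanishes, and \<open>ln t \<le> t - 1\<close> bounds the loss by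
  \<open>Q / ln 2\<close>, in total by \<open>1 / ln 2\<close>. Only the values of \<open>l\<close>
  where \<open>P\<close> is positive are prescribed, so that \<open>l\<close> can later be a
  difference of logarithms of eigenvalues, without the overlap.\<close>

lemma relative_entropy_ge:
  fixes P Q l :: "'x \<Rightarrow> real"
  assumes fin: "finite X" and P: "\<And>x. x \<in> X \<Longrightarrow> 0 \<le> P x" and Q: "\<And>x. x \<in> X \<Longrightarrow> 0 \<le> Q x"
    and P1: "sum P X = 1" and Q1: "sum Q X = 1"
    and l: "\<And>x. x \<in> X \<Longrightarrow> 0 < P x \<Longrightarrow> 0 < Q x \<and> l x = log 2 (P x / Q x)"
    and M: "1 \<le> M" and g: "0 < g" "g \<le> 1"
  shows "(1 - (\<Sum>x\<in>X. min (P x) (g * M * Q x))) * log 2 M + log 2 g - 1 / ln 2 \<le> (\<Sum>x\<in>X. P x * l x)"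
proof -
  have lM: "0 \<le> log 2 M" and lg: "log 2 g \<le> 0" using M g by auto
  have "(P x - min (P x) (g * M * Q x)) * log 2 M + P x * log 2 g - Q x / ln 2 \<le> P x * l x"
    if x: "x \<in> X" for x
  proof (cases "P x = 0")
    case True
    then show ?thesis using Q[OF x] M g by (simp add: min_def)
  next
    case False
    then have Px: "0 < P x" using P[OF x] by simp
    with l[OF x] have Qx: "0 < Q x" and lx: "l x = log 2 (P x / Q x)" by auto
    show ?thesis
    proof (cases "g * M * Q x < P x")
      case True
      then have "g * M \<le> P x / Q x" using Qx by (simp add: field_simps)
      then have "log 2 (g * M) \<le> l x" unfolding lx using g M Qx Px by (subst log_le_cancel_iff) auto
      then have "log 2 M + log 2 g \<le> l x" using g M by (simp add: log_mult)
      then have "P x * (log 2 M + log 2 g) \<le> P x * l x" using Px by simp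
      moreover have "(P x - min (P x) (g * M * Q x)) * log 2 M \<le> P x * log 2 M"
        using lM M g Qx Px by (intro mult_right_mono) auto
      moreover have "0 \<le> Q x / ln 2" using Qx by simp
      ultimately show ?thesis by (simp add: algebra_simps)
    next
      case False
      have "ln (Q x / P x) \<le> Q x / P x - 1" using Qx Px by (intro ln_le_minus_one) simp
      then have "P x * (- ln (P x / Q x)) \<le> P x * (Q x / P x - 1)"
        using Px Qx by (intro mult_left_mono) (auto simp: ln_div)
      also have "\<dots> \<le> Q x" using Px by (simp add: field_simps)
      finally have "- (Q x / ln 2) \<le> P x * l x"
        unfolding lx log_def by (simp add: field_simps)
      moreover have "P x * log 2 g \<le> 0" using Px lg by (simp add: mult_nonneg_nonpos)
      moreover have "min (P x) (g * M * Q x) = P x" using False by simp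
      ultimately show ?thesis by simp
    qed
  qed
  then have "(\<Sum>x\<in>X. (P x - min (P x) (g * M * Q x)) * log 2 M + P x * log 2 g - Q x / ln 2)
    \<le> (\<Sum>x\<in>X. P x * l x)" by (rule sum_mono)
  moreover have "(\<Sum>x\<in>X. (P x - min (P x) (g * M * Q x)) * log 2 M + P x * log 2 g - Q x / ln 2)
    = (1 - (\<Sum>x\<in>X. min (P x) (g * M * Q x))) * log 2 M + log 2 g - 1 / ln 2"
    using P1 Q1 by (simp add: sum.distrib sum_subtractf sum_distrib_right[symmetric] sum_divide_distrib[symmetric])
  ultimately show ?thesis by simp
qed

text \<open>With \<open>w\<close> the overlaps of the eigenbases this is the quantum relative
  entropy, expressed by eigenvalues so that no matrix logarithm appears. The reading requires that
  no weight falls on a zero eigenvalue of the second state.\<close>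

definition relent :: "'b set \<Rightarrow> 'c set \<Rightarrow> ('b \<Rightarrow> real) \<Rightarrow> ('c \<Rightarrow> real) \<Rightarrow> ('b \<Rightarrow> 'c \<Rightarrow> real) \<Rightarrow> real" where
  "relent J K r s w = (\<Sum>j\<in>J. \<Sum>k\<in>K. r j * w j k * (log 2 (r j) - log 2 (s k)))"

text \<open>The factor 2 is the one lost in \<open>half_norm_le\<close>: the mass of the pointwise
  minimum is at most twice the weighted error of the test, with weight \<open>g * M\<close> on the
  second state. The condition \<open>supp\<close> says that the first state has no weight on the
  kernel of the second.\<close>

lemma relent_test_ge:
  assumes R: "spectral I J R r u" and S: "spectral I K S s v"
    and r: "\<And>j. j \<in> J \<Longrightarrow> 0 \<le> r j" and s: "\<And>k. k \<in> K \<Longrightarrow> 0 \<le> s k"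
    and r1: "sum r J = 1" and s1: "sum s K = 1"
    and supp: "\<And>j k. j \<in> J \<Longrightarrow> k \<in> K \<Longrightarrow> s k = 0 \<Longrightarrow> r j * ovl I u v j k = 0"
    and L: "pos I L" and L': "pos I (\<lambda>a b. idm a b - L a b)"
    and M: "1 \<le> M" and g: "0 < g" "g \<le> 1"
  shows "(1 - 2 * (1 - Re (tr2 I R L) + g * M * Re (tr2 I S L))) * log 2 M + log 2 g - 1 / ln 2
    \<le> relent J K r s (ovl I u v)"
proof -
  note RD = specD[OF R] and SD = specD[OF S]
  let ?w = "ovl I u v"
  define P where "P = (\<lambda>(j, k). r j * ?w j k)"
  define Q where "Q = (\<lambda>(j, k). s k * ?w j k)"
  have w: "0 \<le> ?w j k" for j k by (rule ovl_nonneg)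
  have "(1 - (\<Sum>x\<in>J\<times>K. min (P x) (g * M * Q x))) * log 2 M + log 2 g - 1 / ln 2
    \<le> (\<Sum>x\<in>J\<times>K. P x * (case x of (j, k) \<Rightarrow> log 2 (r j) - log 2 (s k)))"
  proof (rule relative_entropy_ge[OF _ _ _ _ _ _ M g])
    show "finite (J \<times> K)" using RD SD by simp
    show "0 \<le> P x" "0 \<le> Q x" if "x \<in> J \<times> K" for x
      using that r s w by (auto simp: P_def Q_def)
    show "sum P (J \<times> K) = 1"
      unfolding P_def sum.cartesian_product[symmetric] sum_distrib_left[symmetric]
      using ovl_sum_right[OF RD(1) SD(1)] r1 by simp
    show "sum Q (J \<times> K) = 1"
      unfolding Q_def sum.cartesian_product[symmetric]
      by (subst sum.swap) (use ovl_sum_left[OF RD(1) SD(1)] s1 in \<open>simp add: sum_distrib_left[symmetric]\<close>)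
    show "0 < Q x \<and> (case x of (j, k) \<Rightarrow> log 2 (r j) - log 2 (s k)) = log 2 (P x / Q x)"
      if x: "x \<in> J \<times> K" and px: "0 < P x" for x
    proof -
      obtain j k where jk: "x = (j, k)" "j \<in> J" "k \<in> K" using x by auto
      have "0 < r j * ?w j k" using px by (simp add: P_def jk)
      then have "0 < r j" "0 < ?w j k" using r[OF jk(2)] w[of j k] by (auto simp: zero_less_mult_iff)
      moreover have "0 < s k" using supp[OF jk(2,3)] s[OF jk(3)] calculation by fastforce
      ultimately show ?thesis by (simp add: jk P_def Q_def log_divide)
    qed
  qed
  moreover have "(\<Sum>x\<in>J\<times>K. P x * (case x of (j, k) \<Rightarrow> log 2 (r j) - log 2 (s k))) = relent J K r s ?w"
    unfolding relent_def sum.cartesian_product by (intro sum.cong refl) (auto simp: P_def)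
  moreover have "(\<Sum>x\<in>J\<times>K. min (P x) (g * M * Q x)) \<le> 2 * (1 - Re (tr2 I R L) + g * M * Re (tr2 I S L))"
  proof -
    have "(\<Sum>x\<in>J\<times>K. min (P x) (g * M * Q x)) = (\<Sum>j\<in>J. \<Sum>k\<in>K. min (r j) (g * M * s k) * ?w j k)"
      unfolding sum.cartesian_product
      using w by (intro sum.cong refl) (auto simp: P_def Q_def min_mult_distrib_right mult.assoc)
    moreover have "0 \<le> g * M" using g M by simp
    ultimately show ?thesis using test_error_ge[OF R S r s _ L L', of "g * M"] r1 by simp
  qed
  then have "(1 - 2 * (1 - Re (tr2 I R L) + g * M * Re (tr2 I S L))) * log 2 M
    \<le> (1 - (\<Sum>x\<in>J\<times>K. min (P x) (g * M * Q x))) * log 2 M"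
    using M by (intro mult_right_mono) auto
  ultimately show ?thesis by linarith
qed

section \<open>Product states\<close>

lemma psd_pos:
  assumes "psd d R" shows "pos {..<d} (\<lambda>a b. R $$ (a, b))"
proof -
  have h: "R $$ (b, a) = cnj (R $$ (a, b))" if "a < d" "b < d" for a b
    using assms that unfolding psd_def hermitian_def by blast
  have "0 \<le> Re (qf {..<d} (\<lambda>a b. R $$ (a, b)) x)" for x
    using assms unfolding psd_def qf_expand by blast
  then show ?thesis unfolding pos_def using h[symmetric] by (simp only: lessThan_iff) blast
qed

lemma qf_eigenvector:
  assumes S: "spectral I K A s v" and k: "k \<in> K"
  shows "Re (qf I A (v k)) = s k"
proof -
  note SD = specD[OF S]
  have "Re (qf I A (v k)) = (\<Sum>j\<in>K. s j * ovl I v v j k)" by (rule ovl_sum_spec[OF S, symmetric])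
  also have "\<dots> = (\<Sum>j\<in>K. if j = k then s j else 0)"
    using onbD(3)[OF SD(1)] k by (intro sum.cong refl) (simp add: ovl_def ip_def)
  finally show ?thesis using k SD(3) by simp
qed

lemma psd_spec:
  assumes "psd d R"
  shows "\<exists>r u. spectral {..<d} {..<d} (\<lambda>a b. R $$ (a, b)) r u \<and> (\<forall>j<d. 0 \<le> r j)"
proof -
  have p: "pos {..<d} (\<lambda>a b. R $$ (a, b))" using assms by (rule psd_pos)
  have "R $$ (b, a) = cnj (R $$ (a, b))" if "a < d" "b < d" for a b
    using p that unfolding pos_def by (simp only: lessThan_iff)
  then obtain r u where s: "spectral {..<d} {..<d} (\<lambda>a b. R $$ (a, b)) r u"
    using hermitian_spec[of d "\<lambda>a b. R $$ (a, b)"] by blast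
  have "0 \<le> r j" if "j < d" for j
    using qf_eigenvector[OF s, of j] that p unfolding pos_def by (metis lessThan_iff)
  then show ?thesis using s by blast
qed

lemma density_spec:
  assumes "density d R"
  shows "\<exists>r u. spectral {..<d} {..<d} (\<lambda>a b. R $$ (a, b)) r u \<and> (\<forall>j<d. 0 \<le> r j) \<and> (\<Sum>j<d. r j) = 1"
proof -
  obtain r u where s: "spectral {..<d} {..<d} (\<lambda>a b. R $$ (a, b)) r u" and r: "\<forall>j<d. 0 \<le> r j"
    using psd_spec assms unfolding density_def by blast
  note S = specD[OF s]
  have "R \<in> carrier_mat d d" using assms by (simp add: density_def psd_def hermitian_def)
  then have "1 = (\<Sum>a<d. R $$ (a, a))" using assms by (simp add: density_def mtrace_def)
  also have "\<dots> = (\<Sum>a<d. \<Sum>j<d. of_real (r j) * (u j a * cnj (u j a)))" by (simp add: S(4))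
  also have "\<dots> = (\<Sum>j<d. of_real (r j) * (\<Sum>a<d. cnj (u j a) * u j a))"
    by (subst sum.swap) (simp add: sum_distrib_left mult_ac)
  also have "\<dots> = of_real (\<Sum>j<d. r j)" by (simp add: onbD(3)[OF S(1)])
  finally have "(\<Sum>j<d. r j) = 1" by (metis of_real_eq_1_iff)
  then show ?thesis using s r by blast
qed

lemma eta_nonneg: "0 \<le> t \<Longrightarrow> eta t = - (t * log 2 t)"
  by (simp add: eta_def)

lemma vn_entropy_density:
  assumes "R \<in> carrier_mat d d" "spectral {..<d} J (\<lambda>a b. R $$ (a, b)) r u"
  shows "vn_entropy R = (\<Sum>j\<in>J. eta (r j))"
  by (rule vn_entropy_spec[OF assms(2), of id d]) (use assms(1) in auto)

text \<open>The second term is linear in the state \<open>R\<close>. This is what lets an average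
  over messages, and later an affine bound on the entropy, be computed exactly.\<close>

lemma relent_expand:
  assumes R: "spectral I J R r u" and v: "onb I K v" and r: "\<And>j. j \<in> J \<Longrightarrow> 0 \<le> r j"
  shows "relent J K r s (ovl I u v) = - (\<Sum>j\<in>J. eta (r j)) - (\<Sum>k\<in>K. Re (qf I R (v k)) * log 2 (s k))"
proof -
  note RD = specD[OF R]
  have "relent J K r s (ovl I u v)
    = (\<Sum>j\<in>J. \<Sum>k\<in>K. r j * log 2 (r j) * ovl I u v j k) - (\<Sum>j\<in>J. \<Sum>k\<in>K. r j * ovl I u v j k * log 2 (s k))"
    unfolding relent_def sum_subtractf[symmetric] by (simp add: algebra_simps)
  also have "(\<Sum>j\<in>J. \<Sum>k\<in>K. r j * log 2 (r j) * ovl I u v j k) = - (\<Sum>j\<in>J. eta (r j))"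
    unfolding sum_distrib_left[symmetric] sum_negf[symmetric]
    using ovl_sum_right[OF RD(1) v] r by (intro sum.cong refl) (simp add: eta_nonneg)
  also have "(\<Sum>j\<in>J. \<Sum>k\<in>K. r j * ovl I u v j k * log 2 (s k)) = (\<Sum>k\<in>K. Re (qf I R (v k)) * log 2 (s k))"
    by (subst sum.swap) (simp only: sum_distrib_right[symmetric] ovl_sum_spec[OF R])
  finally show ?thesis .
qed

section \<open>Tensor products of bases and additivity of relative entropy\<close>

lemma sum_PiE_prod:
  fixes n D :: nat and f :: "nat \<Rightarrow> nat \<Rightarrow> 'b::comm_semiring_1"
  assumes e: "bij_betw e I (PiE {..<n} (\<lambda>_. {..<D}))"
  shows "(\<Sum>a\<in>I. \<Prod>t<n. f t (e a t)) = (\<Prod>t<n. \<Sum>b<D. f t b)"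
proof -
  have "(\<Sum>a\<in>I. \<Prod>t<n. f t (e a t)) = (\<Sum>g\<in>PiE {..<n} (\<lambda>_. {..<D}). \<Prod>t<n. f t (g t))"
    by (rule sum.reindex_bij_betw[OF e])
  also have "\<dots> = (\<Prod>t<n. \<Sum>b<D. f t b)" using prod_sum_PiE[of "{..<n}" "\<lambda>_. {..<D}" f] by simp
  finally show ?thesis .
qed

lemma sum_PiE_prod_id:
  fixes n D :: nat and f :: "nat \<Rightarrow> nat \<Rightarrow> 'b::comm_semiring_1"
  shows "(\<Sum>g\<in>PiE {..<n} (\<lambda>_. {..<D}). \<Prod>t<n. f t (g t)) = (\<Prod>t<n. \<Sum>b<D. f t b)"
  using prod_sum_PiE[of "{..<n}" "\<lambda>_. {..<D}" f] by simp

text \<open>The bijection \<open>e\<close> reads an index as its sequence of local indices. Sums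
  over the product space then factor, and a product of Kronecker deltas is the delta of the
  sequences.\<close>

lemma onb_prod:
  fixes n D :: nat
  assumes e: "bij_betw e I (PiE {..<n} (\<lambda>_. {..<D}))" and u: "\<And>t. t < n \<Longrightarrow> onb {..<D} {..<D} (u t)"
  shows "onb I (PiE {..<n} (\<lambda>_. {..<D})) (\<lambda>j a. \<Prod>t<n. u t (j t) (e a t))"
proof -
  let ?P = "PiE {..<n} (\<lambda>_. {..<D})"
  have fP: "finite ?P" by (intro finite_PiE) auto
  then have fI: "finite I" using e bij_betw_finite by blast
  have delta: "(\<Prod>t<n. if j t = k t then 1 else (0::complex)) = (if j = k then 1 else 0)" if jk: "j \<in> ?P" "k \<in> ?P" for j k
  proof (cases "j = k")
    case False
    then obtain t where "t \<in> {..<n}" "j t \<noteq> k t" using PiE_ext[OF jk] by blast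
    then have "(\<Prod>t<n. if j t = k t then 1 else (0::complex)) = 0" by (intro prod_zero) auto
    then show ?thesis using False by simp
  qed simp
  have 1: "(\<Sum>a\<in>I. cnj (\<Prod>t<n. u t (j t) (e a t)) * (\<Prod>t<n. u t (k t) (e a t))) = (if j = k then 1 else 0)"
    if jk: "j \<in> ?P" "k \<in> ?P" for j k
  proof -
    have "(\<Sum>a\<in>I. cnj (\<Prod>t<n. u t (j t) (e a t)) * (\<Prod>t<n. u t (k t) (e a t)))
      = (\<Sum>a\<in>I. \<Prod>t<n. cnj (u t (j t) (e a t)) * u t (k t) (e a t))" by (simp add: prod.distrib)
    also have "\<dots> = (\<Prod>t<n. \<Sum>b<D. cnj (u t (j t) b) * u t (k t) b)" by (rule sum_PiE_prod[OF e])
    also have "\<dots> = (\<Prod>t<n. if j t = k t then 1 else 0)"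
    proof (rule prod.cong[OF refl])
      fix t assume "t \<in> {..<n}"
      then have t: "t < n" "j t \<in> {..<D}" "k t \<in> {..<D}" using jk by (simp_all add: PiE_iff)
      show "(\<Sum>b<D. cnj (u t (j t) b) * u t (k t) b) = (if j t = k t then 1 else 0)"
        by (rule onbD(3)[OF u[OF t(1)] t(2,3)])
    qed
    finally show ?thesis using delta[OF jk] by simp
  qed
  have 2: "(\<Sum>j\<in>?P. (\<Prod>t<n. u t (j t) (e a t)) * cnj (\<Prod>t<n. u t (j t) (e b t))) = (if a = b then 1 else 0)"
    if ab: "a \<in> I" "b \<in> I" for a b
  proof -
    have eP: "e a \<in> ?P" "e b \<in> ?P" using e ab by (auto simp: bij_betw_def)
    have "(\<Sum>j\<in>?P. (\<Prod>t<n. u t (j t) (e a t)) * cnj (\<Prod>t<n. u t (j t) (e b t)))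
      = (\<Sum>j\<in>?P. \<Prod>t<n. u t (j t) (e a t) * cnj (u t (j t) (e b t)))" by (simp add: prod.distrib)
    also have "\<dots> = (\<Prod>t<n. \<Sum>j<D. u t j (e a t) * cnj (u t j (e b t)))" by (rule sum_PiE_prod_id)
    also have "\<dots> = (\<Prod>t<n. if e a t = e b t then 1 else 0)"
    proof (rule prod.cong[OF refl])
      fix t assume "t \<in> {..<n}"
      then have t: "t < n" "e a t \<in> {..<D}" "e b t \<in> {..<D}" using eP by (simp_all add: PiE_iff)
      show "(\<Sum>j<D. u t j (e a t) * cnj (u t j (e b t))) = (if e a t = e b t then 1 else 0)"
        by (rule onbD(4)[OF u[OF t(1)] t(2,3)])
    qed
    also have "\<dots> = (if e a = e b then 1 else 0)" by (rule delta[OF eP])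
    also have "\<dots> = (if a = b then 1 else 0)" using e ab by (auto simp: bij_betw_def inj_on_def)
    finally show ?thesis .
  qed
  show ?thesis unfolding onb_def by (intro conjI ballI fI fP 1 2)
qed

lemma spec_prod:
  fixes n D :: nat
  assumes e: "bij_betw e I (PiE {..<n} (\<lambda>_. {..<D}))"
    and s: "\<And>t. t < n \<Longrightarrow> spectral {..<D} {..<D} (A t) (r t) (u t)"
  shows "spectral I (PiE {..<n} (\<lambda>_. {..<D})) (\<lambda>a b. \<Prod>t<n. A t (e a t) (e b t))
    (\<lambda>j. \<Prod>t<n. r t (j t)) (\<lambda>j a. \<Prod>t<n. u t (j t) (e a t))"
  unfolding spectral_def
proof (intro conjI ballI)
  let ?P = "PiE {..<n} (\<lambda>_. {..<D})"
  show "onb I ?P (\<lambda>j a. \<Prod>t<n. u t (j t) (e a t))" using onb_prod[OF e] specD(1)[OF s] by blast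
  fix a b assume ab: "a \<in> I" "b \<in> I"
  have eP: "e a \<in> ?P" "e b \<in> ?P" using e ab by (auto simp: bij_betw_def)
  have "(\<Prod>t<n. A t (e a t) (e b t)) = (\<Prod>t<n. \<Sum>j<D. of_real (r t j) * (u t j (e a t) * cnj (u t j (e b t))))"
  proof (rule prod.cong[OF refl])
    fix t assume "t \<in> {..<n}"
    then have t: "t < n" "e a t \<in> {..<D}" "e b t \<in> {..<D}" using eP by (simp_all add: PiE_iff)
    show "A t (e a t) (e b t) = (\<Sum>j<D. of_real (r t j) * (u t j (e a t) * cnj (u t j (e b t))))"
      by (rule specD(4)[OF s[OF t(1)] t(2,3)])
  qed
  also have "\<dots> = (\<Sum>j\<in>?P. \<Prod>t<n. of_real (r t (j t)) * (u t (j t) (e a t) * cnj (u t (j t) (e b t))))"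
    by (rule sum_PiE_prod_id[symmetric])
  also have "\<dots> = (\<Sum>j\<in>?P. of_real (\<Prod>t<n. r t (j t)) * ((\<Prod>t<n. u t (j t) (e a t)) * cnj (\<Prod>t<n. u t (j t) (e b t))))"
    by (simp add: prod.distrib)
  finally show "(\<Prod>t<n. A t (e a t) (e b t)) = \<dots>" .
qed

lemma ovl_prod:
  fixes n D :: nat
  assumes e: "bij_betw e I (PiE {..<n} (\<lambda>_. {..<D}))"
  shows "ovl I (\<lambda>j a. \<Prod>t<n. u t (j t) (e a t)) (\<lambda>j a. \<Prod>t<n. v t (j t) (e a t)) j k
    = (\<Prod>t<n. ovl {..<D} (u t) (v t) (j t) (k t))"
proof -
  have "ip I (\<lambda>a. \<Prod>t<n. u t (j t) (e a t)) (\<lambda>a. \<Prod>t<n. v t (k t) (e a t))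
    = (\<Sum>a\<in>I. \<Prod>t<n. cnj (u t (j t) (e a t)) * v t (k t) (e a t))" unfolding ip_def by (simp add: prod.distrib)
  also have "\<dots> = (\<Prod>t<n. ip {..<D} (u t (j t)) (v t (k t)))" unfolding ip_def by (rule sum_PiE_prod[OF e])
  finally show ?thesis unfolding ovl_def by (simp add: prod_norm[symmetric] prod_power_distrib)
qed

lemma log_prod:
  fixes n :: nat
  assumes "\<And>t. t < n \<Longrightarrow> 0 < (f t :: real)"
  shows "log 2 (\<Prod>t<n. f t) = (\<Sum>t<n. log 2 (f t))"
  using assms
proof (induction n)
  case (Suc n)
  have "0 < (\<Prod>t<n. f t)" using Suc.prems by (intro prod_pos) auto
  then have "log 2 (\<Prod>t<Suc n. f t) = log 2 (\<Prod>t<n. f t) + log 2 (f n)"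
    using Suc.prems[of n] by (simp add: log_mult_pos)
  also have "log 2 (\<Prod>t<n. f t) = (\<Sum>t<n. log 2 (f t))" using Suc by simp
  finally show ?case by simp
qed simp

text \<open>The logarithm of a product is a sum over the positions, and for each of them all other
  factors sum to one by \<open>P1\<close>. The condition \<open>supp\<close> makes every factor
  positive wherever the weight is nonzero, so that the logarithms do split.\<close>

lemma relent_prod:
  fixes r s :: "nat \<Rightarrow> nat \<Rightarrow> real" and w :: "nat \<Rightarrow> nat \<Rightarrow> nat \<Rightarrow> real"
  assumes r: "\<And>t j. t < n \<Longrightarrow> j < D \<Longrightarrow> 0 \<le> r t j" and s: "\<And>t j. t < n \<Longrightarrow> j < D \<Longrightarrow> 0 \<le> s t j"
    and w: "\<And>t j k. 0 \<le> w t j k"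
    and P1: "\<And>t. t < n \<Longrightarrow> (\<Sum>j<D. \<Sum>k<D. r t j * w t j k) = 1"
    and supp: "\<And>t j k. t < n \<Longrightarrow> j < D \<Longrightarrow> k < D \<Longrightarrow> s t k = 0 \<Longrightarrow> r t j * w t j k = 0"
  shows "relent (PiE {..<n} (\<lambda>_. {..<D})) (PiE {..<n} (\<lambda>_. {..<D})) (\<lambda>j. \<Prod>t<n. r t (j t))
     (\<lambda>j. \<Prod>t<n. s t (j t)) (\<lambda>j k. \<Prod>t<n. w t (j t) (k t))
    = (\<Sum>t<n. relent {..<D} {..<D} (r t) (s t) (w t))"
proof -
  let ?P = "PiE {..<n} (\<lambda>_. {..<D})"
  let ?g = "\<lambda>t j k. log 2 (r t j) - log 2 (s t k)"
  \<comment> \<open>The logarithm is attached to the single factor \<open>t = t'\<close>. Each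
    summand is then again a product over positions, and the sum over sequences factors.\<close>
  have "(\<Prod>t<n. r t (j t)) * (\<Prod>t<n. w t (j t) (k t)) * (log 2 (\<Prod>t<n. r t (j t)) - log 2 (\<Prod>t<n. s t (k t)))
    = (\<Sum>t'<n. \<Prod>t<n. r t (j t) * w t (j t) (k t) * (if t = t' then ?g t (j t) (k t) else 1))"
    if jk: "j \<in> ?P" "k \<in> ?P" for j k
  proof -
    let ?Q = "(\<Prod>t<n. r t (j t)) * (\<Prod>t<n. w t (j t) (k t))"
    have jD: "j t < D" and kD: "k t < D" if "t < n" for t using jk that by (auto simp: PiE_iff)
    have *: "(\<Prod>t<n. r t (j t) * w t (j t) (k t) * (if t = t' then ?g t (j t) (k t) else 1)) = ?Q * ?g t' (j t') (k t')"
      if "t' < n" for t'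
      using that by (simp add: prod.distrib)
    have "?Q * (log 2 (\<Prod>t<n. r t (j t)) - log 2 (\<Prod>t<n. s t (k t))) = ?Q * (\<Sum>t'<n. ?g t' (j t') (k t'))"
    proof (cases "?Q = 0")
      case False
      have nz: "r t (j t) * w t (j t) (k t) \<noteq> 0" if "t < n" for t
        using False that by (auto simp: prod_zero_iff)
      have "0 < r t (j t)" if t: "t < n" for t
        using nz[OF t] r[OF t jD[OF t]] by (cases "r t (j t) = 0") simp_all
      moreover have "0 < s t (k t)" if t: "t < n" for t
        using nz[OF t] s[OF t kD[OF t]] supp[OF t jD[OF t] kD[OF t]] by (cases "s t (k t) = 0") simp_all
      ultimately show ?thesis by (simp add: log_prod sum_subtractf)
    qed simp
    then show ?thesis using * by (simp add: sum_distrib_left)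
  qed
  then have "relent ?P ?P (\<lambda>j. \<Prod>t<n. r t (j t)) (\<lambda>j. \<Prod>t<n. s t (j t)) (\<lambda>j k. \<Prod>t<n. w t (j t) (k t))
    = (\<Sum>j\<in>?P. \<Sum>k\<in>?P. \<Sum>t'<n. \<Prod>t<n. r t (j t) * w t (j t) (k t) * (if t = t' then ?g t (j t) (k t) else 1))"
    unfolding relent_def by (intro sum.cong refl) simp
  also have "\<dots> = (\<Sum>j\<in>?P. \<Sum>t'<n. \<Sum>k\<in>?P. \<Prod>t<n. r t (j t) * w t (j t) (k t) * (if t = t' then ?g t (j t) (k t) else 1))"
    by (rule sum.cong[OF refl], rule sum.swap)
  also have "\<dots> = (\<Sum>t'<n. \<Sum>j\<in>?P. \<Sum>k\<in>?P. \<Prod>t<n. r t (j t) * w t (j t) (k t) * (if t = t' then ?g t (j t) (k t) else 1))"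
    by (rule sum.swap)
  also have "\<dots> = (\<Sum>t'<n. \<Prod>t<n. \<Sum>j<D. \<Sum>k<D. r t j * w t j k * (if t = t' then ?g t j k else 1))"
  proof (rule sum.cong[OF refl])
    fix t'
    have "(\<Sum>k\<in>?P. \<Prod>t<n. r t (j t) * w t (j t) (k t) * (if t = t' then ?g t (j t) (k t) else 1))
      = (\<Prod>t<n. \<Sum>k<D. r t (j t) * w t (j t) k * (if t = t' then ?g t (j t) k else 1))" for j
      by (rule sum_PiE_prod_id)
    then show "(\<Sum>j\<in>?P. \<Sum>k\<in>?P. \<Prod>t<n. r t (j t) * w t (j t) (k t) * (if t = t' then ?g t (j t) (k t) else 1))
      = (\<Prod>t<n. \<Sum>j<D. \<Sum>k<D. r t j * w t j k * (if t = t' then ?g t j k else 1))"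
      by (simp only: sum_PiE_prod_id[of "\<lambda>t j. \<Sum>k<D. r t j * w t j k * (if t = t' then ?g t j k else 1)"])
  qed
  also have "\<dots> = (\<Sum>t'<n. relent {..<D} {..<D} (r t') (s t') (w t'))"
  proof (intro sum.cong refl)
    fix t' assume t': "t' \<in> {..<n}"
    have "(\<Prod>t<n. \<Sum>j<D. \<Sum>k<D. r t j * w t j k * (if t = t' then ?g t j k else 1))
      = (\<Prod>t<n. if t = t' then relent {..<D} {..<D} (r t') (s t') (w t') else 1)"
      using P1 by (intro prod.cong refl) (auto simp: relent_def)
    then show "(\<Prod>t<n. \<Sum>j<D. \<Sum>k<D. r t j * w t j k * (if t = t' then ?g t j k else 1))
      = relent {..<D} {..<D} (r t') (s t') (w t')" using t' by simp
  qed
  finally show ?thesis .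
qed

section \<open>Averages of states and the converse for product states\<close>

definition mix :: "nat \<Rightarrow> 'x set \<Rightarrow> ('x \<Rightarrow> real) \<Rightarrow> ('x \<Rightarrow> complex mat) \<Rightarrow> complex mat" where
  "mix d X p R = mat d d (\<lambda>ij. \<Sum>x\<in>X. of_real (p x) * R x $$ ij)"

lemma mix_carrier [simp]: "mix d X p R \<in> carrier_mat d d"
  by (simp add: mix_def)

lemma qf_mix:
  "qf {..<d} (\<lambda>a b. mix d X p R $$ (a, b)) v = (\<Sum>x\<in>X. of_real (p x) * qf {..<d} (\<lambda>a b. R x $$ (a, b)) v)"
proof -
  have "qf {..<d} (\<lambda>a b. mix d X p R $$ (a, b)) v
    = (\<Sum>a<d. \<Sum>b<d. \<Sum>x\<in>X. of_real (p x) * (cnj (v a) * R x $$ (a, b) * v b))"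
    unfolding qf_expand mix_def by (intro sum.cong refl) (simp add: sum_distrib_left sum_distrib_right mult_ac)
  also have "\<dots> = (\<Sum>a<d. \<Sum>x\<in>X. \<Sum>b<d. of_real (p x) * (cnj (v a) * R x $$ (a, b) * v b))"
    by (rule sum.cong[OF refl], rule sum.swap)
  also have "\<dots> = (\<Sum>x\<in>X. \<Sum>a<d. \<Sum>b<d. of_real (p x) * (cnj (v a) * R x $$ (a, b) * v b))"
    by (rule sum.swap)
  finally show ?thesis unfolding qf_expand sum_distrib_left .
qed

lemma psd_carrier: "psd d R \<Longrightarrow> R \<in> carrier_mat d d"
  by (simp add: psd_def hermitian_def)

lemma psdI:
  assumes "R \<in> carrier_mat d d" "pos {..<d} (\<lambda>a b. R $$ (a, b))"
  shows "psd d R"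
proof -
  have "R $$ (b, a) = cnj (R $$ (a, b))" if "a < d" "b < d" for a b
    using assms(2) that unfolding pos_def by (simp only: lessThan_iff)
  then show ?thesis using assms unfolding psd_def hermitian_def pos_def qf_expand by blast
qed

lemma density_mix:
  assumes R: "\<And>x. x \<in> X \<Longrightarrow> density d (R x)" and p: "\<And>x. x \<in> X \<Longrightarrow> 0 \<le> p x" and p1: "sum p X = 1"
  shows "density d (mix d X p R)"
proof -
  have ps: "pos {..<d} (\<lambda>a b. R x $$ (a, b))" if "x \<in> X" for x
    using R[OF that] psd_pos by (auto simp: density_def)
  have "pos {..<d} (\<lambda>a b. mix d X p R $$ (a, b))"
    unfolding pos_def
  proof (intro conjI ballI allI)
    fix a b assume ab: "a \<in> {..<d}" "b \<in> {..<d}"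
    have "cnj (R x $$ (a, b)) = R x $$ (b, a)" if "x \<in> X" for x
      using ps[OF that] ab unfolding pos_def by blast
    then show "cnj (mix d X p R $$ (a, b)) = mix d X p R $$ (b, a)"
      using ab by (simp add: mix_def)
  next
    fix v
    show "0 \<le> Re (qf {..<d} (\<lambda>a b. mix d X p R $$ (a, b)) v)"
      unfolding qf_mix using ps p by (simp add: sum_nonneg pos_def)
  qed
  then have "psd d (mix d X p R)" by (rule psdI[OF mix_carrier])
  moreover have "mtrace (mix d X p R) = 1"
  proof -
    have t: "(\<Sum>i<d. R x $$ (i, i)) = 1" if "x \<in> X" for x
      using R[OF that] psd_carrier by (auto simp: density_def mtrace_def)
    have "mtrace (mix d X p R) = (\<Sum>x\<in>X. of_real (p x) * (\<Sum>i<d. R x $$ (i, i)))"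
      unfolding mtrace_def mix_def by (simp add: sum_distrib_left) (rule sum.swap)
    also have "\<dots> = of_real (sum p X)" using t by simp
    finally show ?thesis using p1 by simp
  qed
  ultimately show ?thesis by (simp add: density_def)
qed

text \<open>One message against the reference state. The latter enters through its local eigenbases
  \<open>v t\<close>, which are the same for all messages, so that the cross terms can be added up
  over the messages afterwards.\<close>

lemma product_test_ge:
  fixes n D :: nat
  assumes e: "bij_betw e I (PiE {..<n} (\<lambda>_. {..<D}))"
    and rho: "\<And>t. t < n \<Longrightarrow> density D (rho t)"
    and S: "\<And>t. t < n \<Longrightarrow> spectral {..<D} {..<D} (sg t) (s t) (v t)"
    and s0: "\<And>t k. t < n \<Longrightarrow> k < D \<Longrightarrow> 0 \<le> s t k" and s1: "\<And>t. t < n \<Longrightarrow> (\<Sum>k<D. s t k) = 1"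
    and supp: "\<And>t k. t < n \<Longrightarrow> k < D \<Longrightarrow> s t k = 0 \<Longrightarrow> Re (qf {..<D} (\<lambda>a b. rho t $$ (a, b)) (v t k)) = 0"
    and L: "pos I L" and L': "pos I (\<lambda>a b. idm a b - L a b)"
    and M: "1 \<le> M" and g: "0 < g" "g \<le> 1"
  shows "(1 - 2 * (1 - Re (tr2 I (\<lambda>a b. \<Prod>t<n. rho t $$ (e a t, e b t)) L)
        + g * M * Re (tr2 I (\<lambda>a b. \<Prod>t<n. sg t (e a t) (e b t)) L))) * log 2 M + log 2 g - 1 / ln 2
    \<le> (\<Sum>t<n. - vn_entropy (rho t) - (\<Sum>k<D. Re (qf {..<D} (\<lambda>a b. rho t $$ (a, b)) (v t k)) * log 2 (s t k)))"
proof -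
  let ?P = "PiE {..<n} (\<lambda>_. {..<D})"
  let ?R = "\<lambda>t a b. rho t $$ (a, b)"
  have "\<forall>t. \<exists>r u. t < n \<longrightarrow> spectral {..<D} {..<D} (?R t) r u \<and> (\<forall>j<D. 0 \<le> r j) \<and> (\<Sum>j<D. r j) = 1"
    using density_spec[OF rho] by blast
  then obtain r u where ru: "\<forall>t. t < n \<longrightarrow> spectral {..<D} {..<D} (?R t) (r t) (u t) \<and> (\<forall>j<D. 0 \<le> r t j) \<and> (\<Sum>j<D. r t j) = 1"
    unfolding choice_iff by blast
  have R: "spectral {..<D} {..<D} (?R t) (r t) (u t)" and r0: "j < D \<Longrightarrow> 0 \<le> r t j" and r1: "(\<Sum>j<D. r t j) = 1"
    if "t < n" for t j using ru that by auto
  let ?w = "\<lambda>t. ovl {..<D} (u t) (v t)"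
  \<comment> \<open>The diagonal entry assumed to vanish is a sum of nonnegative terms over the
    eigenvectors of the state, so each of them vanishes.\<close>
  have suppw: "r t j * ?w t j k = 0" if t: "t < n" and jk: "j < D" "k < D" and sk: "s t k = 0" for t j k
  proof -
    have "(\<Sum>j<D. r t j * ?w t j k) = 0" using ovl_sum_spec[OF R[OF t], where v = "v t" and k = k] supp[OF t jk(2) sk] by simp
    then have "\<forall>j\<in>{..<D}. r t j * ?w t j k = 0"
      using r0[OF t] by (subst (asm) sum_nonneg_eq_0_iff) (auto intro!: mult_nonneg_nonneg ovl_nonneg)
    then show ?thesis using jk by simp
  qed
  have PJ: "j t < D" if "j \<in> ?P" "t < n" for j :: "nat \<Rightarrow> nat" and t using that by (auto simp: PiE_iff)
  define U where "U = (\<lambda>j a. \<Prod>t<n. u t (j t) (e a t))"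
  define V where "V = (\<lambda>j a. \<Prod>t<n. v t (j t) (e a t))"
  have ov: "ovl I U V j k = (\<Prod>t<n. ?w t (j t) (k t))" for j k
    unfolding U_def V_def by (rule ovl_prod[OF e])
  have "(1 - 2 * (1 - Re (tr2 I (\<lambda>a b. \<Prod>t<n. ?R t (e a t) (e b t)) L)
        + g * M * Re (tr2 I (\<lambda>a b. \<Prod>t<n. sg t (e a t) (e b t)) L))) * log 2 M + log 2 g - 1 / ln 2
     \<le> relent ?P ?P (\<lambda>j. \<Prod>t<n. r t (j t)) (\<lambda>j. \<Prod>t<n. s t (j t)) (ovl I U V)"
  proof (rule relent_test_ge[OF _ _ _ _ _ _ _ L L' M g])
    show "spectral I ?P (\<lambda>a b. \<Prod>t<n. ?R t (e a t) (e b t)) (\<lambda>j. \<Prod>t<n. r t (j t)) U"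
      unfolding U_def by (rule spec_prod[OF e R])
    show "spectral I ?P (\<lambda>a b. \<Prod>t<n. sg t (e a t) (e b t)) (\<lambda>j. \<Prod>t<n. s t (j t)) V"
      unfolding V_def by (rule spec_prod[OF e S])
    show "0 \<le> (\<Prod>t<n. r t (j t))" "0 \<le> (\<Prod>t<n. s t (j t))" if "j \<in> ?P" for j
      using PJ[OF that] r0 s0 by (auto intro!: prod_nonneg)
    show "(\<Sum>j\<in>?P. \<Prod>t<n. r t (j t)) = 1" "(\<Sum>j\<in>?P. \<Prod>t<n. s t (j t)) = 1"
      unfolding sum_PiE_prod_id using r1 s1 by simp_all
    show "(\<Prod>t<n. r t (j t)) * ovl I U V j k = 0"
      if jk: "j \<in> ?P" "k \<in> ?P" and z: "(\<Prod>t<n. s t (k t)) = 0" for j k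
    proof -
      obtain t where t: "t < n" "s t (k t) = 0" using z by (auto simp: prod_zero_iff)
      then have "(\<Prod>t<n. r t (j t) * ?w t (j t) (k t)) = 0"
        using suppw[OF t(1) PJ[OF jk(1) t(1)] PJ[OF jk(2) t(1)] t(2)] by (intro prod_zero) auto
      then show ?thesis unfolding ov prod.distrib[symmetric] .
    qed
  qed
  also have "\<dots> = (\<Sum>t<n. relent {..<D} {..<D} (r t) (s t) (?w t))"
    unfolding ov[abs_def]
  proof (rule relent_prod[OF r0 s0 ovl_nonneg _ suppw])
    fix t assume t: "t < n"
    show "(\<Sum>j<D. \<Sum>k<D. r t j * ?w t j k) = 1"
      using ovl_sum_right[OF specD(1)[OF R[OF t]] specD(1)[OF S[OF t]]] r1[OF t]
      by (simp add: sum_distrib_left[symmetric])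
  qed
  also have "\<dots> = (\<Sum>t<n. - vn_entropy (rho t) - (\<Sum>k<D. Re (qf {..<D} (?R t) (v t k)) * log 2 (s t k)))"
  proof (intro sum.cong refl)
    fix t assume "t \<in> {..<n}"
    then have t: "t < n" by simp
    have "rho t \<in> carrier_mat D D" using rho[OF t] psd_carrier by (auto simp: density_def)
    then have "vn_entropy (rho t) = (\<Sum>j<D. eta (r t j))" by (rule vn_entropy_density[OF _ R[OF t]])
    then show "relent {..<D} {..<D} (r t) (s t) (?w t)
      = - vn_entropy (rho t) - (\<Sum>k<D. Re (qf {..<D} (?R t) (v t k)) * log 2 (s t k))"
      using relent_expand[OF R[OF t] specD(1)[OF S[OF t]], of "s t"] r0[OF t] by simp
  qed
  finally show ?thesis .
qed

lemma tr2_sum_right: "(\<Sum>m\<in>X. tr2 I A (L m)) = tr2 I A (\<lambda>a b. \<Sum>m\<in>X. L m a b)"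
  unfolding tr2_def sum_distrib_left by (subst sum.swap) (rule sum.cong[OF refl], rule sum.swap)

lemma pos_sum:
  assumes "\<And>m. m \<in> X \<Longrightarrow> pos I (L m)"
  shows "pos I (\<lambda>a b. \<Sum>m\<in>X. L m a b)"
  unfolding pos_def
proof (intro conjI ballI allI)
  fix a b assume "a \<in> I" "b \<in> I"
  then show "cnj (\<Sum>m\<in>X. L m a b) = (\<Sum>m\<in>X. L m b a)"
    using assms by (auto simp: pos_def intro!: sum.cong)
next
  fix x
  have "qf I (\<lambda>a b. \<Sum>m\<in>X. L m a b) x = (\<Sum>a\<in>I. \<Sum>b\<in>I. \<Sum>m\<in>X. cnj (x a) * L m a b * x b)"
    unfolding qf_expand by (simp add: sum_distrib_left sum_distrib_right)
  also have "\<dots> = (\<Sum>a\<in>I. \<Sum>m\<in>X. \<Sum>b\<in>I. cnj (x a) * L m a b * x b)"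
    by (rule sum.cong[OF refl], rule sum.swap)
  also have "\<dots> = (\<Sum>m\<in>X. qf I (L m) x)" unfolding qf_expand by (rule sum.swap)
  finally show "0 \<le> Re (qf I (\<lambda>a b. \<Sum>m\<in>X. L m a b) x)"
    using assms by (simp add: pos_def sum_nonneg)
qed

text \<open>The reference state is the product of the time-wise averages and not the average of the
  product states, so that the bound is single-letter without subadditivity of the entropy.\<close>

lemma product_converse:
  fixes n D :: nat and rho :: "'m \<Rightarrow> nat \<Rightarrow> complex mat"
  assumes e: "bij_betw e I (PiE {..<n} (\<lambda>_. {..<D}))"
    and X: "finite X" "X \<noteq> {}"
    and rho: "\<And>m t. m \<in> X \<Longrightarrow> t < n \<Longrightarrow> density D (rho m t)"
    and L: "\<And>m. m \<in> X \<Longrightarrow> pos I (L m)"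
    and L1: "\<And>a b. a \<in> I \<Longrightarrow> b \<in> I \<Longrightarrow> (\<Sum>m\<in>X. L m a b) = idm a b"
    and g: "0 < g" "g \<le> 1"
  shows "(1 - 2 * (1 - (\<Sum>m\<in>X. Re (tr2 I (\<lambda>a b. \<Prod>t<n. rho m t $$ (e a t, e b t)) (L m))) / real (card X) + g))
       * log 2 (real (card X)) + log 2 g - 1 / ln 2
    \<le> (\<Sum>t<n. vn_entropy (mix D X (\<lambda>_. 1 / real (card X)) (\<lambda>m. rho m t))
          - (\<Sum>m\<in>X. vn_entropy (rho m t)) / real (card X))"
proof -
  let ?M = "real (card X)"
  have cX: "0 < card X" using X by (simp add: card_gt_0_iff)
  then have M: "1 \<le> ?M" "0 < ?M" by simp_all
  let ?sg = "\<lambda>t. mix D X (\<lambda>_. 1 / ?M) (\<lambda>m. rho m t)"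
  let ?R = "\<lambda>m t a b. rho m t $$ (a, b)"
  have dsg: "density D (?sg t)" if "t < n" for t
    by (rule density_mix) (use rho that M in auto)
  have "\<forall>t. \<exists>s v. t < n \<longrightarrow> spectral {..<D} {..<D} (\<lambda>a b. ?sg t $$ (a, b)) s v \<and> (\<forall>j<D. 0 \<le> s j) \<and> (\<Sum>j<D. s j) = 1"
    using density_spec[OF dsg] by blast
  then obtain s v where sv: "\<forall>t. t < n \<longrightarrow> spectral {..<D} {..<D} (\<lambda>a b. ?sg t $$ (a, b)) (s t) (v t) \<and> (\<forall>j<D. 0 \<le> s t j) \<and> (\<Sum>j<D. s t j) = 1"
    unfolding choice_iff by blast
  have S: "spectral {..<D} {..<D} (\<lambda>a b. ?sg t $$ (a, b)) (s t) (v t)" and s0: "j < D \<Longrightarrow> 0 \<le> s t j" and s1: "(\<Sum>j<D. s t j) = 1"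
    if "t < n" for t j using sv that by auto
  have qs: "(\<Sum>m\<in>X. Re (qf {..<D} (?R m t) (v t k))) / ?M = s t k" if "t < n" "k < D" for t k
  proof -
    have "s t k = Re (qf {..<D} (\<lambda>a b. ?sg t $$ (a, b)) (v t k))"
      using qf_eigenvector[OF S[OF that(1)], of k] that by simp
    then show ?thesis unfolding qf_mix by (simp add: sum_divide_distrib)
  qed
  have q0: "0 \<le> Re (qf {..<D} (?R m t) x)" if "m \<in> X" "t < n" for m t x
    using psd_pos[of D "rho m t"] rho[OF that] by (simp add: density_def pos_def)
  define S' where "S' = (\<lambda>a b. \<Prod>t<n. ?sg t $$ (e a t, e b t))"
  have fI: "finite I" using e bij_betw_finite finite_PiE[of "{..<n}" "\<lambda>_. {..<D}"] by blast
  \<comment> \<open>The complement of one effect is the sum of the others.\<close>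
  have L': "pos I (\<lambda>a b. idm a b - L m a b)" if m: "m \<in> X" for m
  proof -
    have "pos I (\<lambda>a b. \<Sum>m'\<in>X - {m}. L m' a b)" using L by (intro pos_sum) auto
    moreover have "idm a b - L m a b = (\<Sum>m'\<in>X - {m}. L m' a b)" if "a \<in> I" "b \<in> I" for a b
      using L1[OF that] X m by (simp add: sum_diff1)
    moreover have "qf I (\<lambda>a b. idm a b - L m a b) x = qf I (\<lambda>a b. \<Sum>m'\<in>X - {m}. L m' a b) x" for x
      unfolding qf_expand using calculation(2) by (intro sum.cong refl) simp
    ultimately show ?thesis unfolding pos_def by simp
  qed
  have one: "(1 - 2 * (1 - Re (tr2 I (\<lambda>a b. \<Prod>t<n. ?R m t (e a t) (e b t)) (L m)) + g * ?M * Re (tr2 I S' (L m)))) * log 2 ?M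
      + log 2 g - 1 / ln 2
    \<le> (\<Sum>t<n. - vn_entropy (rho m t) - (\<Sum>k<D. Re (qf {..<D} (?R m t) (v t k)) * log 2 (s t k)))"
    if m: "m \<in> X" for m
    unfolding S'_def
  proof (rule product_test_ge[OF e rho[OF m] S s0 s1 _ L[OF m] L'[OF m] M(1) g])
    fix t k assume t: "t < n" and k: "k < D" and z: "s t k = 0"
    \<comment> \<open>Every message state is dominated by a multiple of the average, so the kernel
      of the average is contained in its kernel.\<close>
    have "(\<Sum>m\<in>X. Re (qf {..<D} (?R m t) (v t k))) = 0" using qs[OF t k] z M by simp
    then have "\<forall>m\<in>X. Re (qf {..<D} (?R m t) (v t k)) = 0"
      using X q0 t by (subst (asm) sum_nonneg_eq_0_iff) auto
    then show "Re (qf {..<D} (?R m t) (v t k)) = 0" using m by blast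
  qed
  \<comment> \<open>Some message is always decoded: the probabilities under the reference state add
    up to its trace. After multiplication by \<open>g * ?M\<close> and averaging, exactly
    \<open>g\<close> remains.\<close>
  have trS: "(\<Sum>m\<in>X. Re (tr2 I S' (L m))) = 1"
  proof -
    have "(\<Sum>m\<in>X. tr2 I S' (L m)) = tr2 I S' idm"
      unfolding tr2_sum_right unfolding tr2_def using L1 by (intro sum.cong refl) simp
    also have "\<dots> = (\<Sum>a\<in>I. S' a a)"
      unfolding tr2_def idm_def using fI by (intro sum.cong refl) (simp add: if_distrib[of "\<lambda>c. _ * c"] cong: if_cong)
    also have "\<dots> = (\<Prod>t<n. \<Sum>b<D. ?sg t $$ (b, b))"
      unfolding S'_def by (rule sum_PiE_prod[OF e])
    also have "\<dots> = 1"
    proof (rule prod.neutral, intro ballI)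
      fix t assume "t \<in> {..<n}"
      then have "mtrace (?sg t) = 1" using dsg by (simp add: density_def)
      then show "(\<Sum>b<D. ?sg t $$ (b, b)) = 1" by (simp add: mtrace_def mix_def)
    qed
    finally show ?thesis by (metis Re_sum one_complex.sel(1))
  qed
  let ?T = "\<lambda>m. Re (tr2 I (\<lambda>a b. \<Prod>t<n. ?R m t (e a t) (e b t)) (L m))"
  have "(\<Sum>m\<in>X. (1 - 2 * (1 - ?T m + g * ?M * Re (tr2 I S' (L m)))) * log 2 ?M + log 2 g - 1 / ln 2)
    \<le> (\<Sum>m\<in>X. \<Sum>t<n. - vn_entropy (rho m t) - (\<Sum>k<D. Re (qf {..<D} (?R m t) (v t k)) * log 2 (s t k)))"
    by (rule sum_mono) (rule one)
  also have "\<dots> = (\<Sum>t<n. \<Sum>m\<in>X. - vn_entropy (rho m t) - (\<Sum>k<D. Re (qf {..<D} (?R m t) (v t k)) * log 2 (s t k)))"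
    by (rule sum.swap)
  also have "\<dots> = (\<Sum>t<n. ?M * (vn_entropy (?sg t) - (\<Sum>m\<in>X. vn_entropy (rho m t)) / ?M))"
  proof (intro sum.cong refl)
    fix t assume "t \<in> {..<n}"
    then have t: "t < n" by simp
    \<comment> \<open>By linearity the cross terms average to that of \<open>?sg t\<close> with
      itself, which is its entropy. Relative entropies thus turn into an entropy difference.\<close>
    have "(\<Sum>m\<in>X. \<Sum>k<D. Re (qf {..<D} (?R m t) (v t k)) * log 2 (s t k))
      = (\<Sum>k<D. (\<Sum>m\<in>X. Re (qf {..<D} (?R m t) (v t k))) * log 2 (s t k))"
      by (subst sum.swap) (simp only: sum_distrib_right)
    also have "\<dots> = (\<Sum>k<D. - (?M * eta (s t k)))"
    proof (intro sum.cong refl)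
      fix k assume "k \<in> {..<D}"
      then have "(\<Sum>m\<in>X. Re (qf {..<D} (?R m t) (v t k))) = ?M * s t k" using qs[OF t, of k] M by (simp add: field_simps)
      then show "(\<Sum>m\<in>X. Re (qf {..<D} (?R m t) (v t k))) * log 2 (s t k) = - (?M * eta (s t k))"
        using s0[OF t, of k] \<open>k \<in> {..<D}\<close> by (simp add: eta_nonneg)
    qed
    also have "\<dots> = - (?M * vn_entropy (?sg t))"
      unfolding vn_entropy_density[OF mix_carrier S[OF t]] by (simp add: sum_negf sum_distrib_left)
    finally show "(\<Sum>m\<in>X. - vn_entropy (rho m t) - (\<Sum>k<D. Re (qf {..<D} (?R m t) (v t k)) * log 2 (s t k)))
      = ?M * (vn_entropy (?sg t) - (\<Sum>m\<in>X. vn_entropy (rho m t)) / ?M)"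
      using M by (simp add: sum_subtractf sum_negf algebra_simps)
  qed
  also have "\<dots> = ?M * (\<Sum>t<n. vn_entropy (?sg t) - (\<Sum>m\<in>X. vn_entropy (rho m t)) / ?M)"
    by (simp only: sum_distrib_left)
  finally have fin: "(\<Sum>m\<in>X. (1 - 2 * (1 - ?T m + g * ?M * Re (tr2 I S' (L m)))) * log 2 ?M + log 2 g - 1 / ln 2)
    \<le> ?M * (\<Sum>t<n. vn_entropy (?sg t) - (\<Sum>m\<in>X. vn_entropy (rho m t)) / ?M)" .
  have "(\<Sum>m\<in>X. (1 - 2 * (1 - ?T m + g * ?M * Re (tr2 I S' (L m)))) * log 2 ?M + log 2 g - 1 / ln 2)
    = (\<Sum>m\<in>X. (log 2 g - 1 / ln 2 - log 2 ?M) + 2 * log 2 ?M * ?T m - 2 * log 2 ?M * g * ?M * Re (tr2 I S' (L m)))"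
    by (intro sum.cong refl) (simp add: algebra_simps)
  also have "\<dots> = ?M * (log 2 g - 1 / ln 2 - log 2 ?M) + 2 * log 2 ?M * (\<Sum>m\<in>X. ?T m) - 2 * log 2 ?M * g * ?M * 1"
    unfolding trS[symmetric] by (simp add: sum.distrib sum_subtractf sum_distrib_left)
  also have "\<dots> = ?M * ((1 - 2 * (1 - (\<Sum>m\<in>X. ?T m) / ?M + g)) * log 2 ?M + log 2 g - 1 / ln 2)"
    using M by (simp add: field_simps)
  finally have "?M * ((1 - 2 * (1 - (\<Sum>m\<in>X. ?T m) / ?M + g)) * log 2 ?M + log 2 g - 1 / ln 2)
    \<le> ?M * (\<Sum>t<n. vn_entropy (?sg t) - (\<Sum>m\<in>X. vn_entropy (rho m t)) / ?M)" using fin by simp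
  then show ?thesis using M by (simp only: mult_le_cancel_left_pos)
qed

section \<open>Tensor products of effects and reduced states\<close>

lemma mult_add_less:
  fixes i j A B :: nat
  assumes "i < A" "j < B" shows "i * B + j < A * B"
proof -
  have "i * B + j < (i + 1) * B" using assms by simp
  also have "\<dots> \<le> A * B" using assms by (intro mult_le_mono1) simp
  finally show ?thesis .
qed

lemma sum_lessThan_mult:
  fixes A B :: nat
  shows "(\<Sum>i<A * B. f i) = (\<Sum>a<A. \<Sum>b<B. f (a * B + b))"
proof -
  have "(\<Sum>a<A. \<Sum>b<B. f (a * B + b)) = (\<Sum>p\<in>{..<A} \<times> {..<B}. f (fst p * B + snd p))"
    by (simp add: sum.cartesian_product case_prod_beta)
  also have "\<dots> = (\<Sum>i<A * B. f i)"
    by (rule sum.reindex_bij_witness[of _ "\<lambda>i. (i div B, i mod B)" "\<lambda>p. fst p * B + snd p"])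
      (auto simp: mult_add_less less_mult_imp_div_less intro!: mod_less_divisor intro: gr0I)
  finally show ?thesis by simp
qed

text \<open>The one source of positivity for tensor products and for reduced states: the
  eigenvectors of the given operators supply the rank-one terms.\<close>

lemma pos_sum_rank_one:
  assumes A: "\<And>a b. a \<in> I \<Longrightarrow> b \<in> I \<Longrightarrow> A a b = (\<Sum>p\<in>P. of_real (c p) * (z p a * cnj (z p b)))"
    and c: "\<And>p. p \<in> P \<Longrightarrow> 0 \<le> c p"
  shows "pos I A"
  unfolding pos_def
proof (intro conjI ballI allI)
  fix a b assume "a \<in> I" "b \<in> I"
  then show "cnj (A a b) = A b a" by (simp add: A mult_ac)
next
  fix x
  have "qf I A x = (\<Sum>a\<in>I. \<Sum>b\<in>I. \<Sum>p\<in>P. of_real (c p) * ((cnj (x a) * z p a) * (cnj (z p b) * x b)))"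
    unfolding qf_expand by (intro sum.cong refl) (simp add: A sum_distrib_left sum_distrib_right mult_ac)
  also have "\<dots> = (\<Sum>a\<in>I. \<Sum>p\<in>P. \<Sum>b\<in>I. of_real (c p) * ((cnj (x a) * z p a) * (cnj (z p b) * x b)))"
    by (rule sum.cong[OF refl], rule sum.swap)
  also have "\<dots> = (\<Sum>p\<in>P. \<Sum>a\<in>I. \<Sum>b\<in>I. of_real (c p) * ((cnj (x a) * z p a) * (cnj (z p b) * x b)))"
    by (rule sum.swap)
  also have "\<dots> = (\<Sum>p\<in>P. of_real (c p) * (ip I x (z p) * cnj (ip I x (z p))))"
    unfolding ip_cnj unfolding ip_def sum_product by (simp only: sum_distrib_left)
  also have "\<dots> = of_real (\<Sum>p\<in>P. c p * (cmod (ip I x (z p)))\<^sup>2)"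
    unfolding of_real_sum of_real_mult complex_norm_square ..
  finally show "0 \<le> Re (qf I A x)" using c by (simp add: sum_nonneg)
qed

definition kronf :: "nat \<Rightarrow> complex mat \<Rightarrow> complex mat \<Rightarrow> nat \<Rightarrow> nat \<Rightarrow> complex" where
  "kronf B P Q = (\<lambda>i j. P $$ (i div B, j div B) * Q $$ (i mod B, j mod B))"

lemma pos_kronf:
  assumes P: "psd A P" and Q: "psd B Q"
  shows "pos {..<A * B} (kronf B P Q)"
proof -
  obtain l x where x: "spectral {..<A} {..<A} (\<lambda>a b. P $$ (a, b)) l x" and l: "\<forall>j<A. 0 \<le> l j"
    using psd_spec[OF P] by blast
  obtain m y where y: "spectral {..<B} {..<B} (\<lambda>a b. Q $$ (a, b)) m y" and m: "\<forall>j<B. 0 \<le> m j"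
    using psd_spec[OF Q] by blast
  show ?thesis
  proof (rule pos_sum_rank_one[where P = "{..<A} \<times> {..<B}" and c = "\<lambda>p. l (fst p) * m (snd p)"
        and z = "\<lambda>p i. x (fst p) (i div B) * y (snd p) (i mod B)"])
    fix i j assume "i \<in> {..<A * B}" "j \<in> {..<A * B}"
    then have "i div B < A" "j div B < A" "i mod B < B" "j mod B < B"
      by (auto simp: less_mult_imp_div_less intro!: mod_less_divisor) (metis mult_0_right not_less_zero gr0I)+
    then have "kronf B P Q i j = (\<Sum>a<A. of_real (l a) * (x a (i div B) * cnj (x a (j div B)))) *
       (\<Sum>b<B. of_real (m b) * (y b (i mod B) * cnj (y b (j mod B))))"
      unfolding kronf_def by (simp add: specD(4)[OF x] specD(4)[OF y])
    also have "\<dots> = (\<Sum>p\<in>{..<A} \<times> {..<B}. of_real (l (fst p) * m (snd p)) *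
       (x (fst p) (i div B) * y (snd p) (i mod B) * cnj (x (fst p) (j div B) * y (snd p) (j mod B))))"
      unfolding sum_product by (simp add: sum.cartesian_product case_prod_beta mult_ac)
    finally show "kronf B P Q i j = \<dots>" .
  qed (use l m in auto)
qed

lemma tr2_nonneg:
  assumes "spectral I J A r u" "\<And>j. j \<in> J \<Longrightarrow> 0 \<le> r j" "pos I B"
  shows "0 \<le> Re (tr2 I A B)"
  unfolding tr2_spec[OF assms(1)] using assms(2,3) by (simp add: sum_nonneg pos_def)

text \<open>The partial trace over \<open>B2\<close>, the less significant factor, and
  \<open>red2\<close> is the one over \<open>B1\<close>. They agree with \<open>ptrace\<close> on
  the time-sharing state through \<open>qtr_1\<close> and \<open>qtr_2\<close>.\<close>

definition red1 :: "nat \<Rightarrow> nat \<Rightarrow> complex mat \<Rightarrow> complex mat" where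
  "red1 d1 d2 R = mat d1 d1 (\<lambda>(a, b). \<Sum>c<d2. R $$ (a * d2 + c, b * d2 + c))"

definition red2 :: "nat \<Rightarrow> nat \<Rightarrow> complex mat \<Rightarrow> complex mat" where
  "red2 d1 d2 R = mat d2 d2 (\<lambda>(a, b). \<Sum>c<d1. R $$ (c * d2 + a, c * d2 + b))"

lemma density_red1:
  assumes R: "density (d1 * d2) R" shows "density d1 (red1 d1 d2 R)"
proof -
  obtain r u where s: "spectral {..<d1 * d2} {..<d1 * d2} (\<lambda>a b. R $$ (a, b)) r u" and r: "\<forall>j<d1 * d2. 0 \<le> r j"
    using density_spec[OF R] by blast
  have "pos {..<d1} (\<lambda>a b. red1 d1 d2 R $$ (a, b))"
  \<comment> \<open>The rank-one terms are the slices of the eigenvectors at a fixed index of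
    \<open>B2\<close>.\<close>
  proof (rule pos_sum_rank_one[where P = "{..<d2} \<times> {..<d1 * d2}" and c = "\<lambda>p. r (snd p)"
        and z = "\<lambda>p a. u (snd p) (a * d2 + fst p)"])
    fix a b assume "a \<in> {..<d1}" "b \<in> {..<d1}"
    then show "red1 d1 d2 R $$ (a, b) = (\<Sum>p\<in>{..<d2} \<times> {..<d1 * d2}. of_real (r (snd p)) *
        (u (snd p) (a * d2 + fst p) * cnj (u (snd p) (b * d2 + fst p))))"
      by (simp add: red1_def specD(4)[OF s] mult_add_less sum.cartesian_product case_prod_beta)
  qed (use r in auto)
  moreover have "mtrace (red1 d1 d2 R) = mtrace R"
    using R psd_carrier[of "d1 * d2" R] by (simp add: mtrace_def red1_def density_def sum_lessThan_mult)
  ultimately show ?thesis using R by (auto simp: density_def red1_def intro!: psdI)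
qed

lemma density_red2:
  assumes R: "density (d1 * d2) R" shows "density d2 (red2 d1 d2 R)"
proof -
  obtain r u where s: "spectral {..<d1 * d2} {..<d1 * d2} (\<lambda>a b. R $$ (a, b)) r u" and r: "\<forall>j<d1 * d2. 0 \<le> r j"
    using density_spec[OF R] by blast
  have "pos {..<d2} (\<lambda>a b. red2 d1 d2 R $$ (a, b))"
  proof (rule pos_sum_rank_one[where P = "{..<d1} \<times> {..<d1 * d2}" and c = "\<lambda>p. r (snd p)"
        and z = "\<lambda>p a. u (snd p) (fst p * d2 + a)"])
    fix a b assume "a \<in> {..<d2}" "b \<in> {..<d2}"
    then show "red2 d1 d2 R $$ (a, b) = (\<Sum>p\<in>{..<d1} \<times> {..<d1 * d2}. of_real (r (snd p)) *
        (u (snd p) (fst p * d2 + a) * cnj (u (snd p) (fst p * d2 + b))))"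
      by (simp add: red2_def specD(4)[OF s] mult_add_less sum.cartesian_product case_prod_beta)
  qed (use r in auto)
  moreover have "mtrace (red2 d1 d2 R) = mtrace R"
  proof -
    have "mtrace (red2 d1 d2 R) = (\<Sum>a<d2. \<Sum>c<d1. R $$ (c * d2 + a, c * d2 + a))"
      by (simp add: mtrace_def red2_def)
    also have "\<dots> = (\<Sum>c<d1. \<Sum>a<d2. R $$ (c * d2 + a, c * d2 + a))" by (rule sum.swap)
    finally show ?thesis
      using R psd_carrier[of "d1 * d2" R] by (simp add: mtrace_def density_def sum_lessThan_mult)
  qed
  ultimately show ?thesis using R by (auto simp: density_def red2_def intro!: psdI)
qed

section \<open>Digit sequences of output indices\<close>

lemma digit_replicate:
  assumes "t < n" shows "digit (replicate n d) a t = a div d ^ (n - Suc t) mod d"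
  using assms by (simp add: digit_def prod_list_replicate)

lemma digits_inj:
  fixes a b d :: nat
  assumes "\<And>k. k < n \<Longrightarrow> a div d ^ k mod d = b div d ^ k mod d" "a < d ^ n" "b < d ^ n"
  shows "a = b"
  using assms
proof (induction n arbitrary: a b)
  case (Suc n)
  have "a div d = b div d"
  proof (rule Suc.IH)
    fix k assume "k < n"
    then show "a div d div d ^ k mod d = b div d div d ^ k mod d"
      using Suc.prems(1)[of "Suc k"] by (simp add: div_mult2_eq)
  next
    show "a div d < d ^ n" "b div d < d ^ n"
      using Suc.prems(2,3) by (auto simp: less_mult_imp_div_less mult.commute)
  qed
  moreover have "a mod d = b mod d" using Suc.prems(1)[of 0] by simp
  ultimately show ?case by (metis div_mult_mod_eq)
qed simp

lemma digits_replicate_inj: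
  assumes "\<And>t. t < n \<Longrightarrow> digit (replicate n d) a t = digit (replicate n d) b t" "a < d ^ n" "b < d ^ n"
  shows "a = b"
proof (rule digits_inj[OF _ assms(2,3)])
  fix k assume k: "k < n"
  \<comment> \<open>Digits are numbered from the most significant one, powers of \<open>d\<close>
    from the least, hence the reversal.\<close>
  then have "n - Suc (n - Suc k) = k" "n - Suc k < n" by auto
  then show "a div d ^ k mod d = b div d ^ k mod d"
    using assms(1)[of "n - Suc k"] by (simp add: digit_replicate)
qed

lemma digit_less: "0 < d \<Longrightarrow> t < n \<Longrightarrow> digit (replicate n d) a t < d"
  by (simp add: digit_replicate)

text \<open>Counting replaces the construction of an inverse of the digit maps.\<close>

lemma bij_betw_PiE_inj:
  fixes D n :: nat
  assumes "inj_on e I" "e ` I \<subseteq> PiE {..<n} (\<lambda>_. {..<D})" "finite I" "card I = D ^ n"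
  shows "bij_betw e I (PiE {..<n} (\<lambda>_. {..<D}))"
proof -
  have "card (e ` I) = card (PiE {..<n} (\<lambda>_. {..<D}))"
    using assms(1,4) by (simp add: card_image card_PiE)
  then have "e ` I = PiE {..<n} (\<lambda>_. {..<D})"
    by (intro card_subset_eq assms(2) finite_PiE) auto
  then show ?thesis using assms(1) by (simp add: bij_betw_def)
qed

text \<open>The restriction places the digit sequence in the extensional space \<open>PiE\<close>,
  where sequences that agree below \<open>n\<close> are equal.\<close>

definition dig :: "nat \<Rightarrow> nat \<Rightarrow> nat \<Rightarrow> nat \<Rightarrow> nat" where
  "dig n d a = restrict (digit (replicate n d) a) {..<n}"

lemma bij_dig:
  assumes "0 < d"
  shows "bij_betw (dig n d) {..<d ^ n} (PiE {..<n} (\<lambda>_. {..<d}))"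
proof (rule bij_betw_PiE_inj)
  show "inj_on (dig n d) {..<d ^ n}"
  proof (rule inj_onI)
    fix a b assume ab: "a \<in> {..<d ^ n}" "b \<in> {..<d ^ n}" and eq: "dig n d a = dig n d b"
    have "digit (replicate n d) a t = digit (replicate n d) b t" if "t < n" for t
      using fun_cong[OF eq, of t] that by (simp add: dig_def)
    then show "a = b" using digits_replicate_inj ab by blast
  qed
qed (use assms in \<open>auto simp: dig_def digit_less split: if_splits\<close>)

text \<open>The joint letter of \<open>B1\<close> and \<open>B2\<close> at each time: the passage
  from B1^n B2^n to (B1 B2)^n that is built into \<open>out_state\<close>.\<close>

definition pdig :: "nat \<Rightarrow> nat \<Rightarrow> nat \<Rightarrow> nat \<Rightarrow> nat \<Rightarrow> nat" where
  "pdig n d1 d2 a = restrict (\<lambda>t. digit (replicate n d1) (a div d2 ^ n) t * d2 + digit (replicate n d2) (a mod d2 ^ n) t) {..<n}"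

lemma bij_pdig:
  assumes d: "0 < d1" "0 < d2"
  shows "bij_betw (pdig n d1 d2) {..<d1 ^ n * d2 ^ n} (PiE {..<n} (\<lambda>_. {..<d1 * d2}))"
proof (rule bij_betw_PiE_inj)
  show "inj_on (pdig n d1 d2) {..<d1 ^ n * d2 ^ n}"
  proof (rule inj_onI)
    fix a b assume ab: "a \<in> {..<d1 ^ n * d2 ^ n}" "b \<in> {..<d1 ^ n * d2 ^ n}" and eq: "pdig n d1 d2 a = pdig n d1 d2 b"
    have e: "digit (replicate n d1) (a div d2 ^ n) t * d2 + digit (replicate n d2) (a mod d2 ^ n) t
       = digit (replicate n d1) (b div d2 ^ n) t * d2 + digit (replicate n d2) (b mod d2 ^ n) t" if "t < n" for t
      using fun_cong[OF eq, of t] that by (simp add: pdig_def)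
    have "digit (replicate n d1) (a div d2 ^ n) t = digit (replicate n d1) (b div d2 ^ n) t" if "t < n" for t
      using arg_cong[OF e[OF that], of "\<lambda>x. x div d2"] digit_less[OF d(2) that] d(2) by simp
    then have 1: "a div d2 ^ n = b div d2 ^ n"
      by (rule digits_replicate_inj) (use ab in \<open>auto simp: less_mult_imp_div_less\<close>)
    have "digit (replicate n d2) (a mod d2 ^ n) t = digit (replicate n d2) (b mod d2 ^ n) t" if "t < n" for t
      using arg_cong[OF e[OF that], of "\<lambda>x. x mod d2"] digit_less[OF d(2) that] d(2) by simp
    then have 2: "a mod d2 ^ n = b mod d2 ^ n"
      by (rule digits_replicate_inj) (use d in auto)
    show "a = b" using 1 2 by (metis div_mult_mod_eq)
  qed
qed (use d in \<open>auto simp: pdig_def digit_less mult_add_less power_mult_distrib split: if_splits\<close>)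

lemma out_state_index:
  assumes "a < d1 ^ n * d2 ^ n" "b < d1 ^ n * d2 ^ n"
  shows "out_state d1 d2 rho n u1 u2 $$ (a, b) = (\<Prod>t<n. rho (u1 t) (u2 t) $$ (pdig n d1 d2 a t, pdig n d1 d2 b t))"
  using assms by (simp add: out_state_def pdig_def)

lemma pdig_split:
  assumes "0 < d2" "b < d2 ^ n" "t < n"
  shows "pdig n d1 d2 (a * d2 ^ n + b) t = dig n d1 a t * d2 + dig n d2 b t"
  using assms by (simp add: pdig_def dig_def)

text \<open>An effect that acts trivially on the second factor sees only the partial trace over
  it.\<close>

lemma tr2_kronf_right:
  fixes A B :: nat
  shows "tr2 {..<A * B} F (\<lambda>i j. L (i div B) (j div B) * idm (i mod B) (j mod B))
   = tr2 {..<A} (\<lambda>a a'. \<Sum>b<B. F (a * B + b) (a' * B + b)) L"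
proof -
  have "tr2 {..<A * B} F (\<lambda>i j. L (i div B) (j div B) * idm (i mod B) (j mod B))
    = (\<Sum>a<A. \<Sum>b<B. \<Sum>a'<A. \<Sum>b'<B. if b = b' then F (a * B + b) (a' * B + b') * L a' a else 0)"
    unfolding tr2_def sum_lessThan_mult by (intro sum.cong refl) (auto simp: idm_def)
  also have "\<dots> = (\<Sum>a<A. \<Sum>b<B. \<Sum>a'<A. F (a * B + b) (a' * B + b) * L a' a)"
    by (intro sum.cong refl) simp
  also have "\<dots> = (\<Sum>a<A. \<Sum>a'<A. \<Sum>b<B. F (a * B + b) (a' * B + b) * L a' a)"
    by (rule sum.cong[OF refl], rule sum.swap)
  finally show ?thesis unfolding tr2_def sum_distrib_right .
qed

lemma tr2_kronf_left:
  fixes A B :: nat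
  shows "tr2 {..<A * B} F (\<lambda>i j. idm (i div B) (j div B) * L (i mod B) (j mod B))
   = tr2 {..<B} (\<lambda>b b'. \<Sum>a<A. F (a * B + b) (a * B + b')) L"
proof -
  have "tr2 {..<A * B} F (\<lambda>i j. idm (i div B) (j div B) * L (i mod B) (j mod B))
    = (\<Sum>a<A. \<Sum>b<B. \<Sum>a'<A. if a = a' then \<Sum>b'<B. F (a * B + b) (a' * B + b') * L b' b else 0)"
    unfolding tr2_def sum_lessThan_mult by (intro sum.cong refl) (auto simp: idm_def intro!: sum.cong)
  also have "\<dots> = (\<Sum>a<A. \<Sum>b<B. \<Sum>b'<B. F (a * B + b) (a * B + b') * L b' b)"
    by (rule sum.cong[OF refl], rule sum.cong[OF refl]) simp
  also have "\<dots> = (\<Sum>b<B. \<Sum>a<A. \<Sum>b'<B. F (a * B + b) (a * B + b') * L b' b)"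
    by (rule sum.swap)
  also have "\<dots> = (\<Sum>b<B. \<Sum>b'<B. \<Sum>a<A. F (a * B + b) (a * B + b') * L b' b)"
    by (rule sum.cong[OF refl], rule sum.swap)
  finally show ?thesis unfolding tr2_def sum_distrib_right .
qed

lemma tr2_cong:
  assumes "\<And>a b. a \<in> I \<Longrightarrow> b \<in> I \<Longrightarrow> A a b = A' a b" "\<And>a b. a \<in> I \<Longrightarrow> b \<in> I \<Longrightarrow> B a b = B' a b"
  shows "tr2 I A B = tr2 I A' B'"
  unfolding tr2_def using assms by (intro sum.cong refl) simp

text \<open>Summing over the digit sequences of the traced block factors, so the partial trace acts
  letter by letter and the reduced output is again a product state.\<close>

lemma out_red1:
  assumes d: "0 < d1" "0 < d2" and a: "a < d1 ^ n" "a' < d1 ^ n"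
  shows "(\<Sum>b<d2 ^ n. out_state d1 d2 rho n u1 u2 $$ (a * d2 ^ n + b, a' * d2 ^ n + b))
    = (\<Prod>t<n. red1 d1 d2 (rho (u1 t) (u2 t)) $$ (dig n d1 a t, dig n d1 a' t))"
proof -
  have "(\<Sum>b<d2 ^ n. out_state d1 d2 rho n u1 u2 $$ (a * d2 ^ n + b, a' * d2 ^ n + b))
    = (\<Sum>b<d2 ^ n. \<Prod>t<n. rho (u1 t) (u2 t) $$ (dig n d1 a t * d2 + dig n d2 b t, dig n d1 a' t * d2 + dig n d2 b t))"
    using d a by (intro sum.cong refl) (simp add: out_state_index mult_add_less pdig_split)
  also have "\<dots> = (\<Prod>t<n. \<Sum>c<d2. rho (u1 t) (u2 t) $$ (dig n d1 a t * d2 + c, dig n d1 a' t * d2 + c))"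
    by (rule sum_PiE_prod[OF bij_dig[OF d(2)]])
  also have "\<dots> = (\<Prod>t<n. red1 d1 d2 (rho (u1 t) (u2 t)) $$ (dig n d1 a t, dig n d1 a' t))"
    using d by (intro prod.cong refl) (simp add: red1_def dig_def digit_less)
  finally show ?thesis .
qed

lemma out_red2:
  assumes d: "0 < d1" "0 < d2" and b: "b < d2 ^ n" "b' < d2 ^ n"
  shows "(\<Sum>a<d1 ^ n. out_state d1 d2 rho n u1 u2 $$ (a * d2 ^ n + b, a * d2 ^ n + b'))
    = (\<Prod>t<n. red2 d1 d2 (rho (u1 t) (u2 t)) $$ (dig n d2 b t, dig n d2 b' t))"
proof -
  have "(\<Sum>a<d1 ^ n. out_state d1 d2 rho n u1 u2 $$ (a * d2 ^ n + b, a * d2 ^ n + b'))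
    = (\<Sum>a<d1 ^ n. \<Prod>t<n. rho (u1 t) (u2 t) $$ (dig n d1 a t * d2 + dig n d2 b t, dig n d1 a t * d2 + dig n d2 b' t))"
    using d b by (intro sum.cong refl) (simp add: out_state_index mult_add_less pdig_split)
  also have "\<dots> = (\<Prod>t<n. \<Sum>c<d1. rho (u1 t) (u2 t) $$ (c * d2 + dig n d2 b t, c * d2 + dig n d2 b' t))"
    by (rule sum_PiE_prod[OF bij_dig[OF d(1)]])
  also have "\<dots> = (\<Prod>t<n. red2 d1 d2 (rho (u1 t) (u2 t)) $$ (dig n d2 b t, dig n d2 b' t))"
    using d by (intro prod.cong refl) (simp add: red2_def dig_def digit_less)
  finally show ?thesis .
qed

section \<open>Single-letter bounds for a code\<close>

text \<open>The Holevo quantity of the ensemble: the mutual information between a classical label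
  with law \<open>p\<close> and the state that it selects.\<close>

definition chi :: "nat \<Rightarrow> 'x set \<Rightarrow> ('x \<Rightarrow> real) \<Rightarrow> ('x \<Rightarrow> complex mat) \<Rightarrow> real" where
  "chi d X p R = vn_entropy (mix d X p R) - (\<Sum>x\<in>X. p x * vn_entropy (R x))"

text \<open>Integration against the image of \<open>p\<close> under \<open>c\<close>. The general
  algebra lets one statement serve the complex matrix entries and the real entropies.\<close>

lemma sum_push:
  fixes h :: "'y \<Rightarrow> 'b::real_normed_algebra_1"
  assumes X: "finite X" and Y: "finite Y" and c: "\<And>x. x \<in> X \<Longrightarrow> c x \<in> Y"
  shows "(\<Sum>x\<in>X. of_real (p x) * h (c x)) = (\<Sum>y\<in>Y. of_real (\<Sum>x\<in>{x\<in>X. c x = y}. p x) * h y)"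
proof -
  have "(\<Sum>x\<in>X. of_real (p x) * h (c x)) = (\<Sum>y\<in>Y. \<Sum>x\<in>{x\<in>X. c x = y}. of_real (p x) * h (c x))"
    by (rule sum.group[symmetric]) (use X Y c in auto)
  also have "\<dots> = (\<Sum>y\<in>Y. of_real (\<Sum>x\<in>{x\<in>X. c x = y}. p x) * h y)"
    by (intro sum.cong refl) (simp add: sum_distrib_right)
  finally show ?thesis .
qed

text \<open>Labels that select the same state may be merged. This replaces the uniform law on
  messages by a law on input letters.\<close>

lemma chi_push:
  assumes "finite X" "finite Y" "\<And>x. x \<in> X \<Longrightarrow> c x \<in> Y"
  shows "chi d X p (\<lambda>x. R (c x)) = chi d Y (\<lambda>y. \<Sum>x\<in>{x\<in>X. c x = y}. p x) R"
proof -
  have "mix d X p (\<lambda>x. R (c x)) = mix d Y (\<lambda>y. \<Sum>x\<in>{x\<in>X. c x = y}. p x) R"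
    unfolding mix_def
    by (rule arg_cong[where f = "mat d d"], rule ext, rule sum_push[where h = "\<lambda>y. R y $$ _"]) (use assms in auto)
  then show ?thesis
    using sum_push[where X = X and Y = Y and c = c and p = p and h = "\<lambda>y. vn_entropy (R y)"] assms
    unfolding chi_def by simp
qed

text \<open>The law of the input letter at time \<open>t\<close> when the message is
  uniform.\<close>

definition emp :: "nat \<Rightarrow> (nat \<Rightarrow> nat \<Rightarrow> nat) \<Rightarrow> nat \<Rightarrow> nat \<Rightarrow> real" where
  "emp M c t x = (\<Sum>m\<in>{m\<in>{..<M}. c m t = x}. 1 / real M)"

lemma sum_emp:
  assumes "\<And>m. m < M \<Longrightarrow> c m t < a"
  shows "(\<Sum>m<M. h (c m t)) / real M = (\<Sum>x<a. emp M c t x * (h x :: real))"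
  using sum_push[where X = "{..<M}" and Y = "{..<a}" and c = "\<lambda>m. c m t" and p = "\<lambda>_. 1 / real M" and h = h] assms
  by (simp add: emp_def sum_divide_distrib)

lemma is_distr_emp:
  assumes "\<And>m. m < M \<Longrightarrow> c m t < a" "0 < M"
  shows "is_distr a (emp M c t)"
  using sum_emp[of M c t a "\<lambda>_. 1", OF assms(1)] assms(2)
  by (auto simp: is_distr_def emp_def intro!: sum_nonneg)

text \<open>The conditional information \<open>I(X; B | Y)\<close> for independent \<open>X\<close>
  and \<open>Y\<close>. The instances below are \<open>I(X1; B1 | X2)\<close> and
  \<open>I(X2; B2 | X1)\<close>, and \<open>info3\<close> is \<open>I(X1 X2; B1 B2)\<close>, all at
  a fixed value of the time-sharing variable.\<close>

definition side_info :: "nat \<Rightarrow> nat \<Rightarrow> nat \<Rightarrow> (nat \<Rightarrow> nat \<Rightarrow> complex mat) \<Rightarrow> (nat \<Rightarrow> real) \<Rightarrow> (nat \<Rightarrow> real) \<Rightarrow> real" where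
  "side_info d a b R p r = (\<Sum>y<b. r y * chi d {..<a} p (\<lambda>x. R x y))"

definition info1 :: "nat \<Rightarrow> nat \<Rightarrow> nat \<Rightarrow> nat \<Rightarrow> (nat \<Rightarrow> nat \<Rightarrow> complex mat) \<Rightarrow> (nat \<Rightarrow> real) \<Rightarrow> (nat \<Rightarrow> real) \<Rightarrow> real" where
  "info1 a1 a2 d1 d2 rho p1 p2 = side_info d1 a1 a2 (\<lambda>x y. red1 d1 d2 (rho x y)) p1 p2"

definition info2 :: "nat \<Rightarrow> nat \<Rightarrow> nat \<Rightarrow> nat \<Rightarrow> (nat \<Rightarrow> nat \<Rightarrow> complex mat) \<Rightarrow> (nat \<Rightarrow> real) \<Rightarrow> (nat \<Rightarrow> real) \<Rightarrow> real" where
  "info2 a1 a2 d1 d2 rho p1 p2 = side_info d2 a2 a1 (\<lambda>y x. red2 d1 d2 (rho x y)) p2 p1"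

definition info3 :: "nat \<Rightarrow> nat \<Rightarrow> nat \<Rightarrow> nat \<Rightarrow> (nat \<Rightarrow> nat \<Rightarrow> complex mat) \<Rightarrow> (nat \<Rightarrow> real) \<Rightarrow> (nat \<Rightarrow> real) \<Rightarrow> real" where
  "info3 a1 a2 d1 d2 rho p1 p2 = chi (d1 * d2) ({..<a1} \<times> {..<a2}) (\<lambda>(x, y). p1 x * p2 y) (\<lambda>(x, y). rho x y)"

text \<open>The lower bound on the information delivered by \<open>product_converse\<close>. It is
  affine in \<open>eps\<close>, so it commutes with averaging over the message of the other
  sender.\<close>

definition gap :: "real \<Rightarrow> real \<Rightarrow> real \<Rightarrow> real" where
  "gap eps g M = (1 - 2 * (eps + g)) * log 2 M + log 2 g - 1 / ln 2"

lemma product_converse_chi: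
  fixes n D :: nat and rho :: "'m \<Rightarrow> nat \<Rightarrow> complex mat"
  assumes e: "bij_betw e I (PiE {..<n} (\<lambda>_. {..<D}))"
    and X: "finite X" "X \<noteq> {}"
    and rho: "\<And>m t. m \<in> X \<Longrightarrow> t < n \<Longrightarrow> density D (rho m t)"
    and L: "\<And>m. m \<in> X \<Longrightarrow> pos I (L m)"
    and L1: "\<And>a b. a \<in> I \<Longrightarrow> b \<in> I \<Longrightarrow> (\<Sum>m\<in>X. L m a b) = idm a b"
    and g: "0 < g" "g \<le> 1"
  shows "gap (1 - (\<Sum>m\<in>X. Re (tr2 I (\<lambda>a b. \<Prod>t<n. rho m t $$ (e a t, e b t)) (L m))) / real (card X)) g (real (card X))
    \<le> (\<Sum>t<n. chi D X (\<lambda>_. 1 / real (card X)) (\<lambda>m. rho m t))"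
  using product_converse[OF assms] unfolding gap_def chi_def by (simp add: sum_divide_distrib)

lemma gap_mono: "1 \<le> M \<Longrightarrow> eps \<le> eps' \<Longrightarrow> gap eps' g M \<le> gap eps g M"
  unfolding gap_def by (intro diff_right_mono add_right_mono mult_right_mono) auto

lemma gap_avg:
  assumes "0 < M"
  shows "(\<Sum>m<M. gap (e m) g x) / real M = gap ((\<Sum>m<M. e m) / real M) g x"
proof -
  have "(\<Sum>m<M. gap (e m) g x) = (\<Sum>m<M. ((1 - 2 * g) * log 2 x + log 2 g - 1 / ln 2) - 2 * log 2 x * e m)"
    unfolding gap_def by (intro sum.cong refl) (simp add: algebra_simps)
  also have "\<dots> = real M * ((1 - 2 * g) * log 2 x + log 2 g - 1 / ln 2) - 2 * log 2 x * (\<Sum>m<M. e m)"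
    by (simp add: sum_subtractf sum_distrib_left)
  finally show ?thesis using assms unfolding gap_def by (simp add: field_simps)
qed

section \<open>Error probabilities and output states of a code\<close>

lemma mtrace_error:
  assumes S: "S \<in> carrier_mat N N" "mtrace S = 1" and K: "K \<in> carrier_mat N N"
  shows "Re (mtrace ((1\<^sub>m N - K) * S)) = 1 - Re (tr2 {..<N} (\<lambda>a b. S $$ (a, b)) (\<lambda>a b. K $$ (a, b)))"
proof -
  have "mtrace ((1\<^sub>m N - K) * S) = (\<Sum>i<N. \<Sum>k<N. (if k = i then S $$ (i, i) else 0) - K $$ (i, k) * S $$ (k, i))"
    using S(1) K unfolding mtrace_def
    by (intro sum.cong) (auto simp: scalar_prod_def atLeast0LessThan algebra_simps intro!: sum.cong)
  also have "\<dots> = (\<Sum>i<N. S $$ (i, i)) - (\<Sum>i<N. \<Sum>k<N. K $$ (i, k) * S $$ (k, i))"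
    by (simp add: sum_subtractf)
  also have "(\<Sum>i<N. \<Sum>k<N. K $$ (i, k) * S $$ (k, i)) = tr2 {..<N} (\<lambda>a b. S $$ (a, b)) (\<lambda>a b. K $$ (a, b))"
    unfolding tr2_def by (subst sum.swap) (simp only: mult.commute)
  also have "(\<Sum>i<N. S $$ (i, i)) = 1" using S by (simp add: mtrace_def)
  finally show ?thesis by simp
qed

text \<open>Serves to show that joint outcome probabilities are nonnegative, which is needed when
  the outcome of one receiver is ignored.\<close>

lemma out_spec:
  assumes d: "0 < d1" "0 < d2" and R: "\<And>t. t < n \<Longrightarrow> density (d1 * d2) (rho (u1 t) (u2 t))"
  shows "\<exists>J r u. spectral {..<d1 ^ n * d2 ^ n} (J :: (nat \<Rightarrow> nat) set) (\<lambda>a b. out_state d1 d2 rho n u1 u2 $$ (a, b)) r u \<and> (\<forall>j\<in>J. 0 \<le> r j)"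
proof -
  have "\<forall>t. \<exists>r u. t < n \<longrightarrow> spectral {..<d1 * d2} {..<d1 * d2} (\<lambda>a b. rho (u1 t) (u2 t) $$ (a, b)) r u \<and> (\<forall>j<d1 * d2. 0 \<le> r j)"
    using density_spec[OF R] by blast
  then obtain r u where ru: "\<forall>t. t < n \<longrightarrow> spectral {..<d1 * d2} {..<d1 * d2} (\<lambda>a b. rho (u1 t) (u2 t) $$ (a, b)) (r t) (u t) \<and> (\<forall>j<d1 * d2. 0 \<le> r t j)"
    unfolding choice_iff by blast
  let ?P = "PiE {..<n} (\<lambda>_. {..<d1 * d2})"
  have "spectral {..<d1 ^ n * d2 ^ n} ?P (\<lambda>a b. \<Prod>t<n. rho (u1 t) (u2 t) $$ (pdig n d1 d2 a t, pdig n d1 d2 b t))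
    (\<lambda>j. \<Prod>t<n. r t (j t)) (\<lambda>j a. \<Prod>t<n. u t (j t) (pdig n d1 d2 a t))"
    by (rule spec_prod[OF bij_pdig[OF d]]) (use ru in auto)
  then have "spectral {..<d1 ^ n * d2 ^ n} ?P (\<lambda>a b. out_state d1 d2 rho n u1 u2 $$ (a, b))
    (\<lambda>j. \<Prod>t<n. r t (j t)) (\<lambda>j a. \<Prod>t<n. u t (j t) (pdig n d1 d2 a t))"
    unfolding spectral_def by (simp add: out_state_index)
  moreover have "\<forall>j\<in>?P. 0 \<le> (\<Prod>t<n. r t (j t))"
    using ru by (auto simp: PiE_iff intro!: prod_nonneg)
  ultimately show ?thesis by blast
qed

lemma mtrace_out:
  assumes d: "0 < d1" "0 < d2" and R: "\<And>t. t < n \<Longrightarrow> density (d1 * d2) (rho (u1 t) (u2 t))"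
  shows "mtrace (out_state d1 d2 rho n u1 u2) = 1"
proof -
  have "mtrace (out_state d1 d2 rho n u1 u2)
    = (\<Sum>a<d1 ^ n * d2 ^ n. \<Prod>t<n. rho (u1 t) (u2 t) $$ (pdig n d1 d2 a t, pdig n d1 d2 a t))"
  proof -
    have dr: "dim_row (out_state d1 d2 rho n u1 u2) = d1 ^ n * d2 ^ n" by (simp add: out_state_def)
    show ?thesis unfolding mtrace_def dr by (intro sum.cong refl) (simp add: out_state_index)
  qed
  also have "\<dots> = (\<Prod>t<n. \<Sum>b<d1 * d2. rho (u1 t) (u2 t) $$ (b, b))"
    by (rule sum_PiE_prod[OF bij_pdig[OF d]])
  also have "\<dots> = 1"
  proof (rule prod.neutral, intro ballI)
    fix t assume "t \<in> {..<n}"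
    then have "density (d1 * d2) (rho (u1 t) (u2 t))" using R by simp
    moreover from this have "rho (u1 t) (u2 t) \<in> carrier_mat (d1 * d2) (d1 * d2)"
      using psd_carrier unfolding density_def by blast
    ultimately show "(\<Sum>b<d1 * d2. rho (u1 t) (u2 t) $$ (b, b)) = 1"
      by (simp add: density_def mtrace_def)
  qed
  finally show ?thesis .
qed

lemma chi_cong:
  assumes "\<And>x. x \<in> X \<Longrightarrow> p x = p' x" "\<And>x. x \<in> X \<Longrightarrow> R x = R' x"
  shows "chi d X p R = chi d X p' R'"
proof -
  have "mix d X p R = mix d X p' R'" unfolding mix_def using assms
    by (intro arg_cong[where f = "mat d d"] ext sum.cong refl) simp
  then show ?thesis unfolding chi_def using assms by simp
qed

lemma kron_index:
  assumes "P \<in> carrier_mat A A" "Q \<in> carrier_mat B B" "i < A * B" "j < A * B"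
  shows "kron P Q $$ (i, j) = kronf B P Q i j"
  using assms by (simp add: kron_def kronf_def)

lemma sum_kronf_right:
  assumes "\<And>i j. i < B \<Longrightarrow> j < B \<Longrightarrow> (\<Sum>m<M. Q m $$ (i, j)) = 1\<^sub>m B $$ (i, j)" "i < A * B" "j < A * B"
  shows "(\<Sum>m<M. kronf B P (Q m) i j) = P $$ (i div B, j div B) * idm (i mod B) (j mod B)"
proof -
  have "0 < B" using assms(2) by (cases B) auto
  then show ?thesis using assms(1)[of "i mod B" "j mod B"]
    by (simp add: kronf_def sum_distrib_left[symmetric] idm_def)
qed

lemma sum_kronf_left:
  assumes "\<And>i j. i < A \<Longrightarrow> j < A \<Longrightarrow> (\<Sum>m<M. P m $$ (i, j)) = 1\<^sub>m A $$ (i, j)" "i < A * B" "j < A * B"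
  shows "(\<Sum>m<M. kronf B (P m) Q i j) = idm (i div B) (j div B) * Q $$ (i mod B, j mod B)"
  using assms(1)[of "i div B" "j div B"] assms(2,3)
  by (simp add: kronf_def sum_distrib_right[symmetric] idm_def less_mult_imp_div_less)

lemma msize_pos: "0 < msize n R"
  by (simp add: msize_def)

lemma kron_carrier:
  assumes "P \<in> carrier_mat A A" "Q \<in> carrier_mat B B"
  shows "kron P Q \<in> carrier_mat (A * B) (A * B)"
  by (rule carrier_matI) (use carrier_matD[OF assms(1)] carrier_matD[OF assms(2)] in \<open>simp_all add: kron_def\<close>)

text \<open>With the message \<open>m'\<close> of the other sender held fixed, what remains is a
  one-sender code whose outputs are product states. The converse applies for each \<open>m'\<close>,
  and averaging over \<open>m'\<close> replaces the letters of the other codeword by their law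
  \<open>emp M' c'\<close>.\<close>

lemma side_info_bound:
  assumes d: "0 < d" and M: "0 < M" "0 < M'"
    and R: "\<And>x y. x < a \<Longrightarrow> y < b \<Longrightarrow> density d (R x y)"
    and c: "\<forall>m<M. \<forall>t<n. c m t < a" and c': "\<forall>m<M'. \<forall>t<n. c' m t < b" and L: "povm (d ^ n) M L"
    and err: "1 - (\<Sum>m<M. \<Sum>m'<M'. Re (tr2 {..<d ^ n} (\<lambda>i j. \<Prod>t<n. R (c m t) (c' m' t) $$ (dig n d i t, dig n d j t))
      (\<lambda>i j. L m $$ (i, j)))) / (real M * real M') \<le> eps"
    and g: "0 < g" "g \<le> 1"
  shows "gap eps g (real M) \<le> (\<Sum>t<n. side_info d a b R (emp M c t) (emp M' c' t))"
proof -
  define T where "T = (\<lambda>m m'. Re (tr2 {..<d ^ n} (\<lambda>i j. \<Prod>t<n. R (c m t) (c' m' t) $$ (dig n d i t, dig n d j t)) (\<lambda>i j. L m $$ (i, j))))"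
  let ?h = "\<lambda>t y. chi d {..<a} (emp M c t) (\<lambda>x. R x y)"
  have "gap (1 - (\<Sum>m<M. T m m') / real M) g (real M) \<le> (\<Sum>t<n. ?h t (c' m' t))" if m': "m' < M'" for m'
  proof -
    have "gap (1 - (\<Sum>m\<in>{..<M}. T m m') / real (card {..<M})) g (real (card {..<M}))
      \<le> (\<Sum>t<n. chi d {..<M} (\<lambda>_. 1 / real (card {..<M})) (\<lambda>m. R (c m t) (c' m' t)))"
      unfolding T_def
    proof (rule product_converse_chi[OF bij_dig[OF d]])
      show "density d (R (c m t) (c' m' t))" if "m \<in> {..<M}" "t < n" for m t
        using R c c' that m' by auto
      show "pos {..<d ^ n} (\<lambda>i j. L m $$ (i, j))" if "m \<in> {..<M}" for m
        using psd_pos L that by (auto simp: povm_def)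
      show "(\<Sum>m\<in>{..<M}. L m $$ (i, j)) = idm i j" if "i \<in> {..<d ^ n}" "j \<in> {..<d ^ n}" for i j
        using L that by (simp add: povm_def idm_def)
    qed (use M g in \<open>auto simp: lessThan_empty_iff\<close>)
    also have "\<dots> = (\<Sum>t<n. ?h t (c' m' t))"
    proof (intro sum.cong refl)
      fix t assume "t \<in> {..<n}"
      then show "chi d {..<M} (\<lambda>_. 1 / real (card {..<M})) (\<lambda>m. R (c m t) (c' m' t)) = ?h t (c' m' t)"
        using chi_push[where X = "{..<M}" and Y = "{..<a}" and c = "\<lambda>m. c m t" and R = "\<lambda>x. R x (c' m' t)"
            and p = "\<lambda>_. 1 / real M" and d = d] c by (simp add: emp_def[abs_def])
    qed
    finally show ?thesis by simp
  qed
  then have "(\<Sum>m'<M'. gap (1 - (\<Sum>m<M. T m m') / real M) g (real M)) / real M' \<le> (\<Sum>m'<M'. \<Sum>t<n. ?h t (c' m' t)) / real M'"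
    by (intro divide_right_mono sum_mono) auto
  also have "\<dots> = (\<Sum>t<n. (\<Sum>m'<M'. ?h t (c' m' t)) / real M')"
    by (subst sum.swap) (simp only: sum_divide_distrib)
  also have "\<dots> = (\<Sum>t<n. side_info d a b R (emp M c t) (emp M' c' t))"
    unfolding side_info_def using c' by (intro sum.cong[OF refl] sum_emp) auto
  finally have "gap ((\<Sum>m'<M'. 1 - (\<Sum>m<M. T m m') / real M) / real M') g (real M)
    \<le> (\<Sum>t<n. side_info d a b R (emp M c t) (emp M' c' t))" unfolding gap_avg[OF M(2)] .
  moreover have "(\<Sum>m'<M'. 1 - (\<Sum>m<M. T m m') / real M) / real M' \<le> eps"
  proof -
    have "(\<Sum>m'<M'. 1 - (\<Sum>m<M. T m m') / real M) / real M' = 1 - (\<Sum>m'<M'. \<Sum>m<M. T m m') / (real M * real M')"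
      using M by (simp add: sum_subtractf diff_divide_distrib sum_divide_distrib[symmetric])
    also have "(\<Sum>m'<M'. \<Sum>m<M. T m m') = (\<Sum>m<M. \<Sum>m'<M'. T m m')" by (rule sum.swap)
    finally show ?thesis using err unfolding T_def by simp
  qed
  moreover have "1 \<le> real M" using M by simp
  ultimately show ?thesis using gap_mono by (meson order_trans)
qed

text \<open>The witnesses are the letter laws of the two codebooks. They are chosen before
  \<open>g\<close> and serve all three bounds. The two input letters at a given time are independent
  because the messages are.\<close>

lemma code_bound:
  assumes ch: "is_ccqq_channel a1 a2 d1 d2 rho" and code: "has_code a1 a2 d1 d2 rho n R1 R2 eps"
  defines "M1 \<equiv> msize n R1" and "M2 \<equiv> msize n R2"
  shows "\<exists>p1 p2. (\<forall>t<n. is_distr a1 (p1 t) \<and> is_distr a2 (p2 t)) \<and>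
    (\<forall>g. 0 < g \<and> g \<le> 1 \<longrightarrow>
      gap eps g (real M1) \<le> (\<Sum>t<n. info1 a1 a2 d1 d2 rho (p1 t) (p2 t)) \<and>
      gap eps g (real M2) \<le> (\<Sum>t<n. info2 a1 a2 d1 d2 rho (p1 t) (p2 t)) \<and>
      gap eps g (real (M1 * M2)) \<le> (\<Sum>t<n. info3 a1 a2 d1 d2 rho (p1 t) (p2 t)))"
proof -
  obtain c1 c2 :: "nat \<Rightarrow> nat \<Rightarrow> nat" and Lam Gam :: "nat \<Rightarrow> complex mat"
    where c1: "\<forall>m<M1. \<forall>t<n. c1 m t < a1" and c2: "\<forall>m<M2. \<forall>t<n. c2 m t < a2"
      and Lam: "povm (d1 ^ n) M1 Lam" and Gam: "povm (d2 ^ n) M2 Gam"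
      and err: "(1 / (real M1 * real M2)) * (\<Sum>m1<M1. \<Sum>m2<M2.
          Re (mtrace ((1\<^sub>m (d1 ^ n * d2 ^ n) - kron (Lam m1) (Gam m2)) *
                      out_state d1 d2 rho n (c1 m1) (c2 m2)))) \<le> eps"
    using code unfolding has_code_def Let_def M1_def[symmetric] M2_def[symmetric] by blast
  have d: "0 < d1" "0 < d2" and dens: "x < a1 \<Longrightarrow> y < a2 \<Longrightarrow> density (d1 * d2) (rho x y)" for x y
    using ch by (auto simp: is_ccqq_channel_def)
  have M: "0 < M1" "0 < M2" unfolding M1_def M2_def by (rule msize_pos)+
  let ?N = "d1 ^ n * d2 ^ n"
  let ?S = "\<lambda>m1 m2 a b. out_state d1 d2 rho n (c1 m1) (c2 m2) $$ (a, b)"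
  have psL: "psd (d1 ^ n) (Lam m)" if "m < M1" for m using Lam that by (simp add: povm_def)
  have psG: "psd (d2 ^ n) (Gam m)" if "m < M2" for m using Gam that by (simp add: povm_def)
  have sL: "(\<Sum>m<M1. Lam m $$ (i, j)) = 1\<^sub>m (d1 ^ n) $$ (i, j)" if "i < d1 ^ n" "j < d1 ^ n" for i j
    using Lam that unfolding povm_def by blast
  have sG: "(\<Sum>m<M2. Gam m $$ (i, j)) = 1\<^sub>m (d2 ^ n) $$ (i, j)" if "i < d2 ^ n" "j < d2 ^ n" for i j
    using Gam that unfolding povm_def by blast
  have dn: "density (d1 * d2) (rho (c1 m1 t) (c2 m2 t))" if "m1 < M1" "m2 < M2" "t < n" for m1 m2 t
    using dens c1 c2 that by blast
  define G where "G = (\<lambda>m1 m2. Re (tr2 {..<?N} (?S m1 m2) (kronf (d2 ^ n) (Lam m1) (Gam m2))))"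
  have G0: "0 \<le> Re (tr2 {..<?N} (?S m1 m2) (kronf (d2 ^ n) (Lam m1') (Gam m2')))"
    if m: "m1 < M1" "m2 < M2" "m1' < M1" "m2' < M2" for m1 m2 m1' m2'
  proof -
    obtain J :: "(nat \<Rightarrow> nat) set" and r u where "spectral {..<?N} J (?S m1 m2) r u" "\<forall>j\<in>J. 0 \<le> r j"
      using out_spec[of d1 d2 n rho "c1 m1" "c2 m2", OF d dn[OF m(1,2)]] by blast
    then show ?thesis using tr2_nonneg[OF _ _ pos_kronf[OF psL[OF m(3)] psG[OF m(4)]]] by blast
  qed
  have avgG: "1 - (\<Sum>m1<M1. \<Sum>m2<M2. G m1 m2) / (real M1 * real M2) \<le> eps"
  proof -
    have "Re (mtrace ((1\<^sub>m ?N - kron (Lam m1) (Gam m2)) * out_state d1 d2 rho n (c1 m1) (c2 m2))) = 1 - G m1 m2"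
      if "m1 < M1" "m2 < M2" for m1 m2
    proof -
      note cc = psd_carrier[OF psL[OF that(1)]] psd_carrier[OF psG[OF that(2)]]
      have K: "kron (Lam m1) (Gam m2) \<in> carrier_mat ?N ?N" by (rule kron_carrier[OF cc])
      have Oc: "out_state d1 d2 rho n (c1 m1) (c2 m2) \<in> carrier_mat ?N ?N" by (simp add: out_state_def)
      have tr: "mtrace (out_state d1 d2 rho n (c1 m1) (c2 m2)) = 1"
        by (rule mtrace_out[OF d]) (use dn that in auto)
      have "tr2 {..<?N} (?S m1 m2) (\<lambda>a b. kron (Lam m1) (Gam m2) $$ (a, b))
        = tr2 {..<?N} (?S m1 m2) (kronf (d2 ^ n) (Lam m1) (Gam m2))"
        by (rule tr2_cong) (use kron_index[OF cc] in auto)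
      then show ?thesis unfolding mtrace_error[OF Oc tr K] G_def by simp
    qed
    then have "(\<Sum>m1<M1. \<Sum>m2<M2. 1 - G m1 m2) / (real M1 * real M2) \<le> eps" using err by simp
    moreover have "(\<Sum>m1<M1. \<Sum>m2<M2. 1 - G m1 m2) = real M1 * real M2 - (\<Sum>m1<M1. \<Sum>m2<M2. G m1 m2)"
      by (simp add: sum_subtractf)
    ultimately show ?thesis using M by (simp add: diff_divide_distrib)
  qed
  define T1 where "T1 = (\<lambda>m1 m2. Re (tr2 {..<d1 ^ n} (\<lambda>a b. \<Prod>t<n. red1 d1 d2 (rho (c1 m1 t) (c2 m2 t)) $$ (dig n d1 a t, dig n d1 b t))
    (\<lambda>a b. Lam m1 $$ (a, b))))"
  define T2 where "T2 = (\<lambda>m1 m2. Re (tr2 {..<d2 ^ n} (\<lambda>a b. \<Prod>t<n. red2 d1 d2 (rho (c1 m1 t) (c2 m2 t)) $$ (dig n d2 a t, dig n d2 b t))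
    (\<lambda>a b. Gam m2 $$ (a, b))))"
  \<comment> \<open>If both receivers are right, then so is the first. Summing over all outcomes of
    the second receiver replaces its effect by the identity, and its system is traced out.\<close>
  have GT1: "G m1 m2 \<le> T1 m1 m2" if m: "m1 < M1" "m2 < M2" for m1 m2
  proof -
    have "G m1 m2 \<le> (\<Sum>m'<M2. Re (tr2 {..<?N} (?S m1 m2) (kronf (d2 ^ n) (Lam m1) (Gam m'))))"
      unfolding G_def
      by (rule member_le_sum[where f = "\<lambda>m'. Re (tr2 {..<?N} (?S m1 m2) (kronf (d2 ^ n) (Lam m1) (Gam m')))"])
        (use G0 m in auto)
    also have "\<dots> = Re (tr2 {..<?N} (?S m1 m2) (\<lambda>i j. \<Sum>m'<M2. kronf (d2 ^ n) (Lam m1) (Gam m') i j))"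
      unfolding tr2_sum_right[symmetric] by simp
    also have "tr2 {..<?N} (?S m1 m2) (\<lambda>i j. \<Sum>m'<M2. kronf (d2 ^ n) (Lam m1) (Gam m') i j)
      = tr2 {..<?N} (?S m1 m2) (\<lambda>i j. (\<lambda>a b. Lam m1 $$ (a, b)) (i div d2 ^ n) (j div d2 ^ n) * idm (i mod d2 ^ n) (j mod d2 ^ n))"
      by (rule tr2_cong[OF refl]) (use sum_kronf_right[OF sG, where A = "d1 ^ n"] in auto)
    also have "\<dots> = tr2 {..<d1 ^ n} (\<lambda>a a'. \<Sum>b<d2 ^ n. ?S m1 m2 (a * d2 ^ n + b) (a' * d2 ^ n + b)) (\<lambda>a b. Lam m1 $$ (a, b))"
      by (rule tr2_kronf_right)
    also have "Re \<dots> = T1 m1 m2"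
      unfolding T1_def by (rule arg_cong[where f = Re], rule tr2_cong[OF _ refl]) (use out_red1[OF d] in auto)
    finally show ?thesis .
  qed
  have GT2: "G m1 m2 \<le> T2 m1 m2" if m: "m1 < M1" "m2 < M2" for m1 m2
  proof -
    have "G m1 m2 \<le> (\<Sum>m'<M1. Re (tr2 {..<?N} (?S m1 m2) (kronf (d2 ^ n) (Lam m') (Gam m2))))"
      unfolding G_def
      by (rule member_le_sum[where f = "\<lambda>m'. Re (tr2 {..<?N} (?S m1 m2) (kronf (d2 ^ n) (Lam m') (Gam m2)))"])
        (use G0 m in auto)
    also have "\<dots> = Re (tr2 {..<?N} (?S m1 m2) (\<lambda>i j. \<Sum>m'<M1. kronf (d2 ^ n) (Lam m') (Gam m2) i j))"
      unfolding tr2_sum_right[symmetric] by simp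
    also have "tr2 {..<?N} (?S m1 m2) (\<lambda>i j. \<Sum>m'<M1. kronf (d2 ^ n) (Lam m') (Gam m2) i j)
      = tr2 {..<?N} (?S m1 m2) (\<lambda>i j. idm (i div d2 ^ n) (j div d2 ^ n) * (\<lambda>a b. Gam m2 $$ (a, b)) (i mod d2 ^ n) (j mod d2 ^ n))"
      by (rule tr2_cong[OF refl]) (use sum_kronf_left[OF sL, where B = "d2 ^ n"] in auto)
    also have "\<dots> = tr2 {..<d2 ^ n} (\<lambda>b b'. \<Sum>a<d1 ^ n. ?S m1 m2 (a * d2 ^ n + b) (a * d2 ^ n + b')) (\<lambda>a b. Gam m2 $$ (a, b))"
      by (rule tr2_kronf_left)
    also have "Re \<dots> = T2 m1 m2"
      unfolding T2_def by (rule arg_cong[where f = Re], rule tr2_cong[OF _ refl]) (use out_red2[OF d] in auto)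
    finally show ?thesis .
  qed
  let ?p1 = "emp M1 c1" and ?p2 = "emp M2 c2"
  have b1: "gap eps g (real M1) \<le> (\<Sum>t<n. info1 a1 a2 d1 d2 rho (?p1 t) (?p2 t))" if g: "0 < g" "g \<le> 1" for g
    unfolding info1_def
  proof (rule side_info_bound[OF d(1) M density_red1[OF dens] c1 c2 Lam _ g])
    have "1 - (\<Sum>m1<M1. \<Sum>m2<M2. T1 m1 m2) / (real M1 * real M2) \<le> 1 - (\<Sum>m1<M1. \<Sum>m2<M2. G m1 m2) / (real M1 * real M2)"
      using GT1 by (intro diff_left_mono divide_right_mono sum_mono) auto
    then show "1 - (\<Sum>m1<M1. \<Sum>m2<M2. Re (tr2 {..<d1 ^ n} (\<lambda>i j. \<Prod>t<n. red1 d1 d2 (rho (c1 m1 t) (c2 m2 t)) $$ (dig n d1 i t, dig n d1 j t))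
        (\<lambda>i j. Lam m1 $$ (i, j)))) / (real M1 * real M2) \<le> eps"
      using avgG unfolding T1_def by linarith
  qed
  have b2: "gap eps g (real M2) \<le> (\<Sum>t<n. info2 a1 a2 d1 d2 rho (?p1 t) (?p2 t))" if g: "0 < g" "g \<le> 1" for g
    unfolding info2_def
  proof (rule side_info_bound[OF d(2) M(2,1) density_red2[OF dens] c2 c1 Gam _ g])
    have "(\<Sum>m2<M2. \<Sum>m1<M1. T2 m1 m2) = (\<Sum>m1<M1. \<Sum>m2<M2. T2 m1 m2)" by (rule sum.swap)
    moreover have "1 - (\<Sum>m1<M1. \<Sum>m2<M2. T2 m1 m2) / (real M2 * real M1) \<le> 1 - (\<Sum>m1<M1. \<Sum>m2<M2. G m1 m2) / (real M2 * real M1)"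
      using GT2 by (intro diff_left_mono divide_right_mono sum_mono) auto
    ultimately show "1 - (\<Sum>m2<M2. \<Sum>m1<M1. Re (tr2 {..<d2 ^ n} (\<lambda>i j. \<Prod>t<n. red2 d1 d2 (rho (c1 m1 t) (c2 m2 t)) $$ (dig n d2 i t, dig n d2 j t))
        (\<lambda>i j. Gam m2 $$ (i, j)))) / (real M2 * real M1) \<le> eps"
      using avgG unfolding T2_def by (simp add: mult.commute)
  qed
  \<comment> \<open>For the sum rate the two receivers count as one decoder of the message pair,
    with the tensor products as effects.\<close>
  have b3: "gap eps g (real (M1 * M2)) \<le> (\<Sum>t<n. info3 a1 a2 d1 d2 rho (?p1 t) (?p2 t))" if g: "0 < g" "g \<le> 1" for g
  proof -
    let ?X = "{..<M1} \<times> {..<M2}"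
    have "gap (1 - (\<Sum>m\<in>?X. Re (tr2 {..<?N} (\<lambda>a b. \<Prod>t<n. rho (c1 (fst m) t) (c2 (snd m) t) $$ (pdig n d1 d2 a t, pdig n d1 d2 b t))
          (kronf (d2 ^ n) (Lam (fst m)) (Gam (snd m))))) / real (card ?X)) g (real (card ?X))
      \<le> (\<Sum>t<n. chi (d1 * d2) ?X (\<lambda>_. 1 / real (card ?X)) (\<lambda>m. rho (c1 (fst m) t) (c2 (snd m) t)))"
    proof (rule product_converse_chi[OF bij_pdig[OF d]])
      show "pos {..<?N} (kronf (d2 ^ n) (Lam (fst m)) (Gam (snd m)))" if "m \<in> ?X" for m
        using pos_kronf psL psG that by auto
      show "(\<Sum>m\<in>?X. kronf (d2 ^ n) (Lam (fst m)) (Gam (snd m)) i j) = idm i j" if "i \<in> {..<?N}" "j \<in> {..<?N}" for i j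
      proof -
        have "(\<Sum>m\<in>?X. kronf (d2 ^ n) (Lam (fst m)) (Gam (snd m)) i j) = (\<Sum>m1<M1. \<Sum>m2<M2. kronf (d2 ^ n) (Lam m1) (Gam m2) i j)"
          by (simp add: sum.cartesian_product case_prod_beta)
        also have "\<dots> = (\<Sum>m1<M1. Lam m1 $$ (i div d2 ^ n, j div d2 ^ n)) * idm (i mod d2 ^ n) (j mod d2 ^ n)"
          unfolding sum_distrib_right using sum_kronf_right[OF sG, where A = "d1 ^ n" and i = i and j = j] that by (intro sum.cong refl) simp
        also have "\<dots> = idm (i div d2 ^ n) (j div d2 ^ n) * idm (i mod d2 ^ n) (j mod d2 ^ n)"
          using sL that by (simp add: less_mult_imp_div_less idm_def)
        also have "\<dots> = idm i j"
        proof -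
          have "i = j \<longleftrightarrow> i div d2 ^ n = j div d2 ^ n \<and> i mod d2 ^ n = j mod d2 ^ n"
            by (metis div_mult_mod_eq)
          then show ?thesis unfolding idm_def by simp
        qed
        finally show ?thesis .
      qed
    qed (use M g dn in auto)
    also have "(\<Sum>m\<in>?X. Re (tr2 {..<?N} (\<lambda>a b. \<Prod>t<n. rho (c1 (fst m) t) (c2 (snd m) t) $$ (pdig n d1 d2 a t, pdig n d1 d2 b t))
          (kronf (d2 ^ n) (Lam (fst m)) (Gam (snd m))))) = (\<Sum>m1<M1. \<Sum>m2<M2. G m1 m2)"
    proof -
      have "Re (tr2 {..<?N} (\<lambda>a b. \<Prod>t<n. rho (c1 m1 t) (c2 m2 t) $$ (pdig n d1 d2 a t, pdig n d1 d2 b t))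
          (kronf (d2 ^ n) (Lam m1) (Gam m2))) = G m1 m2" for m1 m2
        unfolding G_def by (rule arg_cong[where f = Re], rule tr2_cong[OF _ refl]) (simp add: out_state_index)
      then show ?thesis by (simp add: sum.cartesian_product case_prod_beta)
    qed
    also have "(\<Sum>t<n. chi (d1 * d2) ?X (\<lambda>_. 1 / real (card ?X)) (\<lambda>m. rho (c1 (fst m) t) (c2 (snd m) t)))
      = (\<Sum>t<n. info3 a1 a2 d1 d2 rho (?p1 t) (?p2 t))"
    proof (intro sum.cong refl)
      fix t assume t: "t \<in> {..<n}"
      let ?c = "\<lambda>m. (c1 (fst m) t, c2 (snd m) t)"
      have "chi (d1 * d2) ?X (\<lambda>_. 1 / real (card ?X)) (\<lambda>m. (\<lambda>(x, y). rho x y) (?c m))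
        = chi (d1 * d2) ({..<a1} \<times> {..<a2}) (\<lambda>y. \<Sum>x\<in>{x\<in>?X. ?c x = y}. 1 / real (card ?X)) (\<lambda>(x, y). rho x y)"
        by (rule chi_push) (use c1 c2 t in auto)
      also have "\<dots> = info3 a1 a2 d1 d2 rho (?p1 t) (?p2 t)"
        unfolding info3_def
      proof (rule chi_cong)
        fix z assume "z \<in> {..<a1} \<times> {..<a2}"
        obtain x y where z: "z = (x, y)" by (cases z)
        \<comment> \<open>The uniform law on message pairs has as its image the product of the two
          letter laws.\<close>
        have "{m\<in>?X. ?c m = z} = {m\<in>{..<M1}. c1 m t = x} \<times> {m\<in>{..<M2}. c2 m t = y}" unfolding z by auto
        then show "(\<Sum>x\<in>{x\<in>?X. ?c x = z}. 1 / real (card ?X)) = (case z of (x, y) \<Rightarrow> ?p1 t x * ?p2 t y)"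
          by (simp add: z emp_def card_cartesian_product)
      qed simp
      finally show "chi (d1 * d2) ?X (\<lambda>_. 1 / real (card ?X)) (\<lambda>m. rho (c1 (fst m) t) (c2 (snd m) t))
        = info3 a1 a2 d1 d2 rho (?p1 t) (?p2 t)" by simp
    qed
    finally have "gap (1 - (\<Sum>m1<M1. \<Sum>m2<M2. G m1 m2) / (real M1 * real M2)) g (real (M1 * M2))
      \<le> (\<Sum>t<n. info3 a1 a2 d1 d2 rho (?p1 t) (?p2 t))" by (simp add: card_cartesian_product)
    moreover have "1 \<le> real (M1 * M2)" using M by (simp add: Suc_le_eq del: of_nat_mult)
    ultimately show ?thesis using gap_mono avgG by (meson order_trans)
  qed
  have "\<forall>t<n. is_distr a1 (?p1 t) \<and> is_distr a2 (?p2 t)"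
    using c1 c2 M by (auto intro!: is_distr_emp)
  then show ?thesis using b1 b2 b3 by blast
qed

section \<open>Entropies of the time-sharing state\<close>

lemma kron_index_split:
  assumes "P \<in> carrier_mat A A" "Q \<in> carrier_mat B B" "a < A" "a' < A" "b < B" "b' < B"
  shows "kron P Q $$ (a * B + b, a' * B + b') = P $$ (a, a') * Q $$ (b, b')"
  using assms by (simp add: kron_def mult_add_less)

lemma ketbra_carrier [simp]: "ketbra d x \<in> carrier_mat d d"
  by (simp add: ketbra_def)

text \<open>The chain rule for a classical-quantum state. The eigenvalues are the products of a
  block weight and an eigenvalue of its conditional state, and \<open>eta\<close> of a product
  splits.\<close>

lemma vn_entropy_block:
  assumes e: "bij_betw e (C \<times> {..<d}) {..<N}" and C: "finite C" and M: "M \<in> carrier_mat N N"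
    and eq: "\<And>c c' b b'. c \<in> C \<Longrightarrow> c' \<in> C \<Longrightarrow> b < d \<Longrightarrow> b' < d \<Longrightarrow>
      M $$ (e (c, b), e (c', b')) = (if c = c' then of_real (W c) * T c $$ (b, b') else 0)"
    and T: "\<And>c. c \<in> C \<Longrightarrow> density d (T c)" and W: "\<And>c. c \<in> C \<Longrightarrow> 0 \<le> W c"
  shows "vn_entropy M = (\<Sum>c\<in>C. eta (W c) + W c * vn_entropy (T c))"
proof -
  have "\<forall>c. \<exists>r u. c \<in> C \<longrightarrow> spectral {..<d} {..<d} (\<lambda>a b. T c $$ (a, b)) r u \<and> (\<forall>j<d. 0 \<le> r j) \<and> (\<Sum>j<d. r j) = 1"
    using density_spec[OF T] by blast
  then obtain r u where ru: "\<forall>c. c \<in> C \<longrightarrow> spectral {..<d} {..<d} (\<lambda>a b. T c $$ (a, b)) (r c) (u c) \<and> (\<forall>j<d. 0 \<le> r c j) \<and> (\<Sum>j<d. r c j) = 1"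
    unfolding choice_iff by blast
  have S: "spectral {..<d} {..<d} (\<lambda>a b. T c $$ (a, b)) (r c) (u c)" and r0: "j < d \<Longrightarrow> 0 \<le> r c j" and r1: "(\<Sum>j<d. r c j) = 1"
    if "c \<in> C" for c j using ru that by auto
  let ?I = "C \<times> {..<d}"
  define lam where "lam = (\<lambda>p. W (fst p) * r (fst p) (snd p))"
  define v where "v = (\<lambda>p q. if fst p = fst q then u (fst p) (snd p) (snd q) else 0)"
  have sumC: "(\<Sum>p\<in>?I. f p) = (\<Sum>c\<in>C. \<Sum>b<d. f (c, b))" for f :: "_ \<Rightarrow> complex"
    by (simp add: sum.cartesian_product)
  have "onb ?I ?I v"
    unfolding onb_def
  proof (intro conjI ballI)
    show "finite ?I" "finite ?I" using C by auto
    fix p q assume pq: "p \<in> ?I" "q \<in> ?I"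
    obtain c j c' j' where p: "p = (c, j)" and q: "q = (c', j')" by (cases p, cases q)
    have mem: "c \<in> C" "c' \<in> C" "j \<in> {..<d}" "j' \<in> {..<d}" using pq p q by auto
    have "(\<Sum>a\<in>?I. cnj (v p a) * v q a) = (\<Sum>x\<in>C. if x = c then (if c = c' then \<Sum>b<d. cnj (u c j b) * u c' j' b else 0) else 0)"
      unfolding sumC by (intro sum.cong refl) (auto simp: v_def p q)
    also have "\<dots> = (if c = c' then \<Sum>b<d. cnj (u c j b) * u c' j' b else 0)" using mem C by simp
    also have "\<dots> = (if p = q then 1 else 0)"
      using onbD(3)[OF specD(1)[OF S[OF mem(1)]] mem(3,4)] by (auto simp: p q)
    finally show "(\<Sum>a\<in>?I. cnj (v p a) * v q a) = (if p = q then 1 else 0)" .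
    have "(\<Sum>a\<in>?I. v a p * cnj (v a q)) = (\<Sum>x\<in>C. if x = c then (if c = c' then \<Sum>b<d. u c b j * cnj (u c b j') else 0) else 0)"
      unfolding sumC by (intro sum.cong refl) (auto simp: v_def p q)
    also have "\<dots> = (if c = c' then \<Sum>b<d. u c b j * cnj (u c b j') else 0)" using mem C by simp
    also have "\<dots> = (if p = q then 1 else 0)"
      using onbD(4)[OF specD(1)[OF S[OF mem(1)]] mem(3,4)] by (auto simp: p q)
    finally show "(\<Sum>a\<in>?I. v a p * cnj (v a q)) = (if p = q then 1 else 0)" .
  qed
  moreover have "M $$ (e p, e q) = (\<Sum>a\<in>?I. of_real (lam a) * (v a p * cnj (v a q)))" if pq: "p \<in> ?I" "q \<in> ?I" for p q
  proof -
    obtain c j c' j' where p: "p = (c, j)" and q: "q = (c', j')" by (cases p, cases q)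
    have mem: "c \<in> C" "c' \<in> C" "j \<in> {..<d}" "j' \<in> {..<d}" using pq p q by auto
    have "(\<Sum>a\<in>?I. of_real (lam a) * (v a p * cnj (v a q)))
      = (\<Sum>x\<in>C. if x = c then (if c = c' then \<Sum>b<d. of_real (W c) * (of_real (r c b) * (u c b j * cnj (u c b j'))) else 0) else 0)"
      unfolding sumC by (intro sum.cong refl) (auto simp: v_def p q lam_def mult_ac)
    also have "\<dots> = (if c = c' then of_real (W c) * T c $$ (j, j') else 0)"
      using mem C specD(4)[OF S[OF mem(1)] mem(3,4)] by (cases "c = c'") (simp_all add: sum_distrib_left[symmetric])
    finally show ?thesis using eq[of c c' j j'] mem by (simp add: p q)
  qed
  ultimately have "spectral ?I ?I (\<lambda>p q. M $$ (e p, e q)) lam v" by (simp add: spectral_def)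
  then have "vn_entropy M = (\<Sum>p\<in>?I. eta (lam p))" by (rule vn_entropy_spec[OF _ e M]) simp
  also have "\<dots> = (\<Sum>c\<in>C. \<Sum>j<d. r c j * eta (W c) + W c * eta (r c j))"
    unfolding sum.cartesian_product
  proof (intro sum.cong refl)
    fix p assume "p \<in> ?I"
    then have nn: "0 \<le> W (fst p)" "0 \<le> r (fst p) (snd p)" using W r0 by auto
    \<comment> \<open>A zero factor is treated separately: the logarithm of the product splits only
      for positive factors, while \<open>eta\<close> vanishes at zero.\<close>
    show "eta (lam p) = (case p of (c, j) \<Rightarrow> r c j * eta (W c) + W c * eta (r c j))"
      using nn by (cases "W (fst p) = 0 \<or> r (fst p) (snd p) = 0")
        (auto simp: lam_def eta_nonneg log_mult algebra_simps split: prod.split)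
  qed
  also have "\<dots> = (\<Sum>c\<in>C. eta (W c) + W c * vn_entropy (T c))"
  proof (intro sum.cong refl)
    fix c assume c: "c \<in> C"
    have "T c \<in> carrier_mat d d" using T[OF c] psd_carrier by (auto simp: density_def)
    then have "vn_entropy (T c) = (\<Sum>j<d. eta (r c j))" by (rule vn_entropy_density[OF _ S[OF c]])
    then show "(\<Sum>j<d. r c j * eta (W c) + W c * eta (r c j)) = eta (W c) + W c * vn_entropy (T c)"
      using r1[OF c] by (simp add: sum.distrib sum_distrib_left[symmetric] sum_distrib_right[symmetric])
  qed
  finally show ?thesis .
qed

text \<open>Covers the entropies in which no output system is kept: their quantum part is
  one-dimensional.\<close>

lemma vn_entropy_density_1:
  assumes "density 1 R" shows "vn_entropy R = 0"
proof -
  obtain r :: "nat \<Rightarrow> real" and u :: "nat \<Rightarrow> nat \<Rightarrow> complex" where s: "spectral {..<1} {..<1} (\<lambda>a b. R $$ (a, b)) r u" and "(\<Sum>j<1. r j) = (1::real)"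
    using density_spec[OF assms] by blast
  moreover have "R \<in> carrier_mat 1 1" using assms psd_carrier by (auto simp: density_def)
  ultimately show ?thesis using vn_entropy_density[OF _ s] by (simp add: eta_def)
qed

section \<open>Entries and partial traces of the time-sharing state\<close>

definition idx :: "nat \<Rightarrow> nat \<Rightarrow> nat \<Rightarrow> nat \<Rightarrow> nat \<Rightarrow> nat \<Rightarrow> nat \<Rightarrow> nat" where
  "idx a1 a2 D q x y z = q * (a1 * (a2 * D)) + (x * (a2 * D) + (y * D + z))"

lemma sum_delta3:
  fixes q k x a1 y a2 :: nat and S :: "'b::comm_monoid_add"
  assumes "q < k" "x < a1" "y < a2"
  shows "(\<Sum>q'<k. \<Sum>x'<a1. \<Sum>y'<a2. if q = q' \<and> x = x' \<and> y = y' then S else 0) = S"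
proof -
  have 1: "(\<Sum>y'<a2. if q = q' \<and> x = x' \<and> y = y' then S else 0) = (if q = q' \<and> x = x' then S else 0)" for q' x'
    using assms by (cases "q = q' \<and> x = x'") auto
  have 2: "(\<Sum>x'<a1. if q = q' \<and> x = x' then S else 0) = (if q = q' then S else 0)" for q'
    using assms by (cases "q = q'") auto
  show ?thesis using assms by (simp add: 1 2)
qed

text \<open>The factors \<open>ketbra\<close> make the state block diagonal in the classical
  systems, with a weighted output state in each block.\<close>

lemma theta_index:
  assumes rho: "\<And>x y. x < a1 \<Longrightarrow> y < a2 \<Longrightarrow> rho x y \<in> carrier_mat (d1 * d2) (d1 * d2)"
    and lt: "q < k" "x < a1" "y < a2" "z < d1 * d2" "q' < k" "x' < a1" "y' < a2" "z' < d1 * d2"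
  shows "theta a1 a2 d1 d2 rho k pQ p1 p2 $$ (idx a1 a2 (d1 * d2) q x y z, idx a1 a2 (d1 * d2) q' x' y' z')
    = (if q = q' \<and> x = x' \<and> y = y' then of_real (pQ q * p1 q x * p2 q y) * rho x y $$ (z, z') else 0)"
proof -
  let ?D = "d1 * d2"
  let ?i = "idx a1 a2 ?D q x y z" and ?j = "idx a1 a2 ?D q' x' y' z'"
  have b: "y * ?D + z < a2 * ?D" "y' * ?D + z' < a2 * ?D"
    "x * (a2 * ?D) + (y * ?D + z) < a1 * (a2 * ?D)" "x' * (a2 * ?D) + (y' * ?D + z') < a1 * (a2 * ?D)"
    using lt by (auto intro!: mult_add_less)
  have N: "?i < k * (a1 * (a2 * ?D))" "?j < k * (a1 * (a2 * ?D))"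
    unfolding idx_def using lt b by (auto intro!: mult_add_less)
  have kr: "kron (ketbra k q'') (kron (ketbra a1 x'') (kron (ketbra a2 y'') (rho x'' y''))) $$ (?i, ?j)
    = ketbra k q'' $$ (q, q') * (ketbra a1 x'' $$ (x, x') * (ketbra a2 y'' $$ (y, y') * rho x'' y'' $$ (z, z')))"
    if "x'' < a1" "y'' < a2" for q'' x'' y''
  proof -
    note c1 = kron_carrier[OF ketbra_carrier rho[OF that], of a2 y'']
    note c2 = kron_carrier[OF ketbra_carrier c1, of a1 x'']
    show ?thesis unfolding idx_def
      by (subst kron_index_split[OF ketbra_carrier c2 lt(1,5) b(3,4)],
          subst kron_index_split[OF ketbra_carrier c1 lt(2,6) b(1,2)],
          subst kron_index_split[OF ketbra_carrier rho[OF that] lt(3,7,4,8)]) (rule refl)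
  qed
  have "theta a1 a2 d1 d2 rho k pQ p1 p2 $$ (?i, ?j)
    = (\<Sum>q''<k. \<Sum>x''<a1. \<Sum>y''<a2. of_real (pQ q'' * p1 q'' x'' * p2 q'' y'') *
        (ketbra k q'' $$ (q, q') * (ketbra a1 x'' $$ (x, x') * (ketbra a2 y'' $$ (y, y') * rho x'' y'' $$ (z, z')))))"
    using N kr by (simp add: theta_def Let_def mult.assoc)
  also have "\<dots> = (\<Sum>q''<k. \<Sum>x''<a1. \<Sum>y''<a2. if q = q'' \<and> x = x'' \<and> y = y'' then
      (if q = q' \<and> x = x' \<and> y = y' then of_real (pQ q * p1 q x * p2 q y) * rho x y $$ (z, z') else 0) else 0)"
    using lt by (intro sum.cong refl) (auto simp: ketbra_def)
  also have "\<dots> = (if q = q' \<and> x = x' \<and> y = y' then of_real (pQ q * p1 q x * p2 q y) * rho x y $$ (z, z') else 0)"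
    by (rule sum_delta3[OF lt(1-3)])
  finally show ?thesis .
qed

lemma div_mod_split:
  fixes m B r :: nat
  assumes "r < B" shows "(m * B + r) div B = m" "(m * B + r) mod B = r"
  using assms by simp_all

lemma digit_idx:
  assumes lt: "q < k" "x < a1" "y < a2" "b < d1" "c < d2"
  defines "i \<equiv> idx a1 a2 (d1 * d2) q x y (b * d2 + c)"
  shows "digit [k, a1, a2, d1, d2] i 0 = q" "digit [k, a1, a2, d1, d2] i (Suc 0) = x"
    "digit [k, a1, a2, d1, d2] i 2 = y" "digit [k, a1, a2, d1, d2] i 3 = b" "digit [k, a1, a2, d1, d2] i 4 = c"
proof -
  have z: "b * d2 + c < d1 * d2" using lt by (intro mult_add_less)
  have y': "y * (d1 * d2) + (b * d2 + c) < a2 * (d1 * d2)" using lt z by (intro mult_add_less)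
  have x': "x * (a2 * (d1 * d2)) + (y * (d1 * d2) + (b * d2 + c)) < a1 * (a2 * (d1 * d2))"
    using lt y' by (intro mult_add_less)
  \<comment> \<open>The same index in three more bracketings, so that division by each suffix
    product of the dimensions drops exactly the digits behind it.\<close>
  have 1: "i = (q * a1 + x) * (a2 * (d1 * d2)) + (y * (d1 * d2) + (b * d2 + c))"
    and 2: "i = ((q * a1 + x) * a2 + y) * (d1 * d2) + (b * d2 + c)"
    and 3: "i = (((q * a1 + x) * a2 + y) * d1 + b) * d2 + c"
    by (simp_all add: i_def idx_def algebra_simps)
  have 0: "i div (a1 * (a2 * (d1 * d2))) = q" unfolding i_def idx_def by (rule div_mod_split(1)[OF x'])
  have "i div (a2 * (d1 * d2)) = q * a1 + x" unfolding 1 by (rule div_mod_split(1)[OF y'])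
  moreover have "i div (d1 * d2) = (q * a1 + x) * a2 + y" unfolding 2 by (rule div_mod_split(1)[OF z])
  moreover have "i div d2 = ((q * a1 + x) * a2 + y) * d1 + b" "i mod d2 = c"
    unfolding 3 by (rule div_mod_split[OF lt(5)])+
  ultimately show "digit [k, a1, a2, d1, d2] i 0 = q" "digit [k, a1, a2, d1, d2] i (Suc 0) = x"
    "digit [k, a1, a2, d1, d2] i 2 = y" "digit [k, a1, a2, d1, d2] i 3 = b" "digit [k, a1, a2, d1, d2] i 4 = c"
    using 0 lt by (simp_all add: digit_def div_mod_split numeral_eq_Suc del: div_mult_self3 div_mult_self1)
qed

lemma all_less_5: "(\<forall>j<5. P j) \<longleftrightarrow> P 0 \<and> P (Suc 0) \<and> P 2 \<and> P 3 \<and> P (4::nat)"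
  by (simp add: All_less_Suc numeral_eq_Suc) blast

lemma sum_idx:
  "(\<Sum>i<k * (a1 * (a2 * D)). f i) = (\<Sum>q<k. \<Sum>x<a1. \<Sum>y<a2. \<Sum>z<D. f (idx a1 a2 D q x y z))"
  unfolding idx_def by (simp only: sum_lessThan_mult)

text \<open>\<open>T\<close> is the partial trace of the output state \<open>R\<close>, and \<open>qu b c\<close> is the index of the basis
  vector \<open>(b, c)\<close> restricted to the kept output systems.\<close>

definition qtr :: "nat set \<Rightarrow> nat \<Rightarrow> nat \<Rightarrow> nat \<Rightarrow> (nat \<Rightarrow> nat \<Rightarrow> nat) \<Rightarrow> complex mat \<Rightarrow> complex mat \<Rightarrow> bool" where
  "qtr K d1 d2 dq qu R T \<longleftrightarrow> (\<forall>b<d1. \<forall>c<d2. qu b c < dq) \<and>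
    (\<forall>i<dq. \<forall>j<dq. (\<Sum>b<d1. \<Sum>c<d2. \<Sum>b'<d1. \<Sum>c'<d2. if qu b c = i \<and> qu b' c' = j \<and>
        (3 \<notin> K \<longrightarrow> b = b') \<and> (4 \<notin> K \<longrightarrow> c = c') then R $$ (b * d2 + c, b' * d2 + c') else 0) = T $$ (i, j))"

lemma if_conj_mult:
  "(if A \<and> B then w * r else 0) = (if A then w else 0) * (if B then r else (0 :: 'b::mult_zero))"
  by simp

text \<open>The kept index splits into a classical part \<open>cl\<close> and a quantum part
  \<open>qu\<close>, the latter less significant. By block diagonality row and column share all
  classical digits, so the condition of equal digits on the systems traced out is automatic there.
  It remains for the outputs only, and that part is recorded in \<open>qtr\<close>.\<close>

lemma ptrace_theta:
  assumes rho: "\<And>x y. x < a1 \<Longrightarrow> y < a2 \<Longrightarrow> rho x y \<in> carrier_mat (d1 * d2) (d1 * d2)"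
    and DK: "prod_list (map ((!) [k, a1, a2, d1, d2]) (kept [k, a1, a2, d1, d2] K)) = nc * dq"
    and kap: "\<And>q x y b c. q < k \<Longrightarrow> x < a1 \<Longrightarrow> y < a2 \<Longrightarrow> b < d1 \<Longrightarrow> c < d2 \<Longrightarrow>
      kept_index [k, a1, a2, d1, d2] K (idx a1 a2 (d1 * d2) q x y (b * d2 + c)) = cl q x y * dq + qu b c"
    and T: "\<And>x y. x < a1 \<Longrightarrow> y < a2 \<Longrightarrow> qtr K d1 d2 dq qu (rho x y) (T x y)"
    and IJ: "I < nc" "J < nc" "i < dq" "j < dq"
  shows "ptrace [k, a1, a2, d1, d2] K (theta a1 a2 d1 d2 rho k pQ p1 p2) $$ (I * dq + i, J * dq + j)
    = (\<Sum>q<k. \<Sum>x<a1. \<Sum>y<a2. if cl q x y = I \<and> cl q x y = J then of_real (pQ q * p1 q x * p2 q y) * T x y $$ (i, j) else 0)"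
proof -
  let ?ds = "[k, a1, a2, d1, d2]" and ?th = "theta a1 a2 d1 d2 rho k pQ p1 p2"
  let ?x = "idx a1 a2 (d1 * d2)"
  let ?w = "\<lambda>q x y. complex_of_real (pQ q * p1 q x * p2 q y)"
  let ?P = "\<lambda>a b. kept_index ?ds K a = I * dq + i \<and> kept_index ?ds K b = J * dq + j \<and>
           (\<forall>l<length ?ds. l \<notin> K \<longrightarrow> digit ?ds a l = digit ?ds b l)"
  have len: "length ?ds = 5" by simp
  have "ptrace ?ds K ?th $$ (I * dq + i, J * dq + j)
    = (\<Sum>a<k * (a1 * (a2 * (d1 * d2))). \<Sum>b<k * (a1 * (a2 * (d1 * d2))). if ?P a b then ?th $$ (a, b) else 0)"
    unfolding ptrace_def Let_def DK using IJ by (simp add: mult_add_less)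
  also have "\<dots> = (\<Sum>q<k. \<Sum>x<a1. \<Sum>y<a2. \<Sum>z<d1 * d2. \<Sum>q'<k. \<Sum>x'<a1. \<Sum>y'<a2. \<Sum>z'<d1 * d2.
      if ?P (?x q x y z) (?x q' x' y' z') then ?th $$ (?x q x y z, ?x q' x' y' z') else 0)"
    by (simp only: sum_idx)
  also have "\<dots> = (\<Sum>q<k. \<Sum>x<a1. \<Sum>y<a2. \<Sum>z<d1 * d2. \<Sum>z'<d1 * d2.
      if ?P (?x q x y z) (?x q x y z') then ?w q x y * rho x y $$ (z, z') else 0)"
  proof -
    have "(\<Sum>q'<k. \<Sum>x'<a1. \<Sum>y'<a2. \<Sum>z'<d1 * d2.
        if ?P (?x q x y z) (?x q' x' y' z') then ?th $$ (?x q x y z, ?x q' x' y' z') else 0)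
      = (\<Sum>z'<d1 * d2. if ?P (?x q x y z) (?x q x y z') then ?w q x y * rho x y $$ (z, z') else 0)"
      if lt: "q < k" "x < a1" "y < a2" "z < d1 * d2" for q x y z
    proof -
      have "(\<Sum>q'<k. \<Sum>x'<a1. \<Sum>y'<a2. \<Sum>z'<d1 * d2.
          if ?P (?x q x y z) (?x q' x' y' z') then ?th $$ (?x q x y z, ?x q' x' y' z') else 0)
        = (\<Sum>q'<k. \<Sum>x'<a1. \<Sum>y'<a2. \<Sum>z'<d1 * d2. if q = q' \<and> x = x' \<and> y = y' then
            (if ?P (?x q x y z) (?x q x y z') then ?w q x y * rho x y $$ (z, z') else 0) else 0)"
      proof (rule sum.cong[OF refl], rule sum.cong[OF refl], rule sum.cong[OF refl], rule sum.cong[OF refl])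
        fix q' x' y' z' assume "q' \<in> {..<k}" "x' \<in> {..<a1}" "y' \<in> {..<a2}" "z' \<in> {..<d1 * d2}"
        then have lt': "q' < k" "x' < a1" "y' < a2" "z' < d1 * d2" by simp_all
        have th: "?th $$ (?x q x y z, ?x q' x' y' z') = (if q = q' \<and> x = x' \<and> y = y' then ?w q x y * rho x y $$ (z, z') else 0)"
          by (rule theta_index[OF rho lt lt'])
        show "(if ?P (?x q x y z) (?x q' x' y' z') then ?th $$ (?x q x y z, ?x q' x' y' z') else 0)
          = (if q = q' \<and> x = x' \<and> y = y' then
            (if ?P (?x q x y z) (?x q x y z') then ?w q x y * rho x y $$ (z, z') else 0) else 0)"
        proof (cases "q = q' \<and> x = x' \<and> y = y'")
          case True
          then have e: "q' = q" "x' = x" "y' = y" by simp_all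
          show ?thesis using th unfolding e by (simp only: simp_thms if_True)
        next
          case False
          then show ?thesis unfolding th by (simp only: if_False if_cancel)
        qed
      qed
      also have "\<dots> = (\<Sum>q'<k. \<Sum>x'<a1. \<Sum>y'<a2. if q = q' \<and> x = x' \<and> y = y' then
            (\<Sum>z'<d1 * d2. if ?P (?x q x y z) (?x q x y z') then ?w q x y * rho x y $$ (z, z') else 0) else 0)"
      proof -
        have "(\<Sum>z'<d1 * d2. if c then h z' else 0) = (if c then \<Sum>z'<d1 * d2. h z' else 0)" for c and h :: "nat \<Rightarrow> complex"
          by simp
        then show ?thesis by (simp only:)
      qed
      finally show ?thesis unfolding sum_delta3[OF lt(1-3)] .
    qed
    note step = this
    show ?thesis
      by (rule sum.cong[OF refl], rule sum.cong[OF refl], rule sum.cong[OF refl], rule sum.cong[OF refl])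
        (simp only: step lessThan_iff)
  qed
  also have "\<dots> = (\<Sum>q<k. \<Sum>x<a1. \<Sum>y<a2. \<Sum>b<d1. \<Sum>c<d2. \<Sum>b'<d1. \<Sum>c'<d2.
      if ?P (?x q x y (b * d2 + c)) (?x q x y (b' * d2 + c')) then ?w q x y * rho x y $$ (b * d2 + c, b' * d2 + c') else 0)"
    by (simp only: sum_lessThan_mult)
  also have "\<dots> = (\<Sum>q<k. \<Sum>x<a1. \<Sum>y<a2. if cl q x y = I \<and> cl q x y = J then ?w q x y * T x y $$ (i, j) else 0)"
  proof (rule sum.cong[OF refl], rule sum.cong[OF refl], rule sum.cong[OF refl])
    fix q x y assume "q \<in> {..<k}" "x \<in> {..<a1}" "y \<in> {..<a2}"
    then have lt: "q < k" "x < a1" "y < a2" by simp_all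
    note Tq = T[OF lt(2,3), unfolded qtr_def]
    have P: "?P (?x q x y (b * d2 + c)) (?x q x y (b' * d2 + c')) \<longleftrightarrow> (cl q x y = I \<and> cl q x y = J) \<and>
        (qu b c = i \<and> qu b' c' = j \<and> (3 \<notin> K \<longrightarrow> b = b') \<and> (4 \<notin> K \<longrightarrow> c = c'))"
      if m: "b < d1" "c < d2" "b' < d1" "c' < d2" for b c b' c'
    proof -
      have qq: "qu b c < dq" "qu b' c' < dq" using Tq m by blast+
      have eqv: "A * dq + r = A' * dq + r' \<longleftrightarrow> A = A' \<and> r = r'" if "r < dq" "r' < dq" for A A' r r'
        using that by (metis div_mod_split)
      show ?thesis
        unfolding len all_less_5 digit_idx[OF lt m(1,2)] digit_idx[OF lt m(3,4)] kap[OF lt m(1,2)] kap[OF lt m(3,4)]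
          eqv[OF qq(1) IJ(3)] eqv[OF qq(2) IJ(4)] by blast
    qed
    have "(\<Sum>b<d1. \<Sum>c<d2. \<Sum>b'<d1. \<Sum>c'<d2. if ?P (?x q x y (b * d2 + c)) (?x q x y (b' * d2 + c'))
          then ?w q x y * rho x y $$ (b * d2 + c, b' * d2 + c') else 0)
      = (\<Sum>b<d1. \<Sum>c<d2. \<Sum>b'<d1. \<Sum>c'<d2. (if cl q x y = I \<and> cl q x y = J then ?w q x y else 0) *
          (if qu b c = i \<and> qu b' c' = j \<and> (3 \<notin> K \<longrightarrow> b = b') \<and> (4 \<notin> K \<longrightarrow> c = c')
           then rho x y $$ (b * d2 + c, b' * d2 + c') else 0))"
    proof (rule sum.cong[OF refl], rule sum.cong[OF refl], rule sum.cong[OF refl], rule sum.cong[OF refl])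
      fix b c b' c' assume "b \<in> {..<d1}" "c \<in> {..<d2}" "b' \<in> {..<d1}" "c' \<in> {..<d2}"
      then have m: "b < d1" "c < d2" "b' < d1" "c' < d2" by simp_all
      show "(if ?P (?x q x y (b * d2 + c)) (?x q x y (b' * d2 + c'))
          then ?w q x y * rho x y $$ (b * d2 + c, b' * d2 + c') else 0) = (if cl q x y = I \<and> cl q x y = J then ?w q x y else 0) *
          (if qu b c = i \<and> qu b' c' = j \<and> (3 \<notin> K \<longrightarrow> b = b') \<and> (4 \<notin> K \<longrightarrow> c = c')
           then rho x y $$ (b * d2 + c, b' * d2 + c') else 0)"
        unfolding P[OF m] by (rule if_conj_mult)
    qed
    also have "\<dots> = (if cl q x y = I \<and> cl q x y = J then ?w q x y else 0) * T x y $$ (i, j)"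
      unfolding sum_distrib_left[symmetric] using Tq IJ by simp
    finally show "(\<Sum>b<d1. \<Sum>c<d2. \<Sum>b'<d1. \<Sum>c'<d2. if ?P (?x q x y (b * d2 + c)) (?x q x y (b' * d2 + c'))
          then ?w q x y * rho x y $$ (b * d2 + c, b' * d2 + c') else 0)
      = (if cl q x y = I \<and> cl q x y = J then ?w q x y * T x y $$ (i, j) else 0)" by simp
  qed
  finally show ?thesis .
qed

lemma trace_prod_sum:
  fixes R :: "complex mat"
  assumes "R \<in> carrier_mat (d1 * d2) (d1 * d2)"
  shows "(\<Sum>b<d1. \<Sum>c<d2. R $$ (b * d2 + c, b * d2 + c)) = mtrace R"
  using assms by (simp add: mtrace_def sum_lessThan_mult)

lemma sum_delta2:
  fixes S :: "'b::comm_monoid_add"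
  assumes "b < (d1::nat)" "c < (d2::nat)"
  shows "(\<Sum>b'<d1. \<Sum>c'<d2. if b = b' \<and> c = c' then f b' c' else 0) = (f b c :: 'b)"
proof -
  have "(\<Sum>c'<d2. if b = b' \<and> c = c' then f b' c' else 0) = (if b = b' then f b' c else 0)" for b'
    using assms by (cases "b = b'") auto
  then show ?thesis using assms by simp
qed

text \<open>With both outputs traced out, the normalisation of the state supplies the single
  entry.\<close>

lemma qtr_none:
  assumes "3 \<notin> K" "4 \<notin> K" "density (d1 * d2) R"
  shows "qtr K d1 d2 1 (\<lambda>b c. 0) R (1\<^sub>m 1)"
proof -
  have R: "R \<in> carrier_mat (d1 * d2) (d1 * d2)" "mtrace R = 1"
    using assms(3) psd_carrier by (auto simp: density_def)
  have "(\<Sum>b<d1. \<Sum>c<d2. \<Sum>b'<d1. \<Sum>c'<d2. if b = b' \<and> c = c' then R $$ (b * d2 + c, b' * d2 + c') else 0) = 1"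
    unfolding R(2)[symmetric] trace_prod_sum[OF R(1), symmetric]
    by (rule sum.cong[OF refl], rule sum.cong[OF refl], rule sum_delta2) auto
  then show ?thesis using assms(1,2) by (simp add: qtr_def)
qed

lemma qtr_1:
  assumes "3 \<in> K" "4 \<notin> K"
  shows "qtr K d1 d2 d1 (\<lambda>b c. b) R (red1 d1 d2 R)"
proof -
  have "(\<Sum>b<d1. \<Sum>c<d2. \<Sum>b'<d1. \<Sum>c'<d2. if b = i \<and> b' = j \<and> c = c' then R $$ (b * d2 + c, b' * d2 + c') else 0)
      = (\<Sum>c<d2. R $$ (i * d2 + c, j * d2 + c))" if ij: "i < d1" "j < d1" for i j
  proof -
    have "(\<Sum>b<d1. \<Sum>c<d2. \<Sum>b'<d1. \<Sum>c'<d2. if b = i \<and> b' = j \<and> c = c' then R $$ (b * d2 + c, b' * d2 + c') else 0)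
      = (\<Sum>b<d1. \<Sum>c<d2. if b = i then R $$ (b * d2 + c, j * d2 + c) else 0)"
    proof (rule sum.cong[OF refl], rule sum.cong[OF refl])
      fix b c assume "b \<in> {..<d1}" "c \<in> {..<d2}"
      then have "(\<Sum>b'<d1. \<Sum>c'<d2. if j = b' \<and> c = c' then (if b = i then R $$ (b * d2 + c, b' * d2 + c') else 0) else 0)
        = (if b = i then R $$ (b * d2 + c, j * d2 + c) else 0)"
        using sum_delta2[OF ij(2), of c d2 "\<lambda>b' c'. if b = i then R $$ (b * d2 + c, b' * d2 + c') else 0"] by simp
      moreover have "(if b = i \<and> b' = j \<and> c = c' then R $$ (b * d2 + c, b' * d2 + c') else 0)
        = (if j = b' \<and> c = c' then (if b = i then R $$ (b * d2 + c, b' * d2 + c') else 0) else 0)" for b' c' by auto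
      ultimately show "(\<Sum>b'<d1. \<Sum>c'<d2. if b = i \<and> b' = j \<and> c = c' then R $$ (b * d2 + c, b' * d2 + c') else 0)
        = (if b = i then R $$ (b * d2 + c, j * d2 + c) else 0)" by simp
    qed
    also have "\<dots> = (\<Sum>b<d1. if b = i then \<Sum>c<d2. R $$ (b * d2 + c, j * d2 + c) else 0)"
      by (intro sum.cong refl) simp
    finally show ?thesis using ij by simp
  qed
  then show ?thesis using assms by (simp add: qtr_def red1_def)
qed

lemma qtr_2:
  assumes "3 \<notin> K" "4 \<in> K"
  shows "qtr K d1 d2 d2 (\<lambda>b c. c) R (red2 d1 d2 R)"
proof -
  have "(\<Sum>b<d1. \<Sum>c<d2. \<Sum>b'<d1. \<Sum>c'<d2. if c = i \<and> c' = j \<and> b = b' then R $$ (b * d2 + c, b' * d2 + c') else 0)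
      = (\<Sum>b<d1. R $$ (b * d2 + i, b * d2 + j))" if ij: "i < d2" "j < d2" for i j
  proof -
    have "(\<Sum>b<d1. \<Sum>c<d2. \<Sum>b'<d1. \<Sum>c'<d2. if c = i \<and> c' = j \<and> b = b' then R $$ (b * d2 + c, b' * d2 + c') else 0)
      = (\<Sum>b<d1. \<Sum>c<d2. if c = i then R $$ (b * d2 + c, b * d2 + j) else 0)"
    proof (rule sum.cong[OF refl], rule sum.cong[OF refl])
      fix b c assume "b \<in> {..<d1}" "c \<in> {..<d2}"
      then have "(\<Sum>b'<d1. \<Sum>c'<d2. if b = b' \<and> j = c' then (if c = i then R $$ (b * d2 + c, b' * d2 + c') else 0) else 0)
        = (if c = i then R $$ (b * d2 + c, b * d2 + j) else 0)"
        using sum_delta2[of b d1 j d2 "\<lambda>b' c'. if c = i then R $$ (b * d2 + c, b' * d2 + c') else 0"] ij by simp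
      moreover have "(if c = i \<and> c' = j \<and> b = b' then R $$ (b * d2 + c, b' * d2 + c') else 0)
        = (if b = b' \<and> j = c' then (if c = i then R $$ (b * d2 + c, b' * d2 + c') else 0) else 0)" for b' c' by auto
      ultimately show "(\<Sum>b'<d1. \<Sum>c'<d2. if c = i \<and> c' = j \<and> b = b' then R $$ (b * d2 + c, b' * d2 + c') else 0)
        = (if c = i then R $$ (b * d2 + c, b * d2 + j) else 0)" by simp
    qed
    then show ?thesis using ij by simp
  qed
  then show ?thesis using assms by (simp add: qtr_def red2_def)
qed

lemma qtr_12:
  assumes "3 \<in> K" "4 \<in> K"
  shows "qtr K d1 d2 (d1 * d2) (\<lambda>b c. b * d2 + c) R R"
proof -
  have "(\<Sum>b<d1. \<Sum>c<d2. \<Sum>b'<d1. \<Sum>c'<d2. if b * d2 + c = i \<and> b' * d2 + c' = j then R $$ (b * d2 + c, b' * d2 + c') else 0)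
      = R $$ (i, j)" if ij: "i < d1 * d2" "j < d1 * d2" for i j
  proof -
    have "(\<Sum>b<d1. \<Sum>c<d2. \<Sum>b'<d1. \<Sum>c'<d2. if b * d2 + c = i \<and> b' * d2 + c' = j then R $$ (b * d2 + c, b' * d2 + c') else 0)
      = (\<Sum>z<d1 * d2. \<Sum>z'<d1 * d2. if z = i \<and> z' = j then R $$ (z, z') else 0)"
      by (simp only: sum_lessThan_mult)
    also have "\<dots> = (\<Sum>z<d1 * d2. \<Sum>z'<d1 * d2. if i = z \<and> j = z' then R $$ (z, z') else 0)"
      by (intro sum.cong refl) auto
    also have "\<dots> = R $$ (i, j)" by (rule sum_delta2[OF ij])
    finally show ?thesis .
  qed
  then show ?thesis using assms by (simp add: qtr_def mult_add_less)
qed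

lemma density_one: "density 1 (1\<^sub>m 1)"
proof -
  have "psd 1 (1\<^sub>m 1)" by (rule psdI) (auto simp: pos_def qf_expand)
  then show ?thesis by (simp add: density_def mtrace_def)
qed

lemma bij_betw_mult:
  fixes n d :: nat
  assumes e: "bij_betw e C {..<n}"
  shows "bij_betw (\<lambda>p. e (fst p) * d + snd p) (C \<times> {..<d}) {..<n * d}"
proof (rule bij_betwI')
  fix p p' assume p: "p \<in> C \<times> {..<d}" "p' \<in> C \<times> {..<d}"
  have "e (fst p) * d + snd p = e (fst p') * d + snd p' \<longleftrightarrow> e (fst p) = e (fst p') \<and> snd p = snd p'"
    using p by (metis div_mod_split mem_Times_iff lessThan_iff)
  also have "\<dots> \<longleftrightarrow> p = p'"
    using e p by (auto simp: bij_betw_def inj_on_def prod_eq_iff)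
  finally show "(e (fst p) * d + snd p = e (fst p') * d + snd p') = (p = p')" .
next
  fix p assume "p \<in> C \<times> {..<d}"
  then show "e (fst p) * d + snd p \<in> {..<n * d}"
    using bij_betwE[OF e] by (auto intro!: mult_add_less)
next
  fix i assume i: "i \<in> {..<n * d}"
  then have "0 < d" by (cases d) auto
  moreover have "i div d < n" using i by (simp add: less_mult_imp_div_less)
  then have "i div d \<in> e ` C" using e by (simp add: bij_betw_def)
  then obtain c where "c \<in> C" "e c = i div d" by (metis imageE)
  ultimately show "\<exists>p\<in>C \<times> {..<d}. i = e (fst p) * d + snd p"
    by (intro bexI[of _ "(c, i mod d)"]) auto
qed

lemma is_distrD:
  assumes "is_distr n p"
  shows "\<And>i. i \<in> {..<n} \<Longrightarrow> 0 \<le> p i" "sum p {..<n} = 1"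
  using assms by (auto simp: is_distr_def)

lemma density_mix_distr:
  assumes "is_distr n p" "\<And>x. x < n \<Longrightarrow> density d (R x)"
  shows "density d (mix d {..<n} p R)"
  by (rule density_mix) (use assms is_distrD[OF assms(1)] in auto)

lemma density_mix_product:
  assumes p: "is_distr a1 p1" "is_distr a2 p2" and R: "\<And>x y. x < a1 \<Longrightarrow> y < a2 \<Longrightarrow> density d (R x y)"
  shows "density d (mix d ({..<a1} \<times> {..<a2}) (\<lambda>(x, y). p1 x * p2 y) (\<lambda>(x, y). R x y))"
proof (rule density_mix)
  show "sum (\<lambda>(x, y). p1 x * p2 y) ({..<a1} \<times> {..<a2}) = 1"
    unfolding sum.cartesian_product[symmetric] sum_product[symmetric]
    using is_distrD(2)[OF p(1)] is_distrD(2)[OF p(2)] by simp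
qed (use R is_distrD[OF p(1)] is_distrD[OF p(2)] in auto)

lemma kept_eq:
  assumes "K \<inter> {..<5} = set L" "sorted L" "distinct L"
  shows "kept [k, a1, a2, d1, d2] K = L"
proof -
  have l: "length [k, a1, a2, d1, d2] = 5" by simp
  show ?thesis unfolding kept_def l assms(1)
    by (rule sorted_list_of_set.idem_if_sorted_distinct[OF assms(2,3)])
qed

lemma sum_combine4:
  fixes A :: "'a \<Rightarrow> real"
  shows "sum A S + sum B S - sum C S - sum D S = (\<Sum>q\<in>S. A q + B q - C q - D q)"
  by (simp add: sum.distrib sum_subtractf)

lemma mix_1_entropy:
  assumes "is_distr n p" shows "vn_entropy (mix 1 {..<n} p (\<lambda>x. 1\<^sub>m 1)) = 0"
  by (rule vn_entropy_density_1[OF density_mix_distr[OF assms density_one]])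

lemma kept_simps:
  "kept [k, a1, a2, d1, d2] {0, 1, 2} = [0, 1, 2]"
  "kept [k, a1, a2, d1, d2] {0, 2, 3} = [0, 2, 3]"
  "kept [k, a1, a2, d1, d2] {0, 1, 2, 3} = [0, 1, 2, 3]"
  "kept [k, a1, a2, d1, d2] {0, 2} = [0, 2]"
  "kept [k, a1, a2, d1, d2] {0, 1, 4} = [0, 1, 4]"
  "kept [k, a1, a2, d1, d2] {0, 1, 2, 4} = [0, 1, 2, 4]"
  "kept [k, a1, a2, d1, d2] {0, 1} = [0, 1]"
  "kept [k, a1, a2, d1, d2] {0, 3, 4} = [0, 3, 4]"
  "kept [k, a1, a2, d1, d2] {0, 1, 2, 3, 4} = [0, 1, 2, 3, 4]"
  "kept [k, a1, a2, d1, d2] {0} = [0]"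
  by (rule kept_eq; auto)+

section \<open>Conditional informations of the time-sharing state\<close>

context
  fixes k a1 a2 d1 d2 :: nat and rho :: "nat \<Rightarrow> nat \<Rightarrow> complex mat" and pQ :: "nat \<Rightarrow> real" and p1 p2 :: "nat \<Rightarrow> nat \<Rightarrow> real"
  assumes rho: "\<And>x y. x < a1 \<Longrightarrow> y < a2 \<Longrightarrow> density (d1 * d2) (rho x y)"
    and pQ: "is_distr k pQ" and p: "\<And>q. q < k \<Longrightarrow> is_distr a1 (p1 q)" "\<And>q. q < k \<Longrightarrow> is_distr a2 (p2 q)"
begin

abbreviation (input) "ds \<equiv> [k, a1, a2, d1, d2]"
abbreviation (input) "th \<equiv> theta a1 a2 d1 d2 rho k pQ p1 p2"
abbreviation (input) "tx q x y b c \<equiv> idx a1 a2 (d1 * d2) q x y (b * d2 + c)"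

text \<open>Here \<open>C\<close> is the set of values of the kept classical systems, and \<open>S c\<close> is the conditional
  state of the kept output systems, with weight \<open>W c\<close>.\<close>

lemma Hsub_theta:
  assumes DK: "prod_list (map ((!) ds) (kept ds K)) = nc * dq"
    and kap: "\<And>q x y b c. q < k \<Longrightarrow> x < a1 \<Longrightarrow> y < a2 \<Longrightarrow> b < d1 \<Longrightarrow> c < d2 \<Longrightarrow>
      kept_index ds K (tx q x y b c) = e (cl q x y) * dq + qu b c"
    and cl: "\<And>q x y. q < k \<Longrightarrow> x < a1 \<Longrightarrow> y < a2 \<Longrightarrow> cl q x y \<in> C"
    and e: "bij_betw e C {..<nc}" and C: "finite C"
    and T: "\<And>x y. x < a1 \<Longrightarrow> y < a2 \<Longrightarrow> qtr K d1 d2 dq qu (rho x y) (T x y)"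
    and S: "\<And>c. c \<in> C \<Longrightarrow> density dq (S c)" and W: "\<And>c. c \<in> C \<Longrightarrow> 0 \<le> W c"
    and eq: "\<And>c i j. c \<in> C \<Longrightarrow> i < dq \<Longrightarrow> j < dq \<Longrightarrow>
      (\<Sum>q<k. \<Sum>x<a1. \<Sum>y<a2. if cl q x y = c then of_real (pQ q * p1 q x * p2 q y) * T x y $$ (i, j) else 0) = of_real (W c) * S c $$ (i, j)"
  shows "Hsub ds th K = (\<Sum>c\<in>C. eta (W c) + W c * vn_entropy (S c))"
  unfolding Hsub_def
proof (rule vn_entropy_block[OF bij_betw_mult[OF e] C _ _ S W])
  let ?P = "ptrace ds K th"
  show "?P \<in> carrier_mat (nc * dq) (nc * dq)"
    unfolding ptrace_def Let_def DK by simp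
  have rc: "rho x y \<in> carrier_mat (d1 * d2) (d1 * d2)" if "x < a1" "y < a2" for x y
    using rho[OF that] psd_carrier by (auto simp: density_def)
  fix c c' b b' assume m: "c \<in> C" "c' \<in> C" "b < dq" "b' < dq"
  have ec: "e c < nc" "e c' < nc" using bij_betwE[OF e] m by auto
  have inj: "e x = e y \<longleftrightarrow> x = y" if "x \<in> C" "y \<in> C" for x y
    using e that by (auto simp: bij_betw_def inj_on_def)
  have "?P $$ (e c * dq + b, e c' * dq + b')
    = (\<Sum>q<k. \<Sum>x<a1. \<Sum>y<a2. if e (cl q x y) = e c \<and> e (cl q x y) = e c' then of_real (pQ q * p1 q x * p2 q y) * T x y $$ (b, b') else 0)"
    by (rule ptrace_theta[where cl = "\<lambda>q x y. e (cl q x y)", OF rc DK kap T ec m(3,4)])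
  also have "\<dots> = (\<Sum>q<k. \<Sum>x<a1. \<Sum>y<a2. if c = c' then (if cl q x y = c then of_real (pQ q * p1 q x * p2 q y) * T x y $$ (b, b') else 0) else 0)"
    using inj cl m by (intro sum.cong refl) auto
  also have "\<dots> = (if c = c' then of_real (W c) * S c $$ (b, b') else 0)"
    using eq[OF m(1,3,4)] by (cases "c = c'") simp_all
  finally show "?P $$ (e (fst (c, b)) * dq + snd (c, b), e (fst (c', b')) * dq + snd (c', b'))
    = (if c = c' then of_real (W c) * S c $$ (b, b') else 0)" by simp
qed

text \<open>This and the next three results differ in the classical systems that are kept; inputs
  that are not kept are averaged into the conditional state. The outputs that are kept enter through
  \<open>dq\<close>, \<open>qu\<close> and \<open>T\<close>.\<close>

lemma Hsub_theta_X1X2Q: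
  assumes DK: "prod_list (map ((!) ds) (kept ds K)) = k * a1 * a2 * dq"
    and kap: "\<And>q x y b c. q < k \<Longrightarrow> x < a1 \<Longrightarrow> y < a2 \<Longrightarrow> b < d1 \<Longrightarrow> c < d2 \<Longrightarrow>
      kept_index ds K (tx q x y b c) = ((q * a1 + x) * a2 + y) * dq + qu b c"
    and T: "\<And>x y. x < a1 \<Longrightarrow> y < a2 \<Longrightarrow> qtr K d1 d2 dq qu (rho x y) (T x y)"
    and TD: "\<And>x y. x < a1 \<Longrightarrow> y < a2 \<Longrightarrow> density dq (T x y)"
  shows "Hsub ds th K
    = (\<Sum>q<k. \<Sum>x<a1. \<Sum>y<a2. eta (pQ q * p1 q x * p2 q y) + pQ q * p1 q x * p2 q y * vn_entropy (T x y))"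
proof -
  let ?C = "({..<k} \<times> {..<a1}) \<times> {..<a2}"
  let ?W = "\<lambda>((q, x), y). pQ q * p1 q x * p2 q y" and ?S = "\<lambda>((q, x), y). T x y"
  have "Hsub ds th K = (\<Sum>c\<in>?C. eta (?W c) + ?W c * vn_entropy (?S c))"
  proof (rule Hsub_theta[OF DK])
    show "bij_betw (\<lambda>p. (id (fst (fst p)) * a1 + snd (fst p)) * a2 + snd p) ?C {..<k * a1 * a2}"
      by (rule bij_betw_mult[OF bij_betw_mult]) (rule bij_betw_id)
    show "kept_index ds K (tx q x y b c)
      = ((id (fst (fst ((q, x), y))) * a1 + snd (fst ((q, x), y))) * a2 + snd ((q, x), y)) * dq + qu b c"
      if "q < k" "x < a1" "y < a2" "b < d1" "c < d2" for q x y b c using kap[OF that] by simp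
    fix c i j assume c: "c \<in> ?C" and ij: "i < dq" "j < dq"
    obtain q x y where cq: "c = ((q, x), y)" by (metis surj_pair)
    then have lt: "q < k" "x < a1" "y < a2" using c by auto
    have "(\<Sum>q'<k. \<Sum>x'<a1. \<Sum>y'<a2. if ((q', x'), y') = c then of_real (pQ q' * p1 q' x' * p2 q' y') * T x' y' $$ (i, j) else 0)
      = (\<Sum>q'<k. \<Sum>x'<a1. \<Sum>y'<a2. if q = q' \<and> x = x' \<and> y = y' then of_real (pQ q * p1 q x * p2 q y) * T x y $$ (i, j) else 0)"
      by (intro sum.cong refl) (auto simp: cq)
    also have "\<dots> = of_real (?W c) * ?S c $$ (i, j)" unfolding sum_delta3[OF lt] by (simp add: cq)
    finally show "(\<Sum>q'<k. \<Sum>x'<a1. \<Sum>y'<a2. if ((q', x'), y') = c then of_real (pQ q' * p1 q' x' * p2 q' y') * T x' y' $$ (i, j) else 0)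
      = of_real (?W c) * ?S c $$ (i, j)" .
  qed (use T TD is_distrD(1)[OF pQ] is_distrD(1)[OF p(1)] is_distrD(1)[OF p(2)] in auto)
  also have "\<dots> = (\<Sum>q<k. \<Sum>x<a1. \<Sum>y<a2. eta (pQ q * p1 q x * p2 q y) + pQ q * p1 q x * p2 q y * vn_entropy (T x y))"
    by (simp add: sum.cartesian_product' split_def)
  finally show ?thesis .
qed

text \<open>Given \<open>Q\<close> the inputs are independent, so the state conditioned on
  \<open>q\<close> and \<open>y\<close> is a mixture with weights \<open>p1 q\<close>, the same for
  every \<open>y\<close>.\<close>

lemma Hsub_theta_X2Q:
  assumes DK: "prod_list (map ((!) ds) (kept ds K)) = k * a2 * dq"
    and kap: "\<And>q x y b c. q < k \<Longrightarrow> x < a1 \<Longrightarrow> y < a2 \<Longrightarrow> b < d1 \<Longrightarrow> c < d2 \<Longrightarrow>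
      kept_index ds K (tx q x y b c) = (q * a2 + y) * dq + qu b c"
    and T: "\<And>x y. x < a1 \<Longrightarrow> y < a2 \<Longrightarrow> qtr K d1 d2 dq qu (rho x y) (T x y)"
    and TD: "\<And>x y. x < a1 \<Longrightarrow> y < a2 \<Longrightarrow> density dq (T x y)"
  shows "Hsub ds th K
    = (\<Sum>q<k. \<Sum>y<a2. eta (pQ q * p2 q y) + pQ q * p2 q y * vn_entropy (mix dq {..<a1} (p1 q) (\<lambda>x. T x y)))"
proof -
  let ?C = "{..<k} \<times> {..<a2}"
  let ?W = "\<lambda>(q, y). pQ q * p2 q y" and ?S = "\<lambda>(q, y). mix dq {..<a1} (p1 q) (\<lambda>x. T x y)"
  have "Hsub ds th K = (\<Sum>c\<in>?C. eta (?W c) + ?W c * vn_entropy (?S c))"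
  proof (rule Hsub_theta[OF DK])
    show "bij_betw (\<lambda>p. id (fst p) * a2 + snd p) ?C {..<k * a2}"
      by (rule bij_betw_mult) (rule bij_betw_id)
    show "kept_index ds K (tx q x y b c)
      = (id (fst (q, y)) * a2 + snd (q, y)) * dq + qu b c"
      if "q < k" "x < a1" "y < a2" "b < d1" "c < d2" for q x y b c using kap[OF that] by simp
    show "density dq (?S c)" if "c \<in> ?C" for c
      using that p(1) TD by (auto intro!: density_mix_distr)
    fix c i j assume c: "c \<in> ?C" and ij: "i < dq" "j < dq"
    obtain q y where cq: "c = (q, y)" by (metis surj_pair)
    then have lt: "q < k" "y < a2" using c by auto
    let ?F = "\<lambda>x. of_real (pQ q * p1 q x * p2 q y) * T x y $$ (i, j)"
    have 1: "(\<Sum>y'<a2. if (q', y') = c then of_real (pQ q' * p1 q' x' * p2 q' y') * T x' y' $$ (i, j) else 0)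
      = (if q' = q then ?F x' else 0)" for q' x'
      using lt by (cases "q' = q") (simp_all add: cq)
    have "(\<Sum>q'<k. \<Sum>x'<a1. \<Sum>y'<a2. if (q', y') = c then of_real (pQ q' * p1 q' x' * p2 q' y') * T x' y' $$ (i, j) else 0)
      = (\<Sum>q'<k. if q' = q then \<Sum>x'<a1. ?F x' else 0)"
      unfolding 1 by (rule sum.cong[OF refl]) simp
    also have "\<dots> = of_real (?W c) * ?S c $$ (i, j)"
      using lt ij by (simp add: cq mix_def sum_distrib_left mult_ac)
    finally show "(\<Sum>q'<k. \<Sum>x'<a1. \<Sum>y'<a2. if (q', y') = c then of_real (pQ q' * p1 q' x' * p2 q' y') * T x' y' $$ (i, j) else 0)
      = of_real (?W c) * ?S c $$ (i, j)" .
  qed (use T is_distrD(1)[OF pQ] is_distrD(1)[OF p(2)] in auto)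
  also have "\<dots> = (\<Sum>q<k. \<Sum>y<a2. eta (pQ q * p2 q y) + pQ q * p2 q y * vn_entropy (mix dq {..<a1} (p1 q) (\<lambda>x. T x y)))"
    by (simp add: sum.cartesian_product' split_def)
  finally show ?thesis .
qed

lemma Hsub_theta_X1Q:
  assumes DK: "prod_list (map ((!) ds) (kept ds K)) = k * a1 * dq"
    and kap: "\<And>q x y b c. q < k \<Longrightarrow> x < a1 \<Longrightarrow> y < a2 \<Longrightarrow> b < d1 \<Longrightarrow> c < d2 \<Longrightarrow>
      kept_index ds K (tx q x y b c) = (q * a1 + x) * dq + qu b c"
    and T: "\<And>x y. x < a1 \<Longrightarrow> y < a2 \<Longrightarrow> qtr K d1 d2 dq qu (rho x y) (T x y)"
    and TD: "\<And>x y. x < a1 \<Longrightarrow> y < a2 \<Longrightarrow> density dq (T x y)"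
  shows "Hsub ds th K
    = (\<Sum>q<k. \<Sum>x<a1. eta (pQ q * p1 q x) + pQ q * p1 q x * vn_entropy (mix dq {..<a2} (p2 q) (\<lambda>y. T x y)))"
proof -
  let ?C = "{..<k} \<times> {..<a1}"
  let ?W = "\<lambda>(q, x). pQ q * p1 q x" and ?S = "\<lambda>(q, x). mix dq {..<a2} (p2 q) (\<lambda>y. T x y)"
  have "Hsub ds th K = (\<Sum>c\<in>?C. eta (?W c) + ?W c * vn_entropy (?S c))"
  proof (rule Hsub_theta[OF DK])
    show "bij_betw (\<lambda>p. id (fst p) * a1 + snd p) ?C {..<k * a1}"
      by (rule bij_betw_mult) (rule bij_betw_id)
    show "kept_index ds K (tx q x y b c)
      = (id (fst (q, x)) * a1 + snd (q, x)) * dq + qu b c"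
      if "q < k" "x < a1" "y < a2" "b < d1" "c < d2" for q x y b c using kap[OF that] by simp
    show "density dq (?S c)" if "c \<in> ?C" for c
      using that p(2) TD by (auto intro!: density_mix_distr)
    fix c i j assume c: "c \<in> ?C" and ij: "i < dq" "j < dq"
    obtain q x where cq: "c = (q, x)" by (metis surj_pair)
    then have lt: "q < k" "x < a1" using c by auto
    let ?F = "\<lambda>y. of_real (pQ q * p1 q x * p2 q y) * T x y $$ (i, j)"
    have 1: "(\<Sum>y'<a2. if (q', x') = c then of_real (pQ q' * p1 q' x' * p2 q' y') * T x' y' $$ (i, j) else 0)
      = (if q' = q \<and> x' = x then \<Sum>y'<a2. ?F y' else 0)" for q' x'
      unfolding cq prod.inject by (cases "q' = q \<and> x' = x") (simp_all only: if_True if_False simp_thms sum.neutral_const)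
    have 2: "(\<Sum>x'<a1. if q' = q \<and> x' = x then \<Sum>y'<a2. ?F y' else 0) = (if q' = q then \<Sum>y'<a2. ?F y' else 0)" for q'
      using lt by (cases "q' = q") simp_all
    have "(\<Sum>q'<k. \<Sum>x'<a1. \<Sum>y'<a2. if (q', x') = c then of_real (pQ q' * p1 q' x' * p2 q' y') * T x' y' $$ (i, j) else 0)
      = (\<Sum>y'<a2. ?F y')"
      unfolding 1 2 using lt by simp
    also have "\<dots> = of_real (?W c) * ?S c $$ (i, j)"
      using ij by (simp add: cq mix_def sum_distrib_left mult_ac)
    finally show "(\<Sum>q'<k. \<Sum>x'<a1. \<Sum>y'<a2. if (q', x') = c then of_real (pQ q' * p1 q' x' * p2 q' y') * T x' y' $$ (i, j) else 0)
      = of_real (?W c) * ?S c $$ (i, j)" .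
  qed (use T is_distrD(1)[OF pQ] is_distrD(1)[OF p(1)] in auto)
  also have "\<dots> = (\<Sum>q<k. \<Sum>x<a1. eta (pQ q * p1 q x) + pQ q * p1 q x * vn_entropy (mix dq {..<a2} (p2 q) (\<lambda>y. T x y)))"
    by (simp add: sum.cartesian_product' split_def)
  finally show ?thesis .
qed

lemma Hsub_theta_Q:
  assumes DK: "prod_list (map ((!) ds) (kept ds K)) = k * dq"
    and kap: "\<And>q x y b c. q < k \<Longrightarrow> x < a1 \<Longrightarrow> y < a2 \<Longrightarrow> b < d1 \<Longrightarrow> c < d2 \<Longrightarrow>
      kept_index ds K (tx q x y b c) = q * dq + qu b c"
    and T: "\<And>x y. x < a1 \<Longrightarrow> y < a2 \<Longrightarrow> qtr K d1 d2 dq qu (rho x y) (T x y)"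
    and TD: "\<And>x y. x < a1 \<Longrightarrow> y < a2 \<Longrightarrow> density dq (T x y)"
  shows "Hsub ds th K
    = (\<Sum>q<k. eta (pQ q) + pQ q * vn_entropy (mix dq ({..<a1} \<times> {..<a2}) (\<lambda>(x, y). p1 q x * p2 q y) (\<lambda>(x, y). T x y)))"
proof (rule Hsub_theta[OF DK])
  let ?S = "\<lambda>q. mix dq ({..<a1} \<times> {..<a2}) (\<lambda>(x, y). p1 q x * p2 q y) (\<lambda>(x, y). T x y)"
  show "bij_betw id {..<k} {..<k}" by simp
  show "kept_index ds K (tx q x y b c) = id q * dq + qu b c"
    if "q < k" "x < a1" "y < a2" "b < d1" "c < d2" for q x y b c using kap[OF that] by simp
  show "density dq (?S c)" if "c \<in> {..<k}" for c
    using that p TD by (intro density_mix_product) auto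
  fix q i j assume q: "q \<in> {..<k}" and ij: "i < dq" "j < dq"
  let ?F = "\<lambda>x y. of_real (pQ q * p1 q x * p2 q y) * T x y $$ (i, j)"
  have "(\<Sum>q'<k. \<Sum>x'<a1. \<Sum>y'<a2. if q' = q then of_real (pQ q' * p1 q' x' * p2 q' y') * T x' y' $$ (i, j) else 0)
    = (\<Sum>q'<k. if q' = q then \<Sum>x'<a1. \<Sum>y'<a2. ?F x' y' else 0)"
    by (rule sum.cong[OF refl]) simp
  also have "\<dots> = of_real (pQ q) * ?S q $$ (i, j)"
    using q ij by (simp add: mix_def sum_distrib_left mult_ac sum.cartesian_product' split_def)
  finally show "(\<Sum>q'<k. \<Sum>x'<a1. \<Sum>y'<a2. if q' = q then of_real (pQ q' * p1 q' x' * p2 q' y') * T x' y' $$ (i, j) else 0)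
    = of_real (pQ q) * ?S q $$ (i, j)" .
qed (use T is_distrD(1)[OF pQ] in auto)

text \<open>By the chain rule each entropy is a classical part plus an average of conditional
  entropies. The classical parts cancel in pairs, between the sets with and without the outputs, and
  the rest is an average of Holevo quantities over \<open>q\<close>.\<close>

lemma cmi_theta:
  shows "cmi ds th {1} {3} {2, 0} = (\<Sum>q<k. pQ q * info1 a1 a2 d1 d2 rho (p1 q) (p2 q))"
    and "cmi ds th {2} {4} {1, 0} = (\<Sum>q<k. pQ q * info2 a1 a2 d1 d2 rho (p1 q) (p2 q))"
    and "cmi ds th {1, 2} {3, 4} {0} = (\<Sum>q<k. pQ q * info3 a1 a2 d1 d2 rho (p1 q) (p2 q))"
proof -
  let ?w = "\<lambda>q x y. pQ q * p1 q x * p2 q y"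
  have sets: "{1} \<union> {0, 2} = {0, 1, 2 :: nat}" "{3} \<union> {0, 2} = {0, 2, 3 :: nat}" "{1} \<union> {3} \<union> {0, 2} = {0, 1, 2, 3 :: nat}"
    "{2, 0} = {0, 2 :: nat}" "{2} \<union> {0, 1} = {0, 1, 2 :: nat}" "{4} \<union> {0, 1} = {0, 1, 4 :: nat}"
    "{2} \<union> {4} \<union> {0, 1} = {0, 1, 2, 4 :: nat}" "{1, 0} = {0, 1 :: nat}" "{1, 2} \<union> {0} = {0, 1, 2 :: nat}"
    "{3, 4} \<union> {0} = {0, 3, 4 :: nat}" "{1, 2} \<union> {3, 4} \<union> {0} = {0, 1, 2, 3, 4 :: nat}"
    by auto
  have h012: "Hsub ds th {0, 1, 2} = (\<Sum>q<k. \<Sum>x<a1. \<Sum>y<a2. eta (?w q x y) + ?w q x y * vn_entropy (1\<^sub>m 1))"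
    by (rule Hsub_theta_X1X2Q[OF _ _ qtr_none[OF _ _ rho] density_one], unfold kept_index_def kept_simps)
      (simp_all add: enc_def digit_idx, (simp_all add: algebra_simps)?)
  have h023: "Hsub ds th {0, 2, 3} = (\<Sum>q<k. \<Sum>y<a2. eta (pQ q * p2 q y) + pQ q * p2 q y * vn_entropy (mix d1 {..<a1} (p1 q) (\<lambda>x. red1 d1 d2 (rho x y))))"
    by (rule Hsub_theta_X2Q[OF _ _ qtr_1 density_red1[OF rho]], unfold kept_index_def kept_simps)
      (simp_all add: enc_def digit_idx, (simp_all add: algebra_simps)?)
  have h0123: "Hsub ds th {0, 1, 2, 3} = (\<Sum>q<k. \<Sum>x<a1. \<Sum>y<a2. eta (?w q x y) + ?w q x y * vn_entropy (red1 d1 d2 (rho x y)))"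
    by (rule Hsub_theta_X1X2Q[OF _ _ qtr_1 density_red1[OF rho]], unfold kept_index_def kept_simps)
      (simp_all add: enc_def digit_idx, (simp_all add: algebra_simps)?)
  have h02: "Hsub ds th {0, 2} = (\<Sum>q<k. \<Sum>y<a2. eta (pQ q * p2 q y) + pQ q * p2 q y * vn_entropy (mix 1 {..<a1} (p1 q) (\<lambda>x. 1\<^sub>m 1)))"
    by (rule Hsub_theta_X2Q[OF _ _ qtr_none[OF _ _ rho] density_one], unfold kept_index_def kept_simps)
      (simp_all add: enc_def digit_idx, (simp_all add: algebra_simps)?)
  have h014: "Hsub ds th {0, 1, 4} = (\<Sum>q<k. \<Sum>x<a1. eta (pQ q * p1 q x) + pQ q * p1 q x * vn_entropy (mix d2 {..<a2} (p2 q) (\<lambda>y. red2 d1 d2 (rho x y))))"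
    by (rule Hsub_theta_X1Q[OF _ _ qtr_2 density_red2[OF rho]], unfold kept_index_def kept_simps)
      (simp_all add: enc_def digit_idx, (simp_all add: algebra_simps)?)
  have h0124: "Hsub ds th {0, 1, 2, 4} = (\<Sum>q<k. \<Sum>x<a1. \<Sum>y<a2. eta (?w q x y) + ?w q x y * vn_entropy (red2 d1 d2 (rho x y)))"
    by (rule Hsub_theta_X1X2Q[OF _ _ qtr_2 density_red2[OF rho]], unfold kept_index_def kept_simps)
      (simp_all add: enc_def digit_idx, (simp_all add: algebra_simps)?)
  have h01: "Hsub ds th {0, 1} = (\<Sum>q<k. \<Sum>x<a1. eta (pQ q * p1 q x) + pQ q * p1 q x * vn_entropy (mix 1 {..<a2} (p2 q) (\<lambda>y. 1\<^sub>m 1)))"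
    by (rule Hsub_theta_X1Q[OF _ _ qtr_none[OF _ _ rho] density_one], unfold kept_index_def kept_simps)
      (simp_all add: enc_def digit_idx, (simp_all add: algebra_simps)?)
  have h034: "Hsub ds th {0, 3, 4} = (\<Sum>q<k. eta (pQ q) + pQ q * vn_entropy (mix (d1 * d2) ({..<a1} \<times> {..<a2}) (\<lambda>(x, y). p1 q x * p2 q y) (\<lambda>(x, y). rho x y)))"
    by (rule Hsub_theta_Q[OF _ _ qtr_12 rho], unfold kept_index_def kept_simps)
      (simp_all add: enc_def digit_idx, (simp_all add: algebra_simps)?)
  have h01234: "Hsub ds th {0, 1, 2, 3, 4} = (\<Sum>q<k. \<Sum>x<a1. \<Sum>y<a2. eta (?w q x y) + ?w q x y * vn_entropy (rho x y))"
    by (rule Hsub_theta_X1X2Q[OF _ _ qtr_12 rho], unfold kept_index_def kept_simps)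
      (simp_all add: enc_def digit_idx, (simp_all add: algebra_simps)?)
  have h0: "Hsub ds th {0} = (\<Sum>q<k. eta (pQ q) + pQ q * vn_entropy (mix 1 ({..<a1} \<times> {..<a2}) (\<lambda>(x, y). p1 q x * p2 q y) (\<lambda>(x, y). 1\<^sub>m 1)))"
    by (rule Hsub_theta_Q[OF _ _ qtr_none[OF _ _ rho] density_one], unfold kept_index_def kept_simps)
      (simp_all add: enc_def digit_idx, (simp_all add: algebra_simps)?)
  have v1: "vn_entropy (1\<^sub>m 1 :: complex mat) = 0" by (rule vn_entropy_density_1[OF density_one])
  show "cmi ds th {1} {3} {2, 0} = (\<Sum>q<k. pQ q * info1 a1 a2 d1 d2 rho (p1 q) (p2 q))"
    unfolding cmi_def sets h012 h023 h0123 h02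
  proof (rule trans[OF sum_combine4], rule sum.cong[OF refl])
    fix q assume "q \<in> {..<k}"
    then have m: "vn_entropy (mix 1 {..<a1} (p1 q) (\<lambda>x. 1\<^sub>m 1)) = 0" using mix_1_entropy p(1) by simp
    have "(\<Sum>x<a1. \<Sum>y<a2. ?w q x y * vn_entropy (red1 d1 d2 (rho x y)))
      = (\<Sum>y<a2. \<Sum>x<a1. pQ q * (p2 q y * (p1 q x * vn_entropy (red1 d1 d2 (rho x y)))))"
      by (subst sum.swap) (simp only: mult_ac)
    then show "(\<Sum>x<a1. \<Sum>y<a2. eta (?w q x y) + ?w q x y * vn_entropy (1\<^sub>m 1))
       + (\<Sum>y<a2. eta (pQ q * p2 q y) + pQ q * p2 q y * vn_entropy (mix d1 {..<a1} (p1 q) (\<lambda>x. red1 d1 d2 (rho x y))))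
       - (\<Sum>x<a1. \<Sum>y<a2. eta (?w q x y) + ?w q x y * vn_entropy (red1 d1 d2 (rho x y)))
       - (\<Sum>y<a2. eta (pQ q * p2 q y) + pQ q * p2 q y * vn_entropy (mix 1 {..<a1} (p1 q) (\<lambda>x. 1\<^sub>m 1)))
      = pQ q * info1 a1 a2 d1 d2 rho (p1 q) (p2 q)"
      unfolding m v1 info1_def side_info_def chi_def
      by (simp add: sum.distrib sum_subtractf right_diff_distrib sum_distrib_left mult.assoc)
  qed
  show "cmi ds th {2} {4} {1, 0} = (\<Sum>q<k. pQ q * info2 a1 a2 d1 d2 rho (p1 q) (p2 q))"
    unfolding cmi_def sets h012 h014 h0124 h01
  proof (rule trans[OF sum_combine4], rule sum.cong[OF refl])
    fix q assume "q \<in> {..<k}"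
    then have m: "vn_entropy (mix 1 {..<a2} (p2 q) (\<lambda>y. 1\<^sub>m 1)) = 0" using mix_1_entropy p(2) by simp
    show "(\<Sum>x<a1. \<Sum>y<a2. eta (?w q x y) + ?w q x y * vn_entropy (1\<^sub>m 1))
       + (\<Sum>x<a1. eta (pQ q * p1 q x) + pQ q * p1 q x * vn_entropy (mix d2 {..<a2} (p2 q) (\<lambda>y. red2 d1 d2 (rho x y))))
       - (\<Sum>x<a1. \<Sum>y<a2. eta (?w q x y) + ?w q x y * vn_entropy (red2 d1 d2 (rho x y)))
       - (\<Sum>x<a1. eta (pQ q * p1 q x) + pQ q * p1 q x * vn_entropy (mix 1 {..<a2} (p2 q) (\<lambda>y. 1\<^sub>m 1)))
      = pQ q * info2 a1 a2 d1 d2 rho (p1 q) (p2 q)"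
      unfolding m v1 info2_def side_info_def chi_def
      by (simp add: sum.distrib sum_subtractf right_diff_distrib sum_distrib_left mult.assoc)
  qed
  show "cmi ds th {1, 2} {3, 4} {0} = (\<Sum>q<k. pQ q * info3 a1 a2 d1 d2 rho (p1 q) (p2 q))"
    unfolding cmi_def sets h012 h034 h01234 h0
  proof (rule trans[OF sum_combine4], rule sum.cong[OF refl])
    fix q assume q: "q \<in> {..<k}"
    have "density 1 (mix 1 ({..<a1} \<times> {..<a2}) (\<lambda>(x, y). p1 q x * p2 q y) (\<lambda>(x, y). 1\<^sub>m 1))"
      using q p density_one by (intro density_mix_product) auto
    note m = vn_entropy_density_1[OF this]
    show "(\<Sum>x<a1. \<Sum>y<a2. eta (?w q x y) + ?w q x y * vn_entropy (1\<^sub>m 1))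
       + (eta (pQ q) + pQ q * vn_entropy (mix (d1 * d2) ({..<a1} \<times> {..<a2}) (\<lambda>(x, y). p1 q x * p2 q y) (\<lambda>(x, y). rho x y)))
       - (\<Sum>x<a1. \<Sum>y<a2. eta (?w q x y) + ?w q x y * vn_entropy (rho x y))
       - (eta (pQ q) + pQ q * vn_entropy (mix 1 ({..<a1} \<times> {..<a2}) (\<lambda>(x, y). p1 q x * p2 q y) (\<lambda>(x, y). 1\<^sub>m 1)))
      = pQ q * info3 a1 a2 d1 d2 rho (p1 q) (p2 q)"
      unfolding m v1 info3_def chi_def
      by (simp add: sum.distrib sum_subtractf right_diff_distrib sum_distrib_left mult.assoc sum.cartesian_product' split_def)
  qed
qed

end

section \<open>Semicontinuity and compactness\<close>

text \<open>Klein's inequality for a measurement basis \<open>v\<close> and positive weights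
  \<open>s\<close> of total mass at most one. It is \<open>ln t \<le> t - 1\<close> at each pair of
  basis vectors, summed against the doubly stochastic overlaps. Strict positivity of
  \<open>s\<close> takes the place of a support condition.\<close>

lemma vn_entropy_le:
  assumes R: "density d R" and v: "onb {..<d} {..<d} v"
    and s: "\<And>k. k < d \<Longrightarrow> 0 < s k" and s1: "(\<Sum>k<d. s k) \<le> 1"
  shows "vn_entropy R \<le> - (\<Sum>k<d. Re (qf {..<d} (\<lambda>a b. R $$ (a, b)) (v k)) * log 2 (s k))"
proof -
  let ?R = "\<lambda>a b. R $$ (a, b)"
  obtain r u where S: "spectral {..<d} {..<d} ?R r u" and r0: "\<forall>j<d. 0 \<le> r j" and r1: "(\<Sum>j<d. r j) = 1"
    using density_spec[OF R] by blast
  have Rc: "R \<in> carrier_mat d d" using R psd_carrier by (auto simp: density_def)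
  let ?w = "ovl {..<d} u v"
  have "(r j * ?w j k - s k * ?w j k) / ln 2 \<le> r j * ?w j k * (log 2 (r j) - log 2 (s k))"
    if jk: "j < d" "k < d" for j k
  proof (cases "r j = 0")
    case True
    then show ?thesis using s[OF jk(2)] ovl_nonneg[of "{..<d}" u v j k] by (simp add: divide_nonpos_pos)
  next
    case False
    then have rj: "0 < r j" using r0 jk(1) by (metis order_le_less)
    have "ln (s k / r j) \<le> s k / r j - 1" using s[OF jk(2)] rj by (intro ln_le_minus_one) simp
    then have "r j * (1 - s k / r j) \<le> r j * (ln (r j) - ln (s k))"
      using rj s[OF jk(2)] by (intro mult_left_mono) (auto simp: ln_div)
    then have "r j - s k \<le> r j * (ln (r j) - ln (s k))" using rj by (simp add: right_diff_distrib)
    then have "?w j k * (r j - s k) / ln 2 \<le> ?w j k * (r j * (ln (r j) - ln (s k))) / ln 2"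
      using ovl_nonneg by (intro divide_right_mono mult_left_mono) auto
    then show ?thesis by (simp add: log_def diff_divide_distrib[symmetric] algebra_simps)
  qed
  then have "(\<Sum>j<d. \<Sum>k<d. (r j * ?w j k - s k * ?w j k) / ln 2) \<le> relent {..<d} {..<d} r s ?w"
    unfolding relent_def by (intro sum_mono) simp
  moreover have "(\<Sum>j<d. \<Sum>k<d. (r j * ?w j k - s k * ?w j k) / ln 2) = (1 - (\<Sum>k<d. s k)) / ln 2"
  proof -
    have "(\<Sum>j<d. \<Sum>k<d. r j * ?w j k) = 1"
      using ovl_sum_right[OF specD(1)[OF S] v] r1 by (simp add: sum_distrib_left[symmetric])
    moreover have "(\<Sum>j<d. \<Sum>k<d. s k * ?w j k) = (\<Sum>k<d. s k)"
      by (subst sum.swap) (use ovl_sum_left[OF specD(1)[OF S] v] in \<open>simp add: sum_distrib_left[symmetric]\<close>)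
    ultimately show ?thesis by (simp add: sum_divide_distrib[symmetric] sum_subtractf)
  qed
  moreover have "0 \<le> (1 - (\<Sum>k<d. s k)) / ln 2" using s1 by simp
  ultimately have "0 \<le> relent {..<d} {..<d} r s ?w" by linarith
  then show ?thesis
    using relent_expand[OF S v, of s] r0 vn_entropy_density[OF Rc S] by simp
qed

lemma vn_entropy_nonneg:
  assumes "density d R" shows "0 \<le> vn_entropy R"
proof -
  obtain r u where S: "spectral {..<d} {..<d} (\<lambda>a b. R $$ (a, b)) r u" and r0: "\<forall>j<d. 0 \<le> r j" and r1: "(\<Sum>j<d. r j) = 1"
    using density_spec[OF assms] by blast
  have Rc: "R \<in> carrier_mat d d" using assms psd_carrier by (auto simp: density_def)
  have "0 \<le> eta (r j)" if "j < d" for j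
  proof -
    have "r j \<le> (\<Sum>j<d. r j)" by (rule member_le_sum) (use r0 that in auto)
    then show ?thesis using r0 r1 that by (simp add: eta_def mult_nonneg_nonpos)
  qed
  then show ?thesis unfolding vn_entropy_density[OF Rc S] by (intro sum_nonneg) simp
qed

lemma density_dim_pos: "density d R \<Longrightarrow> 0 < d"
  using psd_carrier[of d R] by (cases d) (auto simp: density_def mtrace_def)

text \<open>Klein's inequality with uniform weights, in an eigenbasis of \<open>R\<close>.\<close>

lemma vn_entropy_le_log:
  assumes "density d R" shows "vn_entropy R \<le> log 2 d"
proof -
  obtain r u where S: "spectral {..<d} {..<d} (\<lambda>a b. R $$ (a, b)) r u" and r1: "(\<Sum>j<d. r j) = 1"
    using density_spec[OF assms] by blast
  have d: "0 < d" by (rule density_dim_pos[OF assms])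
  have "vn_entropy R \<le> - (\<Sum>k<d. Re (qf {..<d} (\<lambda>a b. R $$ (a, b)) (u k)) * log 2 (1 / real d))"
    by (rule vn_entropy_le[OF assms specD(1)[OF S]]) (use d in auto)
  also have "(\<Sum>k<d. Re (qf {..<d} (\<lambda>a b. R $$ (a, b)) (u k)) * log 2 (1 / real d)) = (\<Sum>k<d. r k * log 2 (1 / real d))"
    using qf_eigenvector[OF S] by (intro sum.cong refl) simp
  also have "\<dots> = log 2 (1 / real d)" using r1 by (simp add: sum_distrib_right[symmetric])
  finally show ?thesis using d by (simp add: log_divide)
qed

text \<open>Upper semicontinuity: by Klein's inequality the entropy is an infimum of functionals
  that are affine in the state, so it is dominated by one that is almost tight at \<open>p\<close>.\<close>

lemma chi_affine_bound:
  assumes X: "finite X" and R: "\<And>x. x \<in> X \<Longrightarrow> density d (R x)"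
    and p: "\<And>x. x \<in> X \<Longrightarrow> 0 \<le> p x" "sum p X = 1" and eps: "0 < eps"
  shows "\<exists>h. (\<forall>p'. (\<forall>x\<in>X. 0 \<le> p' x) \<and> sum p' X = 1 \<longrightarrow> chi d X p' R \<le> (\<Sum>x\<in>X. p' x * h x)) \<and>
    (\<Sum>x\<in>X. p x * h x) \<le> chi d X p R + eps"
proof -
  have D: "density d (mix d X p R)" by (rule density_mix[OF R p])
  obtain s v where S: "spectral {..<d} {..<d} (\<lambda>a b. mix d X p R $$ (a, b)) s v" and s0: "\<forall>j<d. 0 \<le> s j" and s1: "(\<Sum>j<d. s j) = 1"
    using density_spec[OF D] by blast
  have d: "0 < d" by (rule density_dim_pos[OF D])
  \<comment> \<open>Shifting each eigenvalue by \<open>e\<close> makes it positive. The size of the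
    shift is chosen so that the total mass becomes \<open>2 powr eps\<close>; normalising then costs
    \<open>eps\<close> in every logarithm.\<close>
  define e where "e = (2 powr eps - 1) / real d"
  have e: "0 < e" unfolding e_def using d eps by simp
  have de: "1 + real d * e = 2 powr eps" unfolding e_def using d by simp
  define s' where "s' = (\<lambda>k. (s k + e) / 2 powr eps)"
  have s'0: "0 < s' k" if "k < d" for k unfolding s'_def using s0 e that by (intro divide_pos_pos add_nonneg_pos) auto
  have s'1: "(\<Sum>k<d. s' k) \<le> 1"
    unfolding s'_def sum_divide_distrib[symmetric] by (simp add: sum.distrib s1 de)
  define g where "g = (\<lambda>x. - (\<Sum>k<d. Re (qf {..<d} (\<lambda>a b. R x $$ (a, b)) (v k)) * log 2 (s' k)))"
  have gsum: "(\<Sum>x\<in>X. p' x * g x) = - (\<Sum>k<d. Re (qf {..<d} (\<lambda>a b. mix d X p' R $$ (a, b)) (v k)) * log 2 (s' k))" for p'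
  proof -
    have "(\<Sum>x\<in>X. p' x * g x) = - (\<Sum>x\<in>X. \<Sum>k<d. p' x * (Re (qf {..<d} (\<lambda>a b. R x $$ (a, b)) (v k)) * log 2 (s' k)))"
      unfolding g_def by (simp add: sum_distrib_left sum_negf)
    also have "(\<Sum>x\<in>X. \<Sum>k<d. p' x * (Re (qf {..<d} (\<lambda>a b. R x $$ (a, b)) (v k)) * log 2 (s' k)))
      = (\<Sum>k<d. \<Sum>x\<in>X. p' x * (Re (qf {..<d} (\<lambda>a b. R x $$ (a, b)) (v k)) * log 2 (s' k)))" by (rule sum.swap)
    also have "\<dots> = (\<Sum>k<d. Re (qf {..<d} (\<lambda>a b. mix d X p' R $$ (a, b)) (v k)) * log 2 (s' k))"
      unfolding qf_mix by (simp add: sum_distrib_right mult.assoc)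
    finally show ?thesis .
  qed
  define h where "h = (\<lambda>x. g x - vn_entropy (R x))"
  have hsum: "(\<Sum>x\<in>X. p' x * h x) = (\<Sum>x\<in>X. p' x * g x) - (\<Sum>x\<in>X. p' x * vn_entropy (R x))" for p'
    unfolding h_def by (simp add: right_diff_distrib sum_subtractf)
  have "chi d X p' R \<le> (\<Sum>x\<in>X. p' x * h x)" if p': "\<forall>x\<in>X. 0 \<le> p' x" "sum p' X = 1" for p'
  proof -
    have "density d (mix d X p' R)" by (rule density_mix) (use R p' in auto)
    then show ?thesis
      using vn_entropy_le[OF _ specD(1)[OF S] s'0 s'1] unfolding chi_def hsum gsum by simp
  qed
  moreover have "(\<Sum>x\<in>X. p x * h x) \<le> chi d X p R + eps"
  proof -
    have "- (\<Sum>k<d. Re (qf {..<d} (\<lambda>a b. mix d X p R $$ (a, b)) (v k)) * log 2 (s' k)) = (\<Sum>k<d. - (s k * log 2 (s' k)))"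
      using qf_eigenvector[OF S] by (simp add: sum_negf)
    also have "\<dots> \<le> (\<Sum>k<d. eta (s k) + s k * eps)"
    proof (rule sum_mono)
      fix k assume "k \<in> {..<d}"
      then have sk: "0 \<le> s k" using s0 by simp
      show "- (s k * log 2 (s' k)) \<le> eta (s k) + s k * eps"
      proof (cases "s k = 0")
        case False
        then have "log 2 (s k) \<le> log 2 (s k + e)" using sk e by simp
        moreover have "log 2 (s' k) = log 2 (s k + e) - eps"
          unfolding s'_def using sk e by (simp add: log_divide)
        ultimately have "s k * (log 2 (s k) - eps) \<le> s k * log 2 (s' k)" using sk by (intro mult_left_mono) auto
        then show ?thesis using sk by (simp add: eta_nonneg right_diff_distrib)
      qed (simp add: eta_def)
    qed
    also have "\<dots> = vn_entropy (mix d X p R) + eps"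
      unfolding vn_entropy_density[OF mix_carrier S] using s1 by (simp add: sum.distrib sum_distrib_right[symmetric])
    finally show ?thesis unfolding chi_def hsum gsum by simp
  qed
  ultimately show ?thesis by blast
qed

section \<open>Bounds and limits of the informations\<close>

lemma chi_abs_le:
  assumes R: "\<And>x. x \<in> X \<Longrightarrow> density d (R x)" and p: "\<And>x. x \<in> X \<Longrightarrow> 0 \<le> p x" "sum p X = 1"
  shows "\<bar>chi d X p R\<bar> \<le> log 2 d"
proof -
  have D: "density d (mix d X p R)" by (rule density_mix[OF R p])
  have "0 \<le> (\<Sum>x\<in>X. p x * vn_entropy (R x))" using p(1) vn_entropy_nonneg[OF R] by (intro sum_nonneg mult_nonneg_nonneg) auto
  moreover have "(\<Sum>x\<in>X. p x * vn_entropy (R x)) \<le> (\<Sum>x\<in>X. p x * log 2 d)"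
    using p R vn_entropy_le_log by (intro sum_mono mult_left_mono) auto
  moreover have "(\<Sum>x\<in>X. p x * log 2 d) = log 2 d" using p by (simp add: sum_distrib_right[symmetric])
  ultimately show ?thesis using vn_entropy_nonneg[OF D] vn_entropy_le_log[OF D] unfolding chi_def by linarith
qed

lemma distr_avg_le:
  assumes "is_distr n p" "\<And>y. y < n \<Longrightarrow> \<bar>f y\<bar> \<le> B"
  shows "\<bar>\<Sum>y<n. p y * f y\<bar> \<le> B"
proof -
  have "\<bar>\<Sum>y<n. p y * f y\<bar> \<le> (\<Sum>y<n. p y * B)"
    using assms is_distrD(1)[OF assms(1)] by (intro order_trans[OF sum_abs] sum_mono) (auto simp: abs_mult intro!: mult_left_mono)
  also have "\<dots> = B" using is_distrD(2)[OF assms(1)] by (simp add: sum_distrib_right[symmetric])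
  finally show ?thesis .
qed

lemma is_distr_prod:
  assumes p: "is_distr a1 p1" "is_distr a2 p2"
  shows "\<And>z. z \<in> {..<a1} \<times> {..<a2} \<Longrightarrow> 0 \<le> (\<lambda>(x, y). p1 x * p2 y) z"
    "sum (\<lambda>(x, y). p1 x * p2 y) ({..<a1} \<times> {..<a2}) = 1"
  using is_distrD[OF p(1)] is_distrD[OF p(2)]
  by (auto simp: sum.cartesian_product[symmetric] sum_product[symmetric])

lemma side_info_abs_le:
  assumes "\<And>x y. x < a \<Longrightarrow> y < b \<Longrightarrow> density d (R x y)" and p: "is_distr a p" and r: "is_distr b r"
  shows "\<bar>side_info d a b R p r\<bar> \<le> log 2 d"
  unfolding side_info_def by (rule distr_avg_le[OF r], rule chi_abs_le) (use assms(1) is_distrD[OF p] in auto)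

lemma info_abs_le:
  assumes rho: "\<And>x y. x < a1 \<Longrightarrow> y < a2 \<Longrightarrow> density (d1 * d2) (rho x y)"
    and p: "is_distr a1 p1" "is_distr a2 p2" and d: "0 < d1" "0 < d2"
  shows "\<bar>info1 a1 a2 d1 d2 rho p1 p2\<bar> \<le> log 2 (d1 * d2)" "\<bar>info2 a1 a2 d1 d2 rho p1 p2\<bar> \<le> log 2 (d1 * d2)"
    "\<bar>info3 a1 a2 d1 d2 rho p1 p2\<bar> \<le> log 2 (d1 * d2)"
proof -
  have l: "log 2 d1 \<le> log 2 (d1 * d2)" "log 2 d2 \<le> log 2 (d1 * d2)"
    using d by (auto simp: log_mult)
  show "\<bar>info1 a1 a2 d1 d2 rho p1 p2\<bar> \<le> log 2 (d1 * d2)"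
    unfolding info1_def by (rule order_trans[OF side_info_abs_le[OF density_red1[OF rho] p] l(1)])
  show "\<bar>info2 a1 a2 d1 d2 rho p1 p2\<bar> \<le> log 2 (d1 * d2)"
    unfolding info2_def by (rule order_trans[OF side_info_abs_le[OF density_red2[OF rho] p(2,1)] l(2)])
  show "\<bar>info3 a1 a2 d1 d2 rho p1 p2\<bar> \<le> log 2 (d1 * d2)"
    unfolding info3_def by (rule chi_abs_le) (use rho is_distr_prod[OF p] in auto)
qed

text \<open>Input distributions are functions on all of \<open>nat\<close> of which only the first
  values matter, so the convergent subsequence is extracted one coordinate at a time.\<close>

lemma convergent_subseq_coords:
  fixes f :: "nat \<Rightarrow> nat \<Rightarrow> real"
  assumes "\<And>n x. x < a \<Longrightarrow> f n x \<in> {0..1}"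
  shows "\<exists>r. strict_mono r \<and> (\<forall>x<a. convergent (\<lambda>n. f (r n) x))"
  using assms
proof (induction a)
  case 0
  then show ?case by (intro exI[of _ id]) (auto simp: strict_mono_def)
next
  case (Suc a)
  then obtain r where r: "strict_mono r" "\<forall>x<a. convergent (\<lambda>n. f (r n) x)" by fastforce
  have "seq_compact {0..1::real}" by (simp add: compact_imp_seq_compact)
  then obtain l r' where r': "strict_mono r'" "((\<lambda>n. f (r n) a) \<circ> r') \<longlonglongrightarrow> l"
    unfolding seq_compact_def using Suc.prems[of a] by (metis lessI)
  have "convergent (\<lambda>n. f ((r \<circ> r') n) x)" if "x < Suc a" for x
  proof (cases "x = a")
    case True
    then show ?thesis using r'(2) by (auto simp: convergent_def comp_def)
  next
    case False
    then have "convergent (\<lambda>n. f (r n) x)" using r(2) that by simp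
    from convergent_subseq_convergent[OF this r'(1)] show ?thesis by (simp add: comp_def)
  qed
  then show ?case using strict_mono_o[OF r(1) r'(1)] by blast
qed

lemma is_distr_le_1: "is_distr n p \<Longrightarrow> x < n \<Longrightarrow> p x \<in> {0..1}"
  using member_le_sum[of x "{..<n}" p] by (auto simp: is_distr_def)

lemma is_distr_limit:
  fixes f :: "nat \<Rightarrow> nat \<Rightarrow> real"
  assumes "\<And>n. is_distr a (f n)" "\<And>x. x < a \<Longrightarrow> (\<lambda>n. f n x) \<longlonglongrightarrow> p x"
  shows "is_distr a p"
proof -
  have "0 \<le> p x" if "x < a" for x
    using assms that by (intro LIMSEQ_le_const[OF assms(2)[OF that]]) (auto simp: is_distr_def)
  moreover have "(\<lambda>n. \<Sum>x<a. f n x) \<longlonglongrightarrow> (\<Sum>x<a. p x)" using assms(2) by (intro tendsto_sum) auto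
  then have "(\<Sum>x<a. p x) = 1"
    using assms(1) by (simp add: is_distr_def LIMSEQ_const_iff)
  ultimately show ?thesis by (simp add: is_distr_def)
qed

lemma distr_convergent_subseq:
  fixes f1 f2 :: "nat \<Rightarrow> nat \<Rightarrow> real"
  assumes "\<And>n. is_distr a1 (f1 n)" "\<And>n. is_distr a2 (f2 n)"
  shows "\<exists>r p1 p2. strict_mono r \<and> is_distr a1 p1 \<and> is_distr a2 p2 \<and>
    (\<forall>x<a1. (\<lambda>n. f1 (r n) x) \<longlonglongrightarrow> p1 x) \<and> (\<forall>y<a2. (\<lambda>n. f2 (r n) y) \<longlonglongrightarrow> p2 y)"
proof -
  obtain r where r: "strict_mono r" "\<forall>x<a1. convergent (\<lambda>n. f1 (r n) x)"
    using convergent_subseq_coords[of a1 f1] is_distr_le_1[OF assms(1)] by blast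
  obtain r' where r': "strict_mono r'" "\<forall>x<a2. convergent (\<lambda>n. f2 (r (r' n)) x)"
    using convergent_subseq_coords[of a2 "\<lambda>n. f2 (r n)"] is_distr_le_1[OF assms(2)] by blast
  have c1: "convergent (\<lambda>n. f1 (r (r' n)) x)" if "x < a1" for x
    using convergent_subseq_convergent[OF r(2)[rule_format, OF that] r'(1)] by (simp add: comp_def)
  define p1 where "p1 = (\<lambda>x. lim (\<lambda>n. f1 (r (r' n)) x))"
  define p2 where "p2 = (\<lambda>x. lim (\<lambda>n. f2 (r (r' n)) x))"
  have l1: "(\<lambda>n. f1 (r (r' n)) x) \<longlonglongrightarrow> p1 x" if "x < a1" for x
    using c1[OF that] unfolding p1_def by (simp add: convergent_LIMSEQ_iff)
  have l2: "(\<lambda>n. f2 (r (r' n)) x) \<longlonglongrightarrow> p2 x" if "x < a2" for x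
    using r'(2) that unfolding p2_def by (simp add: convergent_LIMSEQ_iff)
  have "is_distr a1 p1" using is_distr_limit[of a1 "\<lambda>n. f1 (r (r' n))"] assms(1) l1 by blast
  moreover have "is_distr a2 p2" using is_distr_limit[of a2 "\<lambda>n. f2 (r (r' n))"] assms(2) l2 by blast
  moreover have "strict_mono (r \<circ> r')" by (rule strict_mono_o[OF r(1) r'(1)])
  ultimately show ?thesis using l1 l2 by (intro exI[of _ "r \<circ> r'"] exI[of _ p1] exI[of _ p2]) simp
qed

text \<open>Upper semicontinuity along a sequence: the dominating sequences \<open>y\<close> will be
  the affine bounds, which do converge because they are continuous in the input
  distributions.\<close>

lemma limit_le:
  fixes x :: "nat \<Rightarrow> real"
  assumes x: "x \<longlonglongrightarrow> l" and bound: "\<And>eps. 0 < eps \<Longrightarrow> \<exists>y. (\<forall>n. x n \<le> y n) \<and> (\<exists>m. y \<longlonglongrightarrow> m \<and> m \<le> c + eps)"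
  shows "l \<le> c"
proof (rule field_le_epsilon)
  fix eps :: real assume "0 < eps"
  then obtain y m where "\<forall>n. x n \<le> y n" "y \<longlonglongrightarrow> m" "m \<le> c + eps" using bound by blast
  then show "l \<le> c + eps" using LIMSEQ_le[OF x] by (meson order_trans)
qed

text \<open>For each \<open>y\<close> an affine bound that is almost tight at \<open>p1\<close> is
  chosen. Averaging these bounds with the law of \<open>y\<close> gives a bilinear, hence
  continuous, bound in the two distributions.\<close>

lemma side_info_limit_le:
  assumes R: "\<And>x y. x < a \<Longrightarrow> y < b \<Longrightarrow> density d (R x y)"
    and f: "\<And>n. is_distr a (f1 n)" "\<And>n. is_distr b (f2 n)"
    and p: "is_distr a p1" "is_distr b p2"
    and l: "\<And>x. x < a \<Longrightarrow> (\<lambda>n. f1 n x) \<longlonglongrightarrow> p1 x" "\<And>y. y < b \<Longrightarrow> (\<lambda>n. f2 n y) \<longlonglongrightarrow> p2 y"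
    and t: "t \<longlonglongrightarrow> c" and le: "\<And>n. t n \<le> side_info d a b R (f1 n) (f2 n)"
  shows "c \<le> side_info d a b R p1 p2"
proof (rule limit_le[OF t])
  note D = is_distrD
  fix eps :: real assume eps: "0 < eps"
  have "\<forall>y. \<exists>h. y < b \<longrightarrow> (\<forall>p'. (\<forall>x\<in>{..<a}. 0 \<le> p' x) \<and> sum p' {..<a} = 1 \<longrightarrow>
      chi d {..<a} p' (\<lambda>x. R x y) \<le> (\<Sum>x<a. p' x * h x)) \<and>
      (\<Sum>x<a. p1 x * h x) \<le> chi d {..<a} p1 (\<lambda>x. R x y) + eps"
    using chi_affine_bound[OF finite_lessThan R D(1)[OF p(1)] D(2)[OF p(1)] eps] by simp
  then obtain h where h: "\<forall>y. y < b \<longrightarrow> (\<forall>p'. (\<forall>x\<in>{..<a}. 0 \<le> p' x) \<and> sum p' {..<a} = 1 \<longrightarrow>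
      chi d {..<a} p' (\<lambda>x. R x y) \<le> (\<Sum>x<a. p' x * h y x)) \<and>
      (\<Sum>x<a. p1 x * h y x) \<le> chi d {..<a} p1 (\<lambda>x. R x y) + eps"
    unfolding choice_iff by blast
  let ?Y = "\<lambda>n. \<Sum>y<b. f2 n y * (\<Sum>x<a. f1 n x * h y x)"
  have "t n \<le> ?Y n" for n
  proof (rule order_trans[OF le], unfold side_info_def, intro sum_mono mult_left_mono)
    fix y assume "y \<in> {..<b}"
    then show "chi d {..<a} (f1 n) (\<lambda>x. R x y) \<le> (\<Sum>x<a. f1 n x * h y x)" "0 \<le> f2 n y"
      using h D[OF f(1)[of n]] D[OF f(2)[of n]] by auto
  qed
  moreover have "?Y \<longlonglongrightarrow> (\<Sum>y<b. p2 y * (\<Sum>x<a. p1 x * h y x))"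
    using l by (intro tendsto_sum tendsto_mult tendsto_const) auto
  moreover have "(\<Sum>y<b. p2 y * (\<Sum>x<a. p1 x * h y x)) \<le> side_info d a b R p1 p2 + eps"
  proof -
    have "(\<Sum>y<b. p2 y * (\<Sum>x<a. p1 x * h y x)) \<le> (\<Sum>y<b. p2 y * (chi d {..<a} p1 (\<lambda>x. R x y) + eps))"
      using h D[OF p(2)] by (intro sum_mono mult_left_mono) auto
    also have "\<dots> = side_info d a b R p1 p2 + eps"
      using D(2)[OF p(2)] by (simp add: side_info_def distrib_left sum.distrib sum_distrib_right[symmetric])
    finally show ?thesis .
  qed
  ultimately show "\<exists>y. (\<forall>n. t n \<le> y n) \<and> (\<exists>m. y \<longlonglongrightarrow> m \<and> m \<le> side_info d a b R p1 p2 + eps)"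
    by (intro exI[of _ ?Y]) blast
qed

lemma info3_limit_le:
  assumes rho: "\<And>x y. x < a1 \<Longrightarrow> y < a2 \<Longrightarrow> density (d1 * d2) (rho x y)"
    and f: "\<And>n. is_distr a1 (f1 n)" "\<And>n. is_distr a2 (f2 n)"
    and p: "is_distr a1 p1" "is_distr a2 p2"
    and l: "\<And>x. x < a1 \<Longrightarrow> (\<lambda>n. f1 n x) \<longlonglongrightarrow> p1 x" "\<And>y. y < a2 \<Longrightarrow> (\<lambda>n. f2 n y) \<longlonglongrightarrow> p2 y"
    and t: "t \<longlonglongrightarrow> c" and le: "\<And>n. t n \<le> info3 a1 a2 d1 d2 rho (f1 n) (f2 n)"
  shows "c \<le> info3 a1 a2 d1 d2 rho p1 p2"
proof (rule limit_le[OF t])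
  fix eps :: real assume eps: "0 < eps"
  let ?X = "{..<a1} \<times> {..<a2}"
  have "\<exists>h. (\<forall>p'. (\<forall>z\<in>?X. 0 \<le> p' z) \<and> sum p' ?X = 1 \<longrightarrow> chi (d1 * d2) ?X p' (\<lambda>(x, y). rho x y) \<le> (\<Sum>z\<in>?X. p' z * h z)) \<and>
    (\<Sum>z\<in>?X. (\<lambda>(x, y). p1 x * p2 y) z * h z) \<le> chi (d1 * d2) ?X (\<lambda>(x, y). p1 x * p2 y) (\<lambda>(x, y). rho x y) + eps"
    by (rule chi_affine_bound[OF _ _ is_distr_prod[OF p] eps]) (use rho in auto)
  then obtain h where h: "\<And>p'. (\<forall>z\<in>?X. 0 \<le> p' z) \<and> sum p' ?X = 1 \<Longrightarrow> chi (d1 * d2) ?X p' (\<lambda>(x, y). rho x y) \<le> (\<Sum>z\<in>?X. p' z * h z)"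
    and h2: "(\<Sum>z\<in>?X. (\<lambda>(x, y). p1 x * p2 y) z * h z) \<le> info3 a1 a2 d1 d2 rho p1 p2 + eps"
    unfolding info3_def by blast
  let ?Y = "\<lambda>n. \<Sum>z\<in>?X. (\<lambda>(x, y). f1 n x * f2 n y) z * h z"
  have "t n \<le> ?Y n" for n
    by (rule order_trans[OF le]) (unfold info3_def, rule h, use is_distr_prod[OF f(1)[of n] f(2)[of n]] in blast)
  moreover have "?Y \<longlonglongrightarrow> (\<Sum>z\<in>?X. (\<lambda>(x, y). p1 x * p2 y) z * h z)"
    using l by (intro tendsto_sum tendsto_mult tendsto_const) (auto intro!: tendsto_mult)
  ultimately show "\<exists>y. (\<forall>n. t n \<le> y n) \<and> (\<exists>m. y \<longlonglongrightarrow> m \<and> m \<le> info3 a1 a2 d1 d2 rho p1 p2 + eps)"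
    using h2 by (intro exI[of _ ?Y]) blast
qed

text \<open>Taking everything below the attained triples makes the set closed by upper semicontinuity
  alone; the cube makes it bounded.\<close>

definition triples :: "nat \<Rightarrow> nat \<Rightarrow> nat \<Rightarrow> nat \<Rightarrow> (nat \<Rightarrow> nat \<Rightarrow> complex mat) \<Rightarrow> (real \<times> real \<times> real) set" where
  "triples a1 a2 d1 d2 rho = {(t1, t2, t3). \<bar>t1\<bar> \<le> log 2 (d1 * d2) \<and> \<bar>t2\<bar> \<le> log 2 (d1 * d2) \<and> \<bar>t3\<bar> \<le> log 2 (d1 * d2) \<and>
     (\<exists>p1 p2. is_distr a1 p1 \<and> is_distr a2 p2 \<and> t1 \<le> info1 a1 a2 d1 d2 rho p1 p2 \<and>
        t2 \<le> info2 a1 a2 d1 d2 rho p1 p2 \<and> t3 \<le> info3 a1 a2 d1 d2 rho p1 p2)}"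

text \<open>One subsequence of the two input distributions passes to the limit in all three
  coordinates, so that the limiting triple again has a single pair of witnesses.\<close>

lemma compact_triples:
  assumes rho: "\<And>x y. x < a1 \<Longrightarrow> y < a2 \<Longrightarrow> density (d1 * d2) (rho x y)"
  shows "compact (triples a1 a2 d1 d2 rho)"
proof -
  let ?B = "log 2 (d1 * d2)"
  have "triples a1 a2 d1 d2 rho \<subseteq> {-?B..?B} \<times> {-?B..?B} \<times> {-?B..?B}"
    by (auto simp: triples_def)
  then have "bounded (triples a1 a2 d1 d2 rho)"
    by (rule bounded_subset[rotated]) (intro bounded_Times bounded_closed_interval)
  moreover have "closed (triples a1 a2 d1 d2 rho)"
    unfolding closed_sequential_limits
  proof (intro allI impI, elim conjE)
    fix x :: "nat \<Rightarrow> real \<times> real \<times> real" and l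
    assume x: "\<forall>n. x n \<in> triples a1 a2 d1 d2 rho" and xl: "x \<longlonglongrightarrow> l"
    let ?x1 = "\<lambda>n. fst (x n)" and ?x2 = "\<lambda>n. fst (snd (x n))" and ?x3 = "\<lambda>n. snd (snd (x n))"
    have lim: "?x1 \<longlonglongrightarrow> fst l" "?x2 \<longlonglongrightarrow> fst (snd l)" "?x3 \<longlonglongrightarrow> snd (snd l)"
      using xl by (auto intro!: tendsto_fst tendsto_snd)
    have "\<forall>n. \<exists>p1 p2. is_distr a1 p1 \<and> is_distr a2 p2 \<and> ?x1 n \<le> info1 a1 a2 d1 d2 rho p1 p2 \<and>
        ?x2 n \<le> info2 a1 a2 d1 d2 rho p1 p2 \<and> ?x3 n \<le> info3 a1 a2 d1 d2 rho p1 p2"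
      and ab: "\<bar>?x1 n\<bar> \<le> ?B" "\<bar>?x2 n\<bar> \<le> ?B" "\<bar>?x3 n\<bar> \<le> ?B" for n
      using x unfolding triples_def by (auto simp: case_prod_beta)
    then obtain f1 f2 where f: "\<And>n. is_distr a1 (f1 n)" "\<And>n. is_distr a2 (f2 n)"
      and le: "\<And>n. ?x1 n \<le> info1 a1 a2 d1 d2 rho (f1 n) (f2 n)" "\<And>n. ?x2 n \<le> info2 a1 a2 d1 d2 rho (f1 n) (f2 n)"
        "\<And>n. ?x3 n \<le> info3 a1 a2 d1 d2 rho (f1 n) (f2 n)"
      unfolding choice_iff by blast
    obtain r p1 p2 where r: "strict_mono r" and p: "is_distr a1 p1" "is_distr a2 p2"
      and pl: "\<And>x. x < a1 \<Longrightarrow> (\<lambda>n. f1 (r n) x) \<longlonglongrightarrow> p1 x" "\<And>y. y < a2 \<Longrightarrow> (\<lambda>n. f2 (r n) y) \<longlonglongrightarrow> p2 y"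
      using distr_convergent_subseq[of a1 f1 a2 f2] f by blast
    have sub: "(\<lambda>n. y (r n)) \<longlonglongrightarrow> z" if "y \<longlonglongrightarrow> z" for y :: "nat \<Rightarrow> real" and z
      using LIMSEQ_subseq_LIMSEQ[OF that r] by (simp add: comp_def)
    have "fst l \<le> info1 a1 a2 d1 d2 rho p1 p2"
      using lim(1) le(1) unfolding info1_def by (intro side_info_limit_le[OF density_red1[OF rho] f(1) f(2) p pl sub])
    moreover have "fst (snd l) \<le> info2 a1 a2 d1 d2 rho p1 p2"
      using lim(2) le(2) unfolding info2_def by (intro side_info_limit_le[OF density_red2[OF rho] f(2) f(1) p(2,1) pl(2,1) sub])
    moreover have "snd (snd l) \<le> info3 a1 a2 d1 d2 rho p1 p2"
      using lim(3) le(3) by (intro info3_limit_le[OF rho f p pl sub])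
    moreover have "\<bar>fst l\<bar> \<le> ?B" "\<bar>fst (snd l)\<bar> \<le> ?B" "\<bar>snd (snd l)\<bar> \<le> ?B"
      using ab by (auto intro!: LIMSEQ_le_const2[OF tendsto_rabs[OF lim(1)]] LIMSEQ_le_const2[OF tendsto_rabs[OF lim(2)]]
          LIMSEQ_le_const2[OF tendsto_rabs[OF lim(3)]])
    ultimately show "l \<in> triples a1 a2 d1 d2 rho"
      unfolding triples_def using p by (auto simp: case_prod_beta)
  qed
  ultimately show ?thesis by (simp add: compact_eq_bounded_closed)
qed

section \<open>From the convex hull and from codes to the Sato region\<close>

lemma hull_triples_sato:
  assumes ch: "is_ccqq_channel a1 a2 d1 d2 rho"
    and t: "(t1, t2, t3) \<in> convex hull (triples a1 a2 d1 d2 rho)"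
    and R: "R1 \<le> t1" "R2 \<le> t2" "R1 + R2 \<le> t3"
  shows "(R1, R2) \<in> sato_region a1 a2 d1 d2 rho"
proof -
  have rho: "density (d1 * d2) (rho x y)" if "x < a1" "y < a2" for x y
    using ch that by (auto simp: is_ccqq_channel_def)
  obtain k u z where u: "\<forall>i\<in>{1..k::nat}. 0 \<le> u i \<and> z i \<in> triples a1 a2 d1 d2 rho" and u1: "sum u {1..k} = 1"
    and s: "(\<Sum>i = 1..k. u i *\<^sub>R z i) = (t1, t2, t3)"
    using t unfolding convex_hull_indexed by blast
  have k: "0 < k" using u1 by (cases k) auto
  \<comment> \<open>The coefficients of the convex combination become the law of the time-sharing
    variable. Combinations are indexed from one and alphabets from zero, hence the shift by
    \<open>Suc\<close>.\<close>
  define pQ where "pQ = (\<lambda>q. u (Suc q))"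
  define w where "w = (\<lambda>q. z (Suc q))"
  have pQ: "is_distr k pQ" using u u1 by (auto simp: is_distr_def pQ_def sum.atLeast1_atMost_eq)
  have w: "w q \<in> triples a1 a2 d1 d2 rho" if "q < k" for q using u that by (auto simp: w_def)
  have sw: "(\<Sum>q<k. pQ q *\<^sub>R w q) = (t1, t2, t3)" using s by (simp add: sum.atLeast1_atMost_eq pQ_def w_def)
  have "\<forall>q. \<exists>p1 p2. q < k \<longrightarrow> is_distr a1 p1 \<and> is_distr a2 p2 \<and> fst (w q) \<le> info1 a1 a2 d1 d2 rho p1 p2 \<and>
        fst (snd (w q)) \<le> info2 a1 a2 d1 d2 rho p1 p2 \<and> snd (snd (w q)) \<le> info3 a1 a2 d1 d2 rho p1 p2"
    using w unfolding triples_def by (auto simp: case_prod_beta)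
  then obtain p1 p2 where p: "\<And>q. q < k \<Longrightarrow> is_distr a1 (p1 q)" "\<And>q. q < k \<Longrightarrow> is_distr a2 (p2 q)"
    and le: "\<And>q. q < k \<Longrightarrow> fst (w q) \<le> info1 a1 a2 d1 d2 rho (p1 q) (p2 q)"
      "\<And>q. q < k \<Longrightarrow> fst (snd (w q)) \<le> info2 a1 a2 d1 d2 rho (p1 q) (p2 q)"
      "\<And>q. q < k \<Longrightarrow> snd (snd (w q)) \<le> info3 a1 a2 d1 d2 rho (p1 q) (p2 q)"
    unfolding choice_iff by blast
  have pos: "0 \<le> pQ q" if "q < k" for q using pQ that by (simp add: is_distr_def)
  have "t1 = (\<Sum>q<k. pQ q * fst (w q))" "t2 = (\<Sum>q<k. pQ q * fst (snd (w q)))" "t3 = (\<Sum>q<k. pQ q * snd (snd (w q)))"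
    using arg_cong[OF sw, of fst] arg_cong[OF sw, of "\<lambda>x. fst (snd x)"] arg_cong[OF sw, of "\<lambda>x. snd (snd x)"]
    by (simp_all add: fst_sum snd_sum)
  then have "t1 \<le> (\<Sum>q<k. pQ q * info1 a1 a2 d1 d2 rho (p1 q) (p2 q))"
    "t2 \<le> (\<Sum>q<k. pQ q * info2 a1 a2 d1 d2 rho (p1 q) (p2 q))"
    "t3 \<le> (\<Sum>q<k. pQ q * info3 a1 a2 d1 d2 rho (p1 q) (p2 q))"
    using le pos by (auto intro!: sum_mono mult_left_mono)
  moreover have "cmi [k, a1, a2, d1, d2] (theta a1 a2 d1 d2 rho k pQ p1 p2) {1} {3} {2, 0} = (\<Sum>q<k. pQ q * info1 a1 a2 d1 d2 rho (p1 q) (p2 q))"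
    "cmi [k, a1, a2, d1, d2] (theta a1 a2 d1 d2 rho k pQ p1 p2) {2} {4} {1, 0} = (\<Sum>q<k. pQ q * info2 a1 a2 d1 d2 rho (p1 q) (p2 q))"
    "cmi [k, a1, a2, d1, d2] (theta a1 a2 d1 d2 rho k pQ p1 p2) {1, 2} {3, 4} {0} = (\<Sum>q<k. pQ q * info3 a1 a2 d1 d2 rho (p1 q) (p2 q))"
    by (rule cmi_theta[OF rho pQ p]; assumption)+
  ultimately have "R1 \<le> cmi [k, a1, a2, d1, d2] (theta a1 a2 d1 d2 rho k pQ p1 p2) {1} {3} {2, 0}"
    "R2 \<le> cmi [k, a1, a2, d1, d2] (theta a1 a2 d1 d2 rho k pQ p1 p2) {2} {4} {1, 0}"
    "R1 + R2 \<le> cmi [k, a1, a2, d1, d2] (theta a1 a2 d1 d2 rho k pQ p1 p2) {1, 2} {3, 4} {0}"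
    using R by linarith+
  then show ?thesis
    unfolding sato_region_def Let_def mem_Collect_eq prod.case
    using k pQ p by (intro exI[of _ k] conjI exI[of _ pQ] exI[of _ p1] exI[of _ p2]) auto
qed

text \<open>Of the two losses \<open>e\<close>, one pays for the factor in front of
  \<open>log 2 M\<close> and one for the additive constants of \<open>gap\<close>. Rates of either
  sign occur, since achievability does not force them to be nonnegative; this explains the absolute
  value.\<close>

lemma rate_le:
  assumes n: "0 < n" and L: "0 \<le> log 2 M" "real n * S \<le> log 2 M" and gap: "gap eps g M \<le> V"
    and c: "0 \<le> 2 * (eps + g)" "2 * (eps + g) \<le> 1" "2 * (eps + g) * \<bar>S\<bar> \<le> e" and N: "1 / ln 2 - log 2 g \<le> real n * e"
  shows "S - 2 * e \<le> V / real n"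
proof -
  let ?c = "2 * (eps + g)"
  have "real n * S - ?c * (real n * \<bar>S\<bar>) \<le> (1 - ?c) * log 2 M"
  proof (cases "0 \<le> S")
    case True
    have "(1 - ?c) * (real n * S) \<le> (1 - ?c) * log 2 M" using L(2) c(2) by (intro mult_left_mono) auto
    then show ?thesis using True by (simp add: algebra_simps)
  next
    \<comment> \<open>A codebook has at least one message, so the right-hand side is nonnegative,
      while a negative rate makes the left-hand side nonpositive.\<close>
    case False
    then have "real n * S \<le> 0" by (simp add: mult_nonneg_nonpos)
    moreover have "0 \<le> ?c * (real n * \<bar>S\<bar>)" using c(1) by simp
    moreover have "0 \<le> (1 - ?c) * log 2 M" using L(1) c(2) by simp
    ultimately show ?thesis by linarith
  qed
  moreover have "?c * (real n * \<bar>S\<bar>) \<le> real n * e"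
    using mult_left_mono[OF c(3), of "real n"] by (simp add: mult_ac)
  ultimately have "real n * (S - 2 * e) \<le> V" using gap N unfolding gap_def by (simp add: algebra_simps)
  then show ?thesis using n by (simp add: field_simps)
qed

lemma log_msize: "real n * R \<le> log 2 (real (msize n R))" "0 \<le> log 2 (real (msize n R))"
proof -
  have "2 powr (real n * R) \<le> real (msize n R)" unfolding msize_def by linarith
  then have "log 2 (2 powr (real n * R)) \<le> log 2 (real (msize n R))"
    using msize_pos[of n R] by (subst log_le_cancel_iff) auto
  then show "real n * R \<le> log 2 (real (msize n R))" by simp
  show "0 \<le> log 2 (real (msize n R))" using msize_pos[of n R] by simp
qed

lemma achievable_hull:
  assumes ch: "is_ccqq_channel a1 a2 d1 d2 rho" and ach: "achievable a1 a2 d1 d2 rho (R1, R2)" and delta: "0 < delta"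
  shows "\<exists>t1 t2 t3. (t1, t2, t3) \<in> convex hull (triples a1 a2 d1 d2 rho) \<and> R1 - delta \<le> t1 \<and> R2 - delta \<le> t2 \<and> R1 + R2 - delta \<le> t3"
proof -
  have d: "0 < d1" "0 < d2" and rho: "\<And>x y. x < a1 \<Longrightarrow> y < a2 \<Longrightarrow> density (d1 * d2) (rho x y)"
    using ch by (auto simp: is_ccqq_channel_def)
  \<comment> \<open>A single rate loses \<open>e\<close> by the definition of achievability and
    \<open>2 * e\<close> in \<open>rate_le\<close>. The sum rate loses \<open>2 * e\<close> each
    time, \<open>4 * e\<close> in all.\<close>
  define e where "e = delta / 4"
  have e: "0 < e" using delta by (simp add: e_def)
  \<comment> \<open>Dominates the absolute values of the two shifted rates and of their sum, so that
    one \<open>g\<close> works for all three.\<close>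
  define m where "m = \<bar>R1\<bar> + \<bar>R2\<bar> + 2 * e + 1"
  have m: "0 < m" using e by (simp add: m_def)
  \<comment> \<open>Used both as the error of the code and as the free parameter of
    \<open>gap\<close>. The factor lost in front of \<open>log 2 M\<close> is
    \<open>2 * (g + g)\<close>; the first bound keeps it at most one, the second keeps its product
    with any of the rates at most \<open>e\<close>.\<close>
  define g where "g = min (1 / 4) (e / (4 * m))"
  have g: "0 < g" "g \<le> 1" "2 * (g + g) \<le> 1" using e m by (auto simp: g_def)
  have gm: "2 * (g + g) * m \<le> e"
  proof -
    have "g * (4 * m) \<le> e / (4 * m) * (4 * m)" using m by (intro mult_right_mono) (auto simp: g_def)
    then show ?thesis using m by (simp add: algebra_simps)
  qed
  have gS: "2 * (g + g) * \<bar>S\<bar> \<le> e" if "\<bar>S\<bar> \<le> m" for S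
    by (rule order_trans[OF mult_left_mono[OF that] gm]) (use g in simp)
  obtain N where N: "\<forall>n\<ge>N. has_code a1 a2 d1 d2 rho n (R1 - e) (R2 - e) g"
    using ach[unfolded achievable_def fst_conv snd_conv] e g(1) by blast
  obtain N' :: nat where N': "(1 / ln 2 - log 2 g) / e \<le> real N'" using real_arch_simple by blast
  \<comment> \<open>\<open>Suc N\<close> makes the length positive, and \<open>N'\<close> makes the
    additive constants at most \<open>e\<close> per letter.\<close>
  define n where "n = max (Suc N) N'"
  have n: "0 < n" "N \<le> n" by (auto simp: n_def)
  have ne: "1 / ln 2 - log 2 g \<le> real n * e"
  proof -
    have "(1 / ln 2 - log 2 g) / e \<le> real n" using N' by (simp add: n_def)
    then show ?thesis using e by (simp add: field_simps)
  qed
  let ?M1 = "msize n (R1 - e)" and ?M2 = "msize n (R2 - e)"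
  obtain p1 p2 where p: "\<forall>t<n. is_distr a1 (p1 t) \<and> is_distr a2 (p2 t)"
    and b: "\<forall>g'. 0 < g' \<and> g' \<le> 1 \<longrightarrow> gap g g' (real ?M1) \<le> (\<Sum>t<n. info1 a1 a2 d1 d2 rho (p1 t) (p2 t)) \<and>
      gap g g' (real ?M2) \<le> (\<Sum>t<n. info2 a1 a2 d1 d2 rho (p1 t) (p2 t)) \<and>
      gap g g' (real (?M1 * ?M2)) \<le> (\<Sum>t<n. info3 a1 a2 d1 d2 rho (p1 t) (p2 t))"
    using code_bound[OF ch N[rule_format, OF n(2)]] by blast
  have M: "0 < ?M1" "0 < ?M2" by (rule msize_pos)+
  have lM: "log 2 (real (?M1 * ?M2)) = log 2 (real ?M1) + log 2 (real ?M2)" using M by (simp add: log_mult)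
  let ?V1 = "\<Sum>t<n. info1 a1 a2 d1 d2 rho (p1 t) (p2 t)" and ?V2 = "\<Sum>t<n. info2 a1 a2 d1 d2 rho (p1 t) (p2 t)"
    and ?V3 = "\<Sum>t<n. info3 a1 a2 d1 d2 rho (p1 t) (p2 t)"
  have c0: "0 \<le> 2 * (g + g)" using g by simp
  have "R1 - e - 2 * e \<le> ?V1 / real n"
    by (rule rate_le[OF n(1) log_msize(2,1) _ c0 g(3) gS ne]) (use b g e in \<open>auto simp: m_def\<close>)
  moreover have "R2 - e - 2 * e \<le> ?V2 / real n"
    by (rule rate_le[OF n(1) log_msize(2,1) _ c0 g(3) gS ne]) (use b g e in \<open>auto simp: m_def\<close>)
  moreover have "(R1 - e) + (R2 - e) - 2 * e \<le> ?V3 / real n"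
  proof (rule rate_le[OF n(1) _ _ _ c0 g(3) gS ne])
    show "0 \<le> log 2 (real (?M1 * ?M2))" unfolding lM using log_msize(2)[of n "R1 - e"] log_msize(2)[of n "R2 - e"] by simp
    show "real n * ((R1 - e) + (R2 - e)) \<le> log 2 (real (?M1 * ?M2))"
      unfolding lM distrib_left using log_msize(1)[of n "R1 - e"] log_msize(1)[of n "R2 - e"] by simp
    show "gap g g (real (?M1 * ?M2)) \<le> ?V3" using b g by blast
    show "\<bar>(R1 - e) + (R2 - e)\<bar> \<le> m" using e by (simp add: m_def)
  qed
  moreover have "(?V1 / real n, ?V2 / real n, ?V3 / real n) \<in> convex hull (triples a1 a2 d1 d2 rho)"
  proof -
    \<comment> \<open>Dividing by \<open>n\<close> makes the sums over time a convex combination: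
      time is a uniform time-sharing variable.\<close>
    let ?z = "\<lambda>t. (info1 a1 a2 d1 d2 rho (p1 t) (p2 t), info2 a1 a2 d1 d2 rho (p1 t) (p2 t), info3 a1 a2 d1 d2 rho (p1 t) (p2 t))"
    have "?z t \<in> convex hull (triples a1 a2 d1 d2 rho)" if "t \<in> {..<n}" for t
    proof (rule hull_inc)
      have "is_distr a1 (p1 t)" "is_distr a2 (p2 t)" using p that by auto
      then show "?z t \<in> triples a1 a2 d1 d2 rho"
        unfolding triples_def using info_abs_le[OF rho _ _ d] by auto
    qed
    then have "(\<Sum>t<n. (1 / real n) *\<^sub>R ?z t) \<in> convex hull (triples a1 a2 d1 d2 rho)"
      using n by (intro convex_sum) (auto simp: convex_convex_hull)
    moreover have "(\<Sum>t<n. (1 / real n) *\<^sub>R ?z t) = (?V1 / real n, ?V2 / real n, ?V3 / real n)"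
      by (simp add: prod_eq_iff fst_sum snd_sum sum_divide_distrib)
    ultimately show ?thesis by simp
  qed
  ultimately show ?thesis
    by (intro exI[of _ "?V1 / real n"] exI[of _ "?V2 / real n"] exI[of _ "?V3 / real n"]) (use e in \<open>simp add: e_def\<close>)
qed

theorem theorem4:
  fixes a1 a2 d1 d2 :: nat and rho :: "nat \<Rightarrow> nat \<Rightarrow> complex mat"
  assumes "is_ccqq_channel a1 a2 d1 d2 rho"
  shows "capacity_region a1 a2 d1 d2 rho \<subseteq> sato_region a1 a2 d1 d2 rho"
proof
  fix R assume R: "R \<in> capacity_region a1 a2 d1 d2 rho"
  let ?H = "convex hull (triples a1 a2 d1 d2 rho)"
  obtain R1 R2 where R12: "R = (R1, R2)" by (cases R)
  have "compact ?H"
    using assms by (intro compact_convex_hull compact_triples) (auto simp: is_ccqq_channel_def)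
  \<comment> \<open>Passing to a nearby achievable pair costs \<open>delta / 4\<close> in each rate,
    hence \<open>delta / 2\<close> in their sum; the code costs another
    \<open>delta / 2\<close>.\<close>
  have approx: "\<exists>t. t \<in> ?H \<and> R1 - delta \<le> fst t \<and> R2 - delta \<le> fst (snd t) \<and> R1 + R2 - delta \<le> snd (snd t)"
    if delta: "0 < delta" for delta
  proof -
    obtain R' where R': "achievable a1 a2 d1 d2 rho R'" "dist R' R < delta / 4"
      using R delta unfolding capacity_region_def closure_approachable by (metis divide_pos_pos mem_Collect_eq zero_less_numeral)
    have "\<bar>fst R' - R1\<bar> \<le> dist R' R" "\<bar>snd R' - R2\<bar> \<le> dist R' R"
      using dist_fst_le[of R' R] dist_snd_le[of R' R] by (auto simp: R12 dist_real_def)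
    then have close: "\<bar>fst R' - R1\<bar> < delta / 4" "\<bar>snd R' - R2\<bar> < delta / 4" using R'(2) by linarith+
    obtain t1 t2 t3 where t: "(t1, t2, t3) \<in> ?H" "fst R' - delta / 2 \<le> t1" "snd R' - delta / 2 \<le> t2"
      "fst R' + snd R' - delta / 2 \<le> t3"
      using achievable_hull[OF assms, of "fst R'" "snd R'" "delta / 2"] R'(1) delta by auto
    have "R1 - delta \<le> t1" "R2 - delta \<le> t2" "R1 + R2 - delta \<le> t3"
      using close t(2-) delta by linarith+
    then show ?thesis using t(1) by (intro exI[of _ "(t1, t2, t3)"]) simp
  qed
  have "\<forall>n. \<exists>t. t \<in> ?H \<and> R1 - 1 / real (Suc n) \<le> fst t \<and> R2 - 1 / real (Suc n) \<le> fst (snd t) \<and> R1 + R2 - 1 / real (Suc n) \<le> snd (snd t)"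
    using approx by simp
  then obtain t where t: "\<And>n. t n \<in> ?H" "\<And>n. R1 - 1 / real (Suc n) \<le> fst (t n)" "\<And>n. R2 - 1 / real (Suc n) \<le> fst (snd (t n))"
    "\<And>n. R1 + R2 - 1 / real (Suc n) \<le> snd (snd (t n))"
    unfolding choice_iff by blast
  \<comment> \<open>The time-sharing alphabets may grow along the sequence, but by compactness the
    limit lies in the hull and is again a finite convex combination. This removes the slack
    \<open>delta\<close>.\<close>
  obtain l r where l: "l \<in> ?H" and r: "strict_mono r" and lim: "(t \<circ> r) \<longlonglongrightarrow> l"
    using compact_imp_seq_compact[OF \<open>compact ?H\<close>] t(1) unfolding seq_compact_def by blast
  have z: "(\<lambda>n. c - 1 / real (Suc (r n))) \<longlonglongrightarrow> c" for c
    using tendsto_diff[OF tendsto_const[of c] LIMSEQ_subseq_LIMSEQ[OF LIMSEQ_inverse_real_of_nat r]]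
    by (simp add: comp_def inverse_eq_divide)
  have "R1 \<le> fst l" by (rule LIMSEQ_le[OF z tendsto_fst[OF lim]]) (use t in \<open>auto simp: comp_def\<close>)
  moreover have "R2 \<le> fst (snd l)" by (rule LIMSEQ_le[OF z tendsto_fst[OF tendsto_snd[OF lim]]]) (use t in \<open>auto simp: comp_def\<close>)
  moreover have "R1 + R2 \<le> snd (snd l)" by (rule LIMSEQ_le[OF z tendsto_snd[OF tendsto_snd[OF lim]]]) (use t in \<open>auto simp: comp_def\<close>)
  moreover obtain l1 l2 l3 where "l = (l1, l2, l3)" by (cases l)
  ultimately show "R \<in> sato_region a1 a2 d1 d2 rho"
    unfolding R12 using hull_triples_sato[OF assms, of l1 l2 l3 R1 R2] l by simp
qed

end
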